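(* Let $t$ be even. Given two sets $A,B$ of $N$ tensors in $\{0,1\}^{2\times\cdots\times2}$ ($t$ factors) such that every tensor in $A$ is max-invariant, for any $L\ge 2^t$ there is a deterministic algorithm running in $O(N\cdot\mathrm{poly}(2^t)\cdot L)$ time that outputs two sets $A',B'$ of $N$ binary trees of size $O(\mathrm{poly}(2^t)\cdot L)$ and depth $O((2^{t/2}+\log L)\cdot t)$, with a correspondence $a\mapsto a'$, $b\mapsto b'$, such that for all $a\in A$, $b\in B$: $\mathrm{RLCST}(a',b')=(2^{t/2}s(a,b)+O(1))L$ and $\mathrm{LCST}(a',b')=(2^{t/2}s(a,b)+O(1))L$. In particular, if $s(a,b)=1$ then $\mathrm{RLCST}(a',b')=\mathrm{LCST}(a',b')=|a'|$.
   Context: Tensors indexed by $i\in\{0,1\}^t$; tropical similarity $s(u,v)=\mathbb{E}_{i_1}\max_{i_2}\mathbb{E}_{i_3}\cdots\max_{i_t}(u_i\cdot v_i)$, $\mathbb{E}$ the average over $\{0,1\}$. A tensor $x$ is max-invariant if $x_i$ does not depend on $i_2,i_4,\dots,i_t$. Trees are unordered; a subtree is obtained by removing nodes and edges. $\mathrm{LCST}(G,H)$ is the size of the largest tree isomorphic to a subtree of both $G$ and $H$ viewed as unrooted trees; $\mathrm{RLCST}(G,H)$ is the same for rooted trees (roots must be mapped to roots). $|a'|$ denotes the number of nodes of $a'$. *)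

theory Defs
  imports Complex_Main "HOL-Library.FuncSet" "HOL-Library.Tree"
begin

section \<open>Tensors and tropical similarity\<close>

text \<open>An index in $\{0,1\}^t$ is a \<^typ>\<open>bool list\<close> of length \<open>t\<close>; the coordinate $i_k$ is
  \<open>i ! (k - 1)\<close>, so the expectation coordinates $i_1, i_3, \dots$ sit at even list positions and
  the max coordinates $i_2, i_4, \dots$ at odd ones.\<close>

type_synonym tensor = "bool list \<Rightarrow> nat"

definition tensors :: "nat \<Rightarrow> tensor set" where
  "tensors t = {i. length i = t} \<rightarrow>\<^sub>E {0, 1}"

fun alternate :: "bool \<Rightarrow> nat \<Rightarrow> (bool list \<Rightarrow> real) \<Rightarrow> real" where
  "alternate avg 0 f = f []"
| "alternate avg (Suc n) f =
     (let g = (\<lambda>b. alternate (\<not> avg) n (\<lambda>i. f (b # i)))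
      in if avg then (g False + g True) / 2 else max (g False) (g True))"

definition tropical_similarity :: "nat \<Rightarrow> tensor \<Rightarrow> tensor \<Rightarrow> real" where
  "tropical_similarity t u v = alternate True t (\<lambda>i. real (u i * v i))"

definition max_invariant :: "nat \<Rightarrow> tensor \<Rightarrow> bool" where
  "max_invariant t x \<longleftrightarrow>
     (\<forall>i j. length i = t \<and> length j = t \<and> (\<forall>k<t. even k \<longrightarrow> i ! k = j ! k) \<longrightarrow> x i = x j)"

section \<open>Trees and largest common subtrees\<close>

type_synonym 'v ugraph = "'v set \<times> 'v set set"

abbreviation verts :: "'v ugraph \<Rightarrow> 'v set" where "verts G \<equiv> fst G"
abbreviation edges :: "'v ugraph \<Rightarrow> 'v set set" where "edges G \<equiv> snd G"

definition connected_graph :: "'v ugraph \<Rightarrow> bool" where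
  "connected_graph G \<longleftrightarrow> (\<forall>u\<in>verts G. \<forall>v\<in>verts G. (u, v) \<in> {(x, y). {x, y} \<in> edges G}\<^sup>*)"

definition is_cycle :: "'v ugraph \<Rightarrow> 'v list \<Rightarrow> bool" where
  "is_cycle G p \<longleftrightarrow> 3 \<le> length p \<and> distinct p \<and>
     (\<forall>i<length p. {p ! i, p ! (Suc i mod length p)} \<in> edges G)"

definition is_tree :: "'v ugraph \<Rightarrow> bool" where
  "is_tree G \<longleftrightarrow> finite (verts G) \<and> verts G \<noteq> {} \<and>
     (\<forall>e\<in>edges G. e \<subseteq> verts G \<and> card e = 2) \<and>
     connected_graph G \<and> (\<nexists>p. is_cycle G p)"

definition subtree :: "'v ugraph \<Rightarrow> 'v ugraph \<Rightarrow> bool" where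
  "subtree S G \<longleftrightarrow> is_tree S \<and> verts S \<subseteq> verts G \<and> edges S \<subseteq> edges G"

definition graph_iso :: "('u \<Rightarrow> 'v) \<Rightarrow> 'u ugraph \<Rightarrow> 'v ugraph \<Rightarrow> bool" where
  "graph_iso f G H \<longleftrightarrow> bij_betw f (verts G) (verts H) \<and>
     (\<forall>u\<in>verts G. \<forall>v\<in>verts G. {u, v} \<in> edges G \<longleftrightarrow> {f u, f v} \<in> edges H)"

definition LCST_graph :: "'v ugraph \<Rightarrow> 'v ugraph \<Rightarrow> nat" where
  "LCST_graph G H = Max {card (verts T) | T :: 'v ugraph. is_tree T \<and>
     (\<exists>S f. subtree S G \<and> graph_iso f T S) \<and>
     (\<exists>S f. subtree S H \<and> graph_iso f T S)}"

text \<open>A rooted tree is a tree together with its root; a rooted subtree keeps the root.\<close>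

definition RLCST_graph :: "'v ugraph \<times> 'v \<Rightarrow> 'v ugraph \<times> 'v \<Rightarrow> nat" where
  "RLCST_graph = (\<lambda>(G, r) (H, q). Max {card (verts T) | (T :: 'v ugraph) x.
     is_tree T \<and> x \<in> verts T \<and>
     (\<exists>S f. subtree S G \<and> r \<in> verts S \<and> graph_iso f T S \<and> f x = r) \<and>
     (\<exists>S f. subtree S H \<and> q \<in> verts S \<and> graph_iso f T S \<and> f x = q)})"

text \<open>A rooted binary tree is a nonempty \<^typ>\<open>unit tree\<close>: \<^const>\<open>Leaf\<close> stands for an absent child,
  so every node has at most two children and \<^const>\<open>size\<close> counts the nodes.  A node is named by
  the path leading to it from the root \<open>[]\<close>.  Passing to the graph forgets the order of the
  children.\<close>

fun positions :: "'a tree \<Rightarrow> bool list set" where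
  "positions Leaf = {}"
| "positions (Node l x r) =
     insert [] ((#) False ` positions l \<union> (#) True ` positions r)"

definition tree_graph :: "'a tree \<Rightarrow> bool list ugraph" where
  "tree_graph T = (positions T, {{p, p @ [b]} | p b. p @ [b] \<in> positions T})"

definition LCST :: "'a tree \<Rightarrow> 'a tree \<Rightarrow> nat" where
  "LCST T U = LCST_graph (tree_graph T) (tree_graph U)"

definition RLCST :: "'a tree \<Rightarrow> 'a tree \<Rightarrow> nat" where
  "RLCST T U = RLCST_graph (tree_graph T, []) (tree_graph U, [])"

text \<open>Depth counts edges, whereas \<^const>\<open>height\<close> counts nodes.\<close>

definition depth :: "'a tree \<Rightarrow> nat" where
  "depth T = height T - 1"

section \<open>Word RAM\<close>

text \<open>A deterministic unit-cost RAM with \<open>w\<close>-bit words and structured control flow.  It has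
  registers and arrays (a fixed program mentions finitely many of them, so a single memory
  would change the running time by a constant factor only) and a write-only output.  There is no
  execution in which a stored value overflows the word length.\<close>

datatype operand = Const nat | Reg nat
datatype arith = Plus | Minus | Times | Div | Mod
datatype expr = Atom operand | Arith arith operand operand | Get nat operand
datatype test = Less operand operand | Equal operand operand

datatype com =
    Assign nat expr
  | Put nat operand operand
  | Write operand
  | Seq com com
  | Cond test com com
  | While test com

record state =
  regs :: "nat \<Rightarrow> nat"
  arrays :: "nat \<Rightarrow> nat \<Rightarrow> nat"
  written :: "nat list"

fun operand_val :: "operand \<Rightarrow> state \<Rightarrow> nat" where
  "operand_val (Const n) s = n"
| "operand_val (Reg x) s = regs s x"

fun arith_val :: "arith \<Rightarrow> nat \<Rightarrow> nat \<Rightarrow> nat" where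
  "arith_val Plus m n = m + n"
| "arith_val Minus m n = m - n"
| "arith_val Times m n = m * n"
| "arith_val Div m n = m div n"
| "arith_val Mod m n = m mod n"

fun expr_val :: "expr \<Rightarrow> state \<Rightarrow> nat" where
  "expr_val (Atom a) s = operand_val a s"
| "expr_val (Arith f a b) s = arith_val f (operand_val a s) (operand_val b s)"
| "expr_val (Get k a) s = arrays s k (operand_val a s)"

fun test_val :: "test \<Rightarrow> state \<Rightarrow> bool" where
  "test_val (Less a b) s \<longleftrightarrow> operand_val a s < operand_val b s"
| "test_val (Equal a b) s \<longleftrightarrow> operand_val a s = operand_val b s"

text \<open>\<open>exec w P s n s'\<close>: with word length \<open>w\<close>, program \<open>P\<close> started in \<open>s\<close> halts in \<open>s'\<close> after
  exactly \<open>n\<close> steps.\<close>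

inductive exec :: "nat \<Rightarrow> com \<Rightarrow> state \<Rightarrow> nat \<Rightarrow> state \<Rightarrow> bool" for w where
  Assign: "v = expr_val e s \<Longrightarrow> v < 2 ^ w \<Longrightarrow>
    exec w (Assign x e) s 1 (s\<lparr>regs := (regs s)(x := v)\<rparr>)"
| Put: "j = operand_val a s \<Longrightarrow> v = operand_val b s \<Longrightarrow> j < 2 ^ w \<Longrightarrow> v < 2 ^ w \<Longrightarrow>
    exec w (Put k a b) s 1 (s\<lparr>arrays := (arrays s)(k := (arrays s k)(j := v))\<rparr>)"
| Write: "v = operand_val a s \<Longrightarrow> v < 2 ^ w \<Longrightarrow>
    exec w (Write a) s 1 (s\<lparr>written := written s @ [v]\<rparr>)"
| Seq: "exec w P s m s' \<Longrightarrow> exec w Q s' n s'' \<Longrightarrow> exec w (Seq P Q) s (m + n) s''"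
| CondTrue: "test_val b s \<Longrightarrow> exec w P s n s' \<Longrightarrow> exec w (Cond b P Q) s (Suc n) s'"
| CondFalse: "\<not> test_val b s \<Longrightarrow> exec w Q s n s' \<Longrightarrow> exec w (Cond b P Q) s (Suc n) s'"
| WhileFalse: "\<not> test_val b s \<Longrightarrow> exec w (While b P) s 1 s"
| WhileTrue: "test_val b s \<Longrightarrow> exec w P s m s' \<Longrightarrow> exec w (While b P) s' n s'' \<Longrightarrow>
    exec w (While b P) s (Suc (m + n)) s''"

fun indices :: "nat \<Rightarrow> bool list list" where
  "indices 0 = [[]]"
| "indices (Suc t) = map ((#) False) (indices t) @ map ((#) True) (indices t)"

definition tensor_cells :: "nat \<Rightarrow> tensor list \<Rightarrow> nat list" where
  "tensor_cells t xs = concat (map (\<lambda>x. map x (indices t)) xs)"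

text \<open>Registers 0, 1, 2 hold \<open>t\<close>, \<open>N\<close>, \<open>L\<close>; arrays 0 and 1 hold the entries of the tensors of
  the two sets, tensor after tensor, in lexicographic order of the indices.\<close>

definition input_state :: "nat \<Rightarrow> nat \<Rightarrow> nat \<Rightarrow> tensor list \<Rightarrow> tensor list \<Rightarrow> state" where
  "input_state t N L xs ys =
     \<lparr>regs = (\<lambda>_. 0)(0 := t, 1 := N, 2 := L),
      arrays = (\<lambda>k j.
        let cells = (if k = 0 then tensor_cells t xs else if k = 1 then tensor_cells t ys else [])
        in if j < length cells then cells ! j else 0),
      written = []\<rparr>"

text \<open>Trees are output node by node in preorder; the code is prefix-free.\<close>

fun encode_tree :: "'a tree \<Rightarrow> nat list" where
  "encode_tree Leaf = [0]"
| "encode_tree (Node l x r) = 1 # encode_tree l @ encode_tree r"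

end

theory Submission
  imports Defs "HOL-Library.Sublist"
begin

text \<open>
  Let \<open>n = t/2\<close> and \<open>P = 2 ^ n\<close>.  A tree is a skeleton that branches once per coordinate, with a
  balanced tree of \<open>L\<close> nodes (a gadget) hanging at the end of each branch whose tensor entry is 1.
  Trees of \<open>A\<close> do not branch at max coordinates, so that a rooted embedding chooses a value for
  each of them; following optimal choices gives the lower bound.

  For the upper bound the lengths of the skeleton edges make every unintended match cheap.  The edge
  into the level \<open>k\<close> node with expectation bits \<open>q\<^sub>0 \<dots> q\<^sub>k\<^sub>-\<^sub>1\<close> has length
  \<open>2\<mu> + 2 ^ (n - k) * (2 * (\<Sum>l<k. q\<^sub>l * 2 ^ l) + 1)\<close> with \<open>2 ^ (n + 2)\<close> dividing \<open>\<mu>\<close>, and the max node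
  sits \<open>\<mu>\<close> above its end.  Hence the distance from a skeleton node down to one of level \<open>k\<close> has
  2-adic valuation exactly \<open>n - k\<close>, and if two such paths of equal level lead to nodes whose bits first
  differ at \<open>e\<close>, then the difference of their lengths has valuation \<open>n - k + 1 + e\<close>.

  An isomorphism between subtrees preserves distances.  A gadget of the first tree can meet at most one
  gadget of the second one, and if their roots are displaced by \<open>\<delta>\<close>, then they share at most
  \<open>L / 2 ^ \<bar>\<delta>\<bar>\<close> nodes.  Comparing distances of pairs of matched gadgets, the valuations show that the matched
  gadgets fall into at most four classes of constant depth shift, and that in each class with more than
  four members the displaced gadgets have total weight \<open>O(1)\<close>.  The gadgets matched without
  displacement and with the same expectation bits make consistent choices of the max coordinates, so
  their number is bounded by the scaled similarity.
\<close>

section \<open>Distances in binary trees\<close>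

text \<open>An unrooted isomorphism need not respect depth: it may move pieces of the skeleton up or
  down and turn them round. It does preserve distance, which for two nodes is the sum of their
  depths minus twice the depth of their meeting point. So every pair of matched gadgets yields one
  equation: the sum of their two depth shifts is twice the difference of the depths of the two
  branching nodes. The valuations enter through this equation. The length \<mu> has two tasks. Being
  at least twice the height of a gadget, it keeps gadgets far apart, so that none can be torn
  between two partners; being divisible by \<open>2 ^ (n + 2)\<close>, it does not disturb
  valuations up to \<open>n\<close>. It must nevertheless stay of order
  \<open>2 ^ n + log L\<close>: a tree of \<open>A\<close> has about \<open>2 ^ n\<close> skeleton
  edges, and \<open>4 ^ n \<le> L\<close> then lets the whole skeleton disappear in the error
  term.\<close>

abbreviation lcp :: "bool list \<Rightarrow> bool list \<Rightarrow> bool list" where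
  "lcp \<equiv> longest_common_prefix"

text \<open>Nodes are named by their paths from the root, so \<open>lcp u v\<close> names the lowest
  common ancestor, and this is the distance in every tree that contains both nodes.\<close>

definition pd :: "bool list \<Rightarrow> bool list \<Rightarrow> nat" where
  "pd u v = length u + length v - 2 * length (lcp u v)"

definition adj :: "bool list \<Rightarrow> bool list \<Rightarrow> bool" where
  "adj u v \<longleftrightarrow> (\<exists>b. v = u @ [b] \<or> u = v @ [b])"

lemma prefix_lcp_iff: "prefix p (lcp u v) \<longleftrightarrow> prefix p u \<and> prefix p v"
  by (meson longest_common_prefix_max_prefix longest_common_prefix_prefix1
      longest_common_prefix_prefix2 prefix_order.trans)

lemma lcp_comm: "lcp u v = lcp v u"
  by (meson prefix_lcp_iff prefix_order.antisym prefix_order.refl)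

lemma length_lcp_le: "length (lcp u v) \<le> length u" "length (lcp u v) \<le> length v"
  by (simp_all add: longest_common_prefix_prefix1 longest_common_prefix_prefix2 prefix_length_le)

lemma pd_int: "int (pd u v) = int (length u) + int (length v) - 2 * int (length (lcp u v))"
  using length_lcp_le[of u v] by (simp add: pd_def)

lemma lcp_self [simp]: "lcp u u = u"
  by (meson prefix_lcp_iff prefix_order.antisym prefix_order.refl)

lemma pd_self [simp]: "pd u u = 0"
  by (simp add: pd_def)

lemma lcp_eq_take: "lcp u v = take (length (lcp u v)) u"
  by (metis longest_common_prefix_prefix1 append_eq_conv_conj prefix_def)

text \<open>The ultrametric inequality: two prefixes of \<open>w\<close> are comparable, so the
  shorter of \<open>lcp u w\<close> and \<open>lcp w v\<close> is a prefix of both \<open>u\<close>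
  and \<open>v\<close>.\<close>

lemma lcp_ultra: "length (lcp u v) \<ge> min (length (lcp u w)) (length (lcp w v))"
proof -
  have "\<exists>p. prefix p (lcp u v) \<and> length p = min (length (lcp u w)) (length (lcp w v))"
  proof (cases "length (lcp u w) \<le> length (lcp w v)")
    case True
    then have "prefix (lcp u w) (lcp w v)"
      by (meson longest_common_prefix_prefix1 longest_common_prefix_prefix2 prefix_length_prefix)
    then show ?thesis using True
      by (metis min_def prefix_lcp_iff prefix_order.refl)
  next
    case False
    then have "prefix (lcp w v) (lcp u w)"
      by (meson longest_common_prefix_prefix1 longest_common_prefix_prefix2 nat_le_linear prefix_length_prefix)
    then show ?thesis using False
      by (metis min_def prefix_lcp_iff prefix_order.refl)
  qed
  then show ?thesis by (metis prefix_length_le)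
qed

lemma between_lcp: "pd u (lcp u v) + pd (lcp u v) v = pd u v"
proof -
  have "lcp u (lcp u v) = lcp u v" "lcp (lcp u v) v = lcp u v"
    by (meson prefix_lcp_iff prefix_order.antisym prefix_order.refl)+
  then show ?thesis using length_lcp_le[of u v] by (simp add: pd_def)
qed

text \<open>Betweenness is an equation of lengths, \<open>length (lcp u w) + length (lcp w v) =
  length w + length (lcp u v)\<close>. Each summand on the left is at most \<open>length w\<close>,
  so both are at least \<open>length (lcp u v)\<close>. Consequently whatever lies between two nodes
  below \<open>p\<close> is itself below \<open>p\<close>.\<close>

lemma between_prefix_lcp:
  assumes "pd u w + pd w v = pd u v"
  shows "prefix (lcp u v) w"
proof -
  have eq: "length (lcp u w) + length (lcp w v) = length w + length (lcp u v)"
    using arg_cong[OF assms, of int] by (simp add: pd_int)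
  have "length (lcp u v) \<le> length (lcp u w)"
    using eq lcp_ultra[of u w v] length_lcp_le[of w v] length_lcp_le[of u w] lcp_comm[of v w]
    by (auto simp: min_def split: if_splits)
  then have "prefix (lcp u v) (lcp u w)"
    by (meson longest_common_prefix_prefix1 prefix_length_prefix)
  then show ?thesis by (simp add: prefix_lcp_iff)
qed

lemma lcp_snoc:
  "lcp u (v @ [b]) = (if prefix (v @ [b]) u then v @ [b] else lcp u v)"
proof (cases "prefix (v @ [b]) u")
  case True
  then show ?thesis by (metis prefix_lcp_iff prefix_order.antisym prefix_order.refl)
next
  case False
  have "prefix p (v @ [b]) \<Longrightarrow> prefix p u \<Longrightarrow> prefix p v" for p
    using False by (auto simp: prefix_snoc)
  then have "prefix p (lcp u (v @ [b])) \<longleftrightarrow> prefix p (lcp u v)" for p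
    unfolding prefix_lcp_iff by (metis prefix_snoc)
  then show ?thesis using False by (metis prefix_order.antisym prefix_order.refl)
qed

lemma pd_snoc:
  "if prefix (v @ [b]) u then pd u v = Suc (pd u (v @ [b])) else pd u (v @ [b]) = Suc (pd u v)"
proof (cases "prefix (v @ [b]) u")
  case True
  then have "lcp u v = v"
    by (metis append_prefixD prefix_lcp_iff prefix_order.antisym prefix_order.refl)
  moreover have "length u \<ge> length v + 1" using prefix_length_le[OF True] by simp
  ultimately show ?thesis using True lcp_snoc[of u v b] by (simp add: pd_def)
next
  case False
  then show ?thesis using lcp_snoc[of u v b] length_lcp_le[of u v] by (simp add: pd_def)
qed

lemma pd_adj: "adj v w \<Longrightarrow> pd u w = Suc (pd u v) \<or> pd u v = Suc (pd u w)"
  unfolding adj_def using pd_snoc by (metis (no_types))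

text \<open>A node has only one neighbour nearer to \<open>u\<close>: the next node on the way down
  if \<open>u\<close> lies below, the parent otherwise. The explicit formula serves to express this
  uniqueness.\<close>

lemma closer_neighbour:
  assumes "adj v w" "pd u w < pd u v"
  shows "w = (if prefix v u then take (Suc (length v)) u else butlast v)"
proof -
  from assms(1) obtain b where "w = v @ [b] \<or> v = w @ [b]" by (auto simp: adj_def)
  then show ?thesis
  proof
    assume w: "w = v @ [b]"
    then have "prefix (v @ [b]) u" using pd_snoc[of v b u] assms(2) by (auto split: if_splits)
    then show ?thesis using w by (auto simp: prefix_def)
  next
    assume v: "v = w @ [b]"
    then have "\<not> prefix (w @ [b]) u" using pd_snoc[of w b u] assms(2) by (auto split: if_splits)
    then show ?thesis using v by auto
  qed
qed

text \<open>A simple path is a geodesic. The distance to its start changes by one in each step, and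
  at a first decrease the path would have to return to the only nearer neighbour, which it has
  visited two steps before.\<close>

lemma pd_simple_path:
  assumes "distinct xs" "successively adj xs" "k < length xs"
  shows "pd (xs ! 0) (xs ! k) = k"
  using assms(3)
proof (induction k rule: less_induct)
  case (less k)
  show ?case
  proof (cases k)
    case 0 then show ?thesis by simp
  next
    case (Suc m)
    have pm: "pd (xs ! 0) (xs ! m) = m" using less Suc by simp
    have ad: "adj (xs ! m) (xs ! k)"
      using assms(2) less.prems Suc by (simp add: successively_conv_nth)
    show ?thesis
    proof (rule ccontr)
      assume "pd (xs ! 0) (xs ! k) \<noteq> k"
      then have c: "pd (xs ! 0) (xs ! k) < pd (xs ! 0) (xs ! m)" and m: "m = Suc (pd (xs ! 0) (xs ! k))"
        using pd_adj[OF ad, of "xs ! 0"] pm Suc by auto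
      then obtain l where l: "m = Suc l" by blast
      have pl: "pd (xs ! 0) (xs ! l) = l" using less Suc l by simp
      have "adj (xs ! l) (xs ! m)"
        using assms(2) less.prems Suc l by (simp add: successively_conv_nth)
      then have "adj (xs ! m) (xs ! l)" by (auto simp: adj_def)
      then have "xs ! l = xs ! k"
        using closer_neighbour ad c pl pm l by (metis lessI)
      then show False using assms(1) less.prems Suc l by (simp add: nth_eq_iff_index_eq)
    qed
  qed
qed

text \<open>When a walk is extended by one step, the meeting point of its two ends either stays the
  same or becomes the new end.\<close>

lemma path_contains_lcp:
  assumes "successively adj xs" "xs \<noteq> []"
  shows "lcp (hd xs) (last xs) \<in> set xs"
  using assms
proof (induction xs rule: rev_induct)
  case (snoc z xs)
  show ?case
  proof (cases "xs = []")
    case True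
    then show ?thesis by simp
  next
    case False
    then have s: "successively adj xs" "adj (last xs) z"
      using snoc.prems by (auto simp: successively_append_iff)
    have ih: "lcp (hd xs) (last xs) \<in> set xs" using snoc.IH s False by simp
    from s(2) obtain b where "z = last xs @ [b] \<or> last xs = z @ [b]" by (auto simp: adj_def)
    then have "lcp (hd xs) z \<in> {z, lcp (hd xs) (last xs)}"
    proof
      assume "z = last xs @ [b]"
      then show ?thesis by (simp add: lcp_snoc)
    next
      assume z: "last xs = z @ [b]"
      show ?thesis
      proof (cases "prefix (z @ [b]) (hd xs)")
        case True
        then have "lcp (hd xs) z = z"
          by (metis append_prefixD prefix_lcp_iff prefix_order.antisym prefix_order.refl)
        then show ?thesis by simp
      next
        case False
        then show ?thesis using z lcp_snoc[of "hd xs" z b] by simp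
      qed
    qed
    then show ?thesis using ih False by auto
  qed
qed simp

section \<open>Simple paths, acyclicity, and isometries induced by common subtrees\<close>

lemma rtrancl_simple_path:
  assumes "(u, v) \<in> R\<^sup>*"
  shows "\<exists>xs. xs \<noteq> [] \<and> hd xs = u \<and> last xs = v \<and> distinct xs \<and> successively (\<lambda>x y. (x, y) \<in> R) xs"
  using assms
proof (induction rule: rtrancl_induct)
  case base
  show ?case by (rule exI[of _ "[u]"]) simp
next
  case (step y z)
  then obtain xs where xs: "xs \<noteq> []" "hd xs = u" "last xs = y" "distinct xs"
    "successively (\<lambda>x y. (x, y) \<in> R) xs" by blast
  show ?case
  proof (cases "z \<in> set xs")
    case True
    then obtain as bs where "xs = as @ z # bs" by (meson split_list)
    then show ?thesis using xs
      by (intro exI[of _ "as @ [z]"]) (auto simp: successively_append_iff hd_append)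
  next
    case False
    then show ?thesis using xs step.hyps
      by (intro exI[of _ "xs @ [z]"]) (auto simp: successively_append_iff)
  qed
qed

lemma positions_prefix: "v \<in> positions T \<Longrightarrow> prefix u v \<Longrightarrow> u \<in> positions T"
proof (induction T arbitrary: u v)
  case (Node l x r)
  then show ?case by (cases u; cases v) auto
qed simp

lemma finite_positions [simp]: "finite (positions T)"
  by (induction T) auto

lemma card_positions: "card (positions T) = size T"
proof (induction T)
  case (Node l x r)
  have "card (positions (Node l x r)) = Suc (card ((#) False ` positions l \<union> (#) True ` positions r))"
    by (simp add: card_insert_if image_iff)
  also have "\<dots> = Suc (card ((#) False ` positions l) + card ((#) True ` positions r))"
    by (subst card_Un_disjoint) auto
  finally show ?case using Node by (simp add: card_image)
qed simp

lemma length_positions: "v \<in> positions T \<Longrightarrow> length v < height T"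
  by (induction T arbitrary: v) (auto simp: max_def, fastforce+)

lemma edge_tree_graph:
  "{x, y} \<in> edges (tree_graph T) \<Longrightarrow> adj x y \<and> x \<in> positions T \<and> y \<in> positions T"
  by (auto simp: tree_graph_def adj_def doubleton_eq_iff intro: positions_prefix)

text \<open>Cut open, a cycle is a simple path and hence a geodesic of length at least 2, although
  its ends are adjacent.\<close>

lemma tree_graph_no_cycle: "\<not> is_cycle (tree_graph T) p"
proof
  assume "is_cycle (tree_graph T) p"
  then have l: "3 \<le> length p" and d: "distinct p"
    and e: "\<And>i. i < length p \<Longrightarrow> {p ! i, p ! (Suc i mod length p)} \<in> edges (tree_graph T)"
    by (auto simp: is_cycle_def)
  have "adj (p ! i) (p ! Suc i)" if "Suc i < length p" for i
    using edge_tree_graph[OF e[of i]] that by simp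
  then have "successively adj p" by (simp add: successively_conv_nth)
  then have 1: "pd (p ! 0) (p ! (length p - 1)) = length p - 1"
    using pd_simple_path[of p "length p - 1"] d l by simp
  have "adj (p ! (length p - 1)) (p ! 0)"
  proof -
    have "Suc (length p - 1) = length p" "length p - 1 < length p" using l by auto
    then have "Suc (length p - 1) mod length p = 0" "length p - 1 < length p" by simp_all
    then show ?thesis using edge_tree_graph[OF e[of "length p - 1"]] by simp
  qed
  then show False
    using pd_adj[of "p ! (length p - 1)" "p ! 0" "p ! 0"] 1 l by simp
qed

text \<open>The composed isomorphism carries a simple path in \<open>S\<close> to a simple path in
  \<open>S'\<close>. Both are geodesics, so distances agree, and both contain the meeting point of
  their ends, so the two vertex sets are closed under \<open>lcp\<close>.\<close>

lemma LCST_isometry: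
  fixes S S' :: "bool list ugraph"
  assumes S: "subtree S (tree_graph G)" and S': "subtree S' (tree_graph H)"
    and f: "graph_iso f T S" and g: "graph_iso g T S'"
  obtains \<phi> where "verts S \<subseteq> positions G" "\<phi> ` verts S \<subseteq> positions H" "inj_on \<phi> (verts S)"
    "\<And>u v. u \<in> verts S \<Longrightarrow> v \<in> verts S \<Longrightarrow> pd (\<phi> u) (\<phi> v) = pd u v"
    "\<And>u v. u \<in> verts S \<Longrightarrow> v \<in> verts S \<Longrightarrow> lcp u v \<in> verts S"
    "\<And>u v. u \<in> verts S \<Longrightarrow> v \<in> verts S \<Longrightarrow> lcp (\<phi> u) (\<phi> v) \<in> \<phi> ` verts S"
    "card (verts T) = card (verts S)"
proof -
  define h where "h = the_inv_into (verts T) f"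
  define \<phi> where "\<phi> = g \<circ> h"
  have bf: "bij_betw f (verts T) (verts S)" and bg: "bij_betw g (verts T) (verts S')"
    using f g by (auto simp: graph_iso_def)
  have bh: "bij_betw h (verts S) (verts T)"
    unfolding h_def using bf by (rule bij_betw_the_inv_into)
  have fh: "f (h v) = v" if "v \<in> verts S" for v
    unfolding h_def using that bf by (metis bij_betw_def f_the_inv_into_f)
  have b\<phi>: "bij_betw \<phi> (verts S) (verts S')"
    unfolding \<phi>_def using bh bg by (rule bij_betw_trans)
  have VS: "verts S \<subseteq> positions G" "verts S' \<subseteq> positions H"
    using S S' by (auto simp: subtree_def tree_graph_def)
  have sub: "\<And>e. e \<in> edges S \<Longrightarrow> e \<in> edges (tree_graph G)" "\<And>e. e \<in> edges S' \<Longrightarrow> e \<in> edges (tree_graph H)"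
    "\<And>e. e \<in> edges S \<Longrightarrow> e \<subseteq> verts S"
    using S S' by (auto simp: subtree_def is_tree_def)
  have step: "{\<phi> x, \<phi> y} \<in> edges S'" if "{x, y} \<in> edges S" for x y
  proof -
    have xy: "x \<in> verts S" "y \<in> verts S" using sub(3)[OF that] by auto
    then have hh: "h x \<in> verts T" "h y \<in> verts T" using bh bij_betwE by blast+
    then have "{h x, h y} \<in> edges T" using f that fh xy by (simp add: graph_iso_def)
    then show ?thesis using g hh by (simp add: graph_iso_def \<phi>_def)
  qed
  have path: "\<exists>xs. xs \<noteq> [] \<and> hd xs = u \<and> last xs = v \<and> distinct xs \<and> set xs \<subseteq> verts S \<and>
      successively adj xs \<and> successively adj (map \<phi> xs)"
    if u: "u \<in> verts S" and v: "v \<in> verts S" for u v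
  proof -
    have "(u, v) \<in> {(x, y). {x, y} \<in> edges S}\<^sup>*"
      using S u v by (auto simp: subtree_def is_tree_def connected_graph_def)
    from rtrancl_simple_path[OF this] obtain xs where xs: "xs \<noteq> []" "hd xs = u" "last xs = v"
      "distinct xs" "successively (\<lambda>x y. {x, y} \<in> edges S) xs" by auto
    have "set xs \<subseteq> verts S"
    proof
      fix w assume "w \<in> set xs"
      then obtain k where k: "k < length xs" "w = xs ! k" by (auto simp: in_set_conv_nth)
      show "w \<in> verts S"
      proof (cases k)
        case 0 then show ?thesis using k xs u by (simp add: hd_conv_nth)
      next
        case (Suc m)
        then have "{xs ! m, w} \<in> edges S" using xs(5) k by (simp add: successively_conv_nth)
        then show ?thesis using sub(3) by blast
      qed
    qed
    moreover have "successively adj xs"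
      using xs(5) by (rule successively_mono) (use sub(1) edge_tree_graph in blast)
    moreover have "successively adj (map \<phi> xs)"
      unfolding successively_map using xs(5)
      by (rule successively_mono) (use sub(2) step edge_tree_graph in blast)
    ultimately show ?thesis using xs by blast
  qed
  have iso: "pd (\<phi> u) (\<phi> v) = pd u v" "lcp u v \<in> verts S" "lcp (\<phi> u) (\<phi> v) \<in> \<phi> ` verts S"
    if uv: "u \<in> verts S" "v \<in> verts S" for u v
  proof -
    obtain xs where xs: "xs \<noteq> []" "hd xs = u" "last xs = v" "distinct xs" "set xs \<subseteq> verts S"
      "successively adj xs" "successively adj (map \<phi> xs)" using path[OF uv] by blast
    have "distinct (map \<phi> xs)"
      using xs b\<phi> by (metis bij_betw_def distinct_map inj_on_subset)
    then have "pd (map \<phi> xs ! 0) (map \<phi> xs ! (length xs - 1)) = length xs - 1"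
      using pd_simple_path[of "map \<phi> xs" "length xs - 1"] xs by simp
    moreover have "pd (xs ! 0) (xs ! (length xs - 1)) = length xs - 1"
      using pd_simple_path[of xs "length xs - 1"] xs by simp
    ultimately show "pd (\<phi> u) (\<phi> v) = pd u v"
      using xs by (simp add: hd_conv_nth last_conv_nth)
    show "lcp u v \<in> verts S" using path_contains_lcp[OF xs(6,1)] xs by auto
    have "lcp (\<phi> u) (\<phi> v) \<in> set (map \<phi> xs)"
      using path_contains_lcp[OF xs(7)] xs by (simp add: hd_map last_map)
    then show "lcp (\<phi> u) (\<phi> v) \<in> \<phi> ` verts S" using xs(5) by auto
  qed
  show thesis
  proof
    show "verts S \<subseteq> positions G" "inj_on \<phi> (verts S)" "\<phi> ` verts S \<subseteq> positions H"
      using VS b\<phi> by (auto simp: bij_betw_def)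
    show "card (verts T) = card (verts S)" using bf by (rule bij_betw_same_card)
  qed (use iso in auto)
qed

section \<open>Common subtrees\<close>

text \<open>Root-preserving embeddings. The rule \<open>crossed\<close> reflects that trees are
  unordered; it allows an only child to be sent to either child of the target, which is how a value
  of a max coordinate gets chosen.\<close>

inductive embeds :: "'a tree \<Rightarrow> 'b tree \<Rightarrow> bool" where
  Leaf: "embeds Leaf U"
| straight: "embeds l l' \<Longrightarrow> embeds r r' \<Longrightarrow> embeds (Node l x r) (Node l' y r')"
| crossed: "embeds l r' \<Longrightarrow> embeds r l' \<Longrightarrow> embeds (Node l x r) (Node l' y r')"

lemma embeds_refl: "embeds T T"
  by (induction T) (auto intro: embeds.intros)

lemma embeds_map:
  assumes "embeds C U"
  shows "\<exists>f. inj_on f (positions C) \<and> f ` positions C \<subseteq> positions U \<and> f [] = [] \<and>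
    (\<forall>p b. p @ [b] \<in> positions C \<longrightarrow> (\<exists>b'. f (p @ [b]) = f p @ [b']))"
proof -
  \<comment> \<open>Both recursive rules at once: \<open>s\<close> is the label of the child that
    receives \<open>l\<close>, so \<open>s = False\<close> is the straight and
    \<open>s = True\<close> the crossed case.\<close>
  have node: "\<exists>f. inj_on f (positions (Node l x r)) \<and> f ` positions (Node l x r) \<subseteq> positions U \<and> f [] = [] \<and>
    (\<forall>p b. p @ [b] \<in> positions (Node l x r) \<longrightarrow> (\<exists>b'. f (p @ [b]) = f p @ [b']))"
    if f: "inj_on f (positions l)" "f [] = []" "\<forall>p b. p @ [b] \<in> positions l \<longrightarrow> (\<exists>b'. f (p @ [b]) = f p @ [b'])"
      and g: "inj_on g (positions r)" "g [] = []" "\<forall>p b. p @ [b] \<in> positions r \<longrightarrow> (\<exists>b'. g (p @ [b]) = g p @ [b'])"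
      and U: "[] \<in> positions U" "\<forall>p\<in>positions l. s # f p \<in> positions U"
        "\<forall>p\<in>positions r. (\<not> s) # g p \<in> positions U"
    for f g :: "bool list \<Rightarrow> bool list" and s and l r :: "'a tree" and x and U :: "'b tree"
  proof -
    define h where "h p = (case p of [] \<Rightarrow> [] | b # q \<Rightarrow> if b then (\<not> s) # g q else s # f q)" for p
    have h: "h [] = []" "h (False # q) = s # f q" "h (True # q) = (\<not> s) # g q" for q
      by (auto simp: h_def)
    have "inj_on h (positions (Node l x r))"
      using f(1) g(1) by (auto simp: inj_on_def h)
    moreover have "h ` positions (Node l x r) \<subseteq> positions U"
      using U by (auto simp: h)
    moreover have "\<exists>b'. h (p @ [b]) = h p @ [b']" if "p @ [b] \<in> positions (Node l x r)" for p b
    proof (cases p)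
      case Nil
      then show ?thesis using that f(2) g(2) by (cases b) (auto simp: h)
    next
      case (Cons a q)
      then show ?thesis using that f(3) g(3) by (cases a) (auto simp: h)
    qed
    ultimately show ?thesis using h(1) by blast
  qed
  show ?thesis using assms
  proof (induction rule: embeds.induct)
    case (Leaf U)
    show ?case by (rule exI[of _ "\<lambda>p. p"]) auto
  next
    case (straight l l' r r' x y)
    then obtain f g where fg: "inj_on f (positions l) \<and> f ` positions l \<subseteq> positions l' \<and> f [] = [] \<and>
      (\<forall>p b. p @ [b] \<in> positions l \<longrightarrow> (\<exists>b'. f (p @ [b]) = f p @ [b']))"
      "inj_on g (positions r) \<and> g ` positions r \<subseteq> positions r' \<and> g [] = [] \<and>
      (\<forall>p b. p @ [b] \<in> positions r \<longrightarrow> (\<exists>b'. g (p @ [b]) = g p @ [b']))" by blast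
    show ?case
      by (rule node[where f = f and g = g and s = False]) (use fg in auto)
  next
    case (crossed l r' r l' x y)
    then obtain f g where fg: "inj_on f (positions l) \<and> f ` positions l \<subseteq> positions r' \<and> f [] = [] \<and>
      (\<forall>p b. p @ [b] \<in> positions l \<longrightarrow> (\<exists>b'. f (p @ [b]) = f p @ [b']))"
      "inj_on g (positions r) \<and> g ` positions r \<subseteq> positions l' \<and> g [] = [] \<and>
      (\<forall>p b. p @ [b] \<in> positions r \<longrightarrow> (\<exists>b'. g (p @ [b]) = g p @ [b']))" by blast
    show ?case
      by (rule node[where f = f and g = g and s = True]) (use fg in auto)
  qed
qed

lemma embeds_subtree:
  assumes "embeds C U" "C \<noteq> Leaf"
  obtains S f where "subtree S (tree_graph U)" "[] \<in> verts S" "graph_iso f (tree_graph C) S" "f [] = []"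
proof -
  obtain f where inj: "inj_on f (positions C)" and sub: "f ` positions C \<subseteq> positions U"
    and f0: "f [] = []" and f1: "\<And>p b. p @ [b] \<in> positions C \<Longrightarrow> \<exists>b'. f (p @ [b]) = f p @ [b']"
    using embeds_map[OF assms(1)] by blast
  define S where "S = (f ` positions C, {{f p, f (p @ [b])} | p b. p @ [b] \<in> positions C})"
  have root: "[] \<in> positions C" using assms(2) by (cases C) auto
  have E: "edges S \<subseteq> edges (tree_graph U)"
  proof
    fix e assume "e \<in> edges S"
    then obtain p b where pb: "e = {f p, f (p @ [b])}" "p @ [b] \<in> positions C" by (auto simp: S_def)
    obtain b' where "f (p @ [b]) = f p @ [b']" using f1 pb(2) by blast
    moreover have "f (p @ [b]) \<in> positions U" using sub pb(2) by auto
    ultimately show "e \<in> edges (tree_graph U)" using pb(1) by (auto simp: tree_graph_def)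
  qed
  let ?R = "{(x, y). {x, y} \<in> edges S}"
  have reach: "p \<in> positions C \<Longrightarrow> ([], f p) \<in> ?R\<^sup>*" for p
  proof (induction p rule: rev_induct)
    case (snoc b p)
    then have "p \<in> positions C" using positions_prefix by (metis prefixI)
    then have "([], f p) \<in> ?R\<^sup>*" using snoc by simp
    moreover have "(f p, f (p @ [b])) \<in> ?R" using snoc.prems by (auto simp: S_def)
    ultimately show ?case by (rule rtrancl.rtrancl_into_rtrancl)
  qed (simp add: f0)
  have "sym (?R\<^sup>*)" by (rule sym_rtrancl) (auto simp: sym_def insert_commute)
  then have conn: "connected_graph S"
    unfolding connected_graph_def using reach
    by (auto simp: S_def) (metis (no_types, lifting) rtrancl_trans symD)
  have cyc: "\<not> is_cycle S p" for p
    using E tree_graph_no_cycle[of U p] by (auto simp: is_cycle_def)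
  have iso_edge: "{u, v} \<in> edges (tree_graph C) \<longleftrightarrow> {f u, f v} \<in> edges S"
    if "u \<in> positions C" "v \<in> positions C" for u v
  proof
    assume "{u, v} \<in> edges (tree_graph C)"
    then obtain p b where pb: "{u, v} = {p, p @ [b]}" "p @ [b] \<in> positions C"
      by (auto simp: tree_graph_def)
    then have "{f u, f v} = {f p, f (p @ [b])}" by (metis image_empty image_insert)
    then show "{f u, f v} \<in> edges S" using pb(2) by (auto simp: S_def)
  next
    assume "{f u, f v} \<in> edges S"
    then obtain p b where pb: "f ` {u, v} = f ` {p, p @ [b]}" "p @ [b] \<in> positions C"
      by (auto simp: S_def)
    have "p \<in> positions C" using pb(2) positions_prefix by (metis prefixI)
    then have "{u, v} = {p, p @ [b]}"
      using inj_on_image_eq_iff[OF inj, of "{u, v}" "{p, p @ [b]}"] pb that by auto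
    then show "{u, v} \<in> edges (tree_graph C)" using pb(2) by (auto simp: tree_graph_def)
  qed
  have "is_tree S"
    unfolding is_tree_def
  proof (intro conjI ballI)
    show "finite (verts S)" "verts S \<noteq> {}" using root by (auto simp: S_def)
    fix e assume e: "e \<in> edges S"
    then obtain p b where pb: "e = {f p, f (p @ [b])}" "p @ [b] \<in> positions C" by (auto simp: S_def)
    have "p \<in> positions C" using pb(2) positions_prefix by (metis prefixI)
    then show "e \<subseteq> verts S" using pb by (auto simp: S_def)
    show "card e = 2" using pb f1[OF pb(2)] by auto
  next
    show "connected_graph S" "\<nexists>p. is_cycle S p" using conn cyc by auto
  qed
  then have "subtree S (tree_graph U)"
    using E sub by (auto simp: subtree_def S_def tree_graph_def)
  moreover have "[] \<in> verts S" using root f0 by (force simp: S_def)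
  moreover have "graph_iso f (tree_graph C) S"
    using iso_edge inj by (auto simp: graph_iso_def bij_betw_def S_def tree_graph_def)
  ultimately show thesis using f0 that by blast
qed

section \<open>Lower and upper bounds for the two maxima\<close>

lemma is_tree_tree_graph:
  assumes "T \<noteq> Leaf" shows "is_tree (tree_graph T)"
proof -
  let ?R = "{(x, y). {x, y} \<in> edges (tree_graph T)}"
  have reach: "p \<in> positions T \<Longrightarrow> ([], p) \<in> ?R\<^sup>*" for p
  proof (induction p rule: rev_induct)
    case (snoc b p)
    then have "p \<in> positions T" using positions_prefix by (metis prefixI)
    then have "([], p) \<in> ?R\<^sup>*" using snoc by simp
    moreover have "(p, p @ [b]) \<in> ?R" using snoc.prems by (auto simp: tree_graph_def)
    ultimately show ?case by (rule rtrancl.rtrancl_into_rtrancl)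
  qed simp
  have "sym (?R\<^sup>*)" by (rule sym_rtrancl) (auto simp: sym_def insert_commute)
  then have conn: "connected_graph (tree_graph T)"
    unfolding connected_graph_def using reach
    by (auto simp: tree_graph_def) (metis (no_types, lifting) rtrancl_trans symD)
  have "[] \<in> positions T" using assms by (cases T) auto
  then show ?thesis
    unfolding is_tree_def using conn tree_graph_no_cycle
    by (auto simp: tree_graph_def intro: positions_prefix)
qed

lemma RLCST_graph_set_subset:
  "{card (verts T) | (T :: 'v ugraph) x.
     is_tree T \<and> x \<in> verts T \<and>
     (\<exists>S f. subtree S G \<and> r \<in> verts S \<and> graph_iso f T S \<and> f x = r) \<and>
     (\<exists>S f. subtree S H \<and> q \<in> verts S \<and> graph_iso f T S \<and> f x = q)}
   \<subseteq> {card (verts T) | T :: 'v ugraph. is_tree T \<and>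
     (\<exists>S f. subtree S G \<and> graph_iso f T S) \<and>
     (\<exists>S f. subtree S H \<and> graph_iso f T S)}"
  by blast

text \<open>\<open>Max\<close> is informative only over a finite set. Every common subtree is
  isomorphic to a part of \<open>U\<close>, so \<open>size U\<close> bounds its size.\<close>

lemma finite_LCST_set:
  fixes H :: "bool list ugraph"
  shows "finite {card (verts T) | T :: bool list ugraph. is_tree T \<and>
     (\<exists>S f. subtree S (tree_graph U) \<and> graph_iso f T S) \<and>
     (\<exists>S f. subtree S H \<and> graph_iso f T S)}"
proof (rule finite_subset)
  show "{card (verts T) | T :: bool list ugraph. is_tree T \<and>
     (\<exists>S f. subtree S (tree_graph U) \<and> graph_iso f T S) \<and>
     (\<exists>S f. subtree S H \<and> graph_iso f T S)} \<subseteq> {..size U}"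
    by (auto simp: graph_iso_def subtree_def tree_graph_def dest!: bij_betw_same_card)
       (metis card_mono card_positions finite_positions)
qed simp

text \<open>The graph of \<open>C\<close> itself, rooted at \<open>[]\<close>, is the abstract
  common tree. In the second inequality \<open>C\<close> ensures that the rooted maximum is taken
  over a nonempty set.\<close>

lemma RLCST_ge:
  assumes "embeds C T" "embeds C U" "C \<noteq> Leaf"
  shows "size C \<le> RLCST T U" "RLCST T U \<le> LCST T U"
proof -
  let ?M = "{card (verts X) | (X :: bool list ugraph) x.
     is_tree X \<and> x \<in> verts X \<and>
     (\<exists>S f. subtree S (tree_graph T) \<and> [] \<in> verts S \<and> graph_iso f X S \<and> f x = []) \<and>
     (\<exists>S f. subtree S (tree_graph U) \<and> [] \<in> verts S \<and> graph_iso f X S \<and> f x = [])}"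
  have fin: "finite ?M"
    by (rule finite_subset[OF RLCST_graph_set_subset finite_LCST_set])
  obtain S f where Sf: "subtree S (tree_graph T)" "[] \<in> verts S" "graph_iso f (tree_graph C) S" "f [] = []"
    using embeds_subtree assms by metis
  obtain R g where Rg: "subtree R (tree_graph U)" "[] \<in> verts R" "graph_iso g (tree_graph C) R" "g [] = []"
    using embeds_subtree assms by metis
  have "is_tree (tree_graph C)" "[] \<in> verts (tree_graph C)" "card (verts (tree_graph C)) = size C"
    using is_tree_tree_graph[OF assms(3)] assms(3) card_positions[of C]
    by (cases C; auto simp: tree_graph_def)+
  then have mem: "size C \<in> ?M" using Sf Rg by (smt (verit) mem_Collect_eq)
  show "size C \<le> RLCST T U"
    using Max_ge[OF fin mem] by (simp add: RLCST_def RLCST_graph_def)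
  have "Max ?M \<le> LCST T U"
    unfolding LCST_def LCST_graph_def
    by (rule Max_mono[OF RLCST_graph_set_subset _ finite_LCST_set]) (use mem in blast)
  then show "RLCST T U \<le> LCST T U" by (simp add: RLCST_def RLCST_graph_def)
qed

text \<open>What is kept of a common subtree when its edges are forgotten: the upper bound works
  with distances and meeting points alone.\<close>

definition partial_isometry :: "(bool list \<Rightarrow> bool list) \<Rightarrow> bool list set \<Rightarrow> bool" where
  "partial_isometry \<phi> V \<longleftrightarrow> inj_on \<phi> V \<and>
     (\<forall>u\<in>V. \<forall>v\<in>V. pd (\<phi> u) (\<phi> v) = pd u v \<and> lcp u v \<in> V \<and> lcp (\<phi> u) (\<phi> v) \<in> \<phi> ` V)"

lemma LCST_le:
  assumes "T \<noteq> Leaf" "U \<noteq> Leaf"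
    and "\<And>V \<phi>. V \<subseteq> positions T \<Longrightarrow> \<phi> ` V \<subseteq> positions U \<Longrightarrow> partial_isometry \<phi> V \<Longrightarrow> card V \<le> m"
  shows "LCST T U \<le> m"
proof -
  let ?M = "{card (verts X) | X :: bool list ugraph. is_tree X \<and>
     (\<exists>S f. subtree S (tree_graph T) \<and> graph_iso f X S) \<and>
     (\<exists>S f. subtree S (tree_graph U) \<and> graph_iso f X S)}"
  have "embeds (Node Leaf () Leaf) T" "embeds (Node Leaf () Leaf) U"
    using assms(1,2) by (cases T; cases U; auto intro: embeds.intros)+
  then obtain S f R g where
    "subtree S (tree_graph T)" "graph_iso f (tree_graph (Node Leaf () Leaf)) S"
    "subtree R (tree_graph U)" "graph_iso g (tree_graph (Node Leaf () Leaf)) R"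
    using embeds_subtree by (metis tree.distinct(1))
  then have "?M \<noteq> {}"
    using is_tree_tree_graph[of "Node Leaf () Leaf"] by blast
  moreover have "x \<le> m" if "x \<in> ?M" for x
  proof -
    from that obtain X :: "bool list ugraph" and S f R g where X: "x = card (verts X)"
      "subtree S (tree_graph T)" "graph_iso f X S" "subtree R (tree_graph U)" "graph_iso g X R"
      by blast
    from LCST_isometry[OF X(2,4,3,5)] show ?thesis
      using assms(3) X(1) unfolding partial_isometry_def by (metis (no_types, lifting))
  qed
  ultimately show ?thesis
    unfolding LCST_def LCST_graph_def by (subst Max_le_iff[OF finite_LCST_set]) auto
qed

lemma LCST_le_size:
  assumes "T \<noteq> Leaf" "U \<noteq> Leaf" shows "LCST T U \<le> size T"
  by (rule LCST_le[OF assms]) (metis card_mono card_positions finite_positions)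

section \<open>The trees\<close>

text \<open>The nodes below the root are shared as evenly as possible, so each step down at least
  halves what hangs below. This is why the common part of two displaced gadgets shrinks
  exponentially with the displacement. As the shape depends on \<open>m\<close> only, undisplaced
  gadgets match completely.\<close>

fun balanced :: "nat \<Rightarrow> unit tree" where
  "balanced 0 = Leaf"
| "balanced (Suc m) = Node (balanced (Suc m div 2)) () (balanced (m div 2))"

fun stem :: "nat \<Rightarrow> unit tree \<Rightarrow> unit tree" where
  "stem 0 T = T"
| "stem (Suc k) T = Node Leaf () (stem k T)"

text \<open>Iterated from \<open>c = P\<close> over bits \<open>q\<^sub>0, q\<^sub>1, \<dots>\<close>, this produces the variable parts
  \<open>2 ^ (n - k) * (2 * (\<Sum>l<k. q\<^sub>l * 2 ^ l) + 1)\<close> of the edge lengths.\<close>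

definition next_offset :: "nat \<Rightarrow> nat \<Rightarrow> bool \<Rightarrow> nat" where
  "next_offset P c b = c div 2 + (if b then P else 0)"

text \<open>The recursion runs over the number of coordinates left. As their total is even,
  \<open>odd d\<close> in the equation for \<open>Suc d\<close> marks an expectation coordinate:
  both kinds of tree branch and the offset changes. At a max coordinate a tree without
  \<open>full\<close> keeps only the child \<open>True\<close>. The stems are one shorter than the
  intended edges because the step from the branching node into the stem counts as well.\<close>

fun spine :: "nat \<Rightarrow> nat \<Rightarrow> nat \<Rightarrow> bool \<Rightarrow> nat \<Rightarrow> nat \<Rightarrow> tensor \<Rightarrow> unit tree" where
  "spine \<mu> P L full 0 c x = (if x [] = 0 then Leaf else balanced L)"
| "spine \<mu> P L full (Suc d) c x =
     (let branch = (\<lambda>b. let c' = (if odd d then next_offset P c b else c)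
        in stem (if odd d then \<mu> + c' - 1 else \<mu> - 1) (spine \<mu> P L full d c' (\<lambda>i. x (b # i))))
      in Node (if odd d \<or> full then branch False else Leaf) () (branch True))"

text \<open>The address at which the gadget of index \<open>i\<close> is attached;
  \<open>replicate\<close> is the descent along a stem, whose nodes have right children
  only.\<close>

fun slot :: "nat \<Rightarrow> nat \<Rightarrow> nat \<Rightarrow> bool list \<Rightarrow> bool list" where
  "slot \<mu> P c [] = []"
| "slot \<mu> P c (b # i) = b #
     (let c' = (if odd (length i) then next_offset P c b else c)
      in replicate (if odd (length i) then \<mu> + c' - 1 else \<mu> - 1) True @ slot \<mu> P c' i)"

fun admissible :: "bool \<Rightarrow> bool list \<Rightarrow> bool" where
  "admissible full [] = True"
| "admissible full (b # i) = ((full \<or> b \<or> odd (length i)) \<and> admissible full i)"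

section \<open>Sizes, heights and node sets of gadgets, stems and spines\<close>

lemma size_balanced [simp]: "size (balanced m) = m"
proof (induction m rule: balanced.induct)
  case (2 m)
  have "Suc m div 2 + m div 2 = m" by presburger
  then show ?case using 2 by simp
qed simp

lemma height_balanced: "m < 2 ^ k \<Longrightarrow> height (balanced m) \<le> k"
proof (induction k arbitrary: m)
  case (Suc k)
  then show ?case
  proof (cases m)
    case (Suc m')
    have "Suc m' div 2 < 2 ^ k" "m' div 2 < 2 ^ k" using Suc.prems Suc by auto
    then show ?thesis using Suc.IH Suc by simp
  qed simp
qed simp

lemma card_balanced_below:
  "card {u \<in> positions (balanced m). prefix w u} * 2 ^ length w \<le> m"
proof (induction w arbitrary: m)
  case Nil
  then show ?case by (simp add: card_positions)
next
  case (Cons b w)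
  show ?case
  proof (cases m)
    case (Suc m')
    let ?m = "if b then m' div 2 else Suc m' div 2"
    have "{u \<in> positions (balanced m). prefix (b # w) u} = (#) b ` {u \<in> positions (balanced ?m). prefix w u}"
      unfolding Suc by (cases b) auto
    then have "card {u \<in> positions (balanced m). prefix (b # w) u} =
        card {u \<in> positions (balanced ?m). prefix w u}"
      by (simp add: card_image)
    moreover have "card {u \<in> positions (balanced ?m). prefix w u} * 2 ^ length w \<le> ?m" by (rule Cons)
    moreover have "2 * ?m \<le> m" unfolding Suc by auto
    ultimately show ?thesis by (simp add: mult.left_commute mult.commute)
  qed simp
qed

lemma positions_stem:
  "positions (stem k T) = {replicate m True | m. m < k} \<union> (@) (replicate k True) ` positions T"
proof (induction k)
  case (Suc k)
  have "v \<in> positions (stem (Suc k) T) \<longleftrightarrow>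
     v \<in> {replicate m True | m. m < Suc k} \<union> (@) (replicate (Suc k) True) ` positions T" for v
  proof (cases v)
    case Nil
    then show ?thesis by auto
  next
    case (Cons b w)
    have "(\<exists>m<Suc k. True # w = replicate m True) \<longleftrightarrow> (\<exists>m<k. w = replicate m True)"
    proof
      assume "\<exists>m<Suc k. True # w = replicate m True"
      then obtain m where "m < Suc k" "True # w = replicate m True" by blast
      then show "\<exists>m<k. w = replicate m True" by (cases m) auto
    next
      assume "\<exists>m<k. w = replicate m True"
      then show "\<exists>m<Suc k. True # w = replicate m True" by (metis Suc_mono replicate_Suc)
    qed
    moreover have "\<not> (\<exists>m<Suc k. False # w = replicate m True)"
      by (metis list.inject list.distinct(1) replicate_Suc replicate_0 old.nat.exhaust)
    ultimately show ?thesis using Cons Suc by (cases b) auto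
  qed
  then show ?case by blast
qed auto

lemma size_stem [simp]: "size (stem k T) = k + size T"
  by (induction k) auto

lemma height_stem: "height (stem k T) = k + height T"
  by (induction k) auto

text \<open>The zero tensor attaches no gadget, so its spine is the bare skeleton. The upper bound
  sorts nodes according to these two alternatives.\<close>

lemma spine_positions:
  assumes "v \<in> positions (spine \<mu> P L full d c x)"
  shows "v \<in> positions (spine \<mu> P L full d c (\<lambda>_. 0)) \<or>
    (\<exists>i u. length i = d \<and> admissible full i \<and> x i \<noteq> 0 \<and> u \<in> positions (balanced L) \<and>
       v = slot \<mu> P c i @ u)"
  using assms
proof (induction d arbitrary: c x v)
  case 0
  then show ?case by (auto split: if_splits)
next
  case (Suc d)
  define c' where "c' b = (if odd d then next_offset P c b else c)" for b
  define k where "k b = (if odd d then \<mu> + c' b - 1 else \<mu> - 1)" for b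
  define br where "br z b = stem (k b) (spine \<mu> P L full d (c' b) (\<lambda>i. z (b # i)))" for z :: tensor and b
  have sp: "spine \<mu> P L full (Suc d) c z = Node (if odd d \<or> full then br z False else Leaf) () (br z True)" for z
    by (simp add: br_def c'_def k_def Let_def)
  show ?case
  proof (cases v)
    case Nil
    then show ?thesis by (simp only: sp) simp
  next
    case (Cons b w)
    have w: "w \<in> positions (br x b)" and ad: "full \<or> b \<or> odd d"
      using Suc.prems unfolding Cons sp by (cases b; auto split: if_splits)+
    from w consider (stem) m where "m < k b" "w = replicate m True"
      | (sub) u where "u \<in> positions (spine \<mu> P L full d (c' b) (\<lambda>i. x (b # i)))" "w = replicate (k b) True @ u"
      by (auto simp: br_def positions_stem)
    then show ?thesis
    proof cases
      case stem
      then have "w \<in> positions (br (\<lambda>_. 0) b)" by (auto simp: br_def positions_stem)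
      then have "v \<in> positions (spine \<mu> P L full (Suc d) c (\<lambda>_. 0))"
        using ad Cons by (cases b) (auto simp only: sp positions.simps, auto)
      then show ?thesis by blast
    next
      case sub
      from Suc.IH[OF sub(1)] show ?thesis
      proof
        assume "u \<in> positions (spine \<mu> P L full d (c' b) (\<lambda>_. 0))"
        then have "w \<in> positions (br (\<lambda>_. 0) b)" using sub by (auto simp: br_def positions_stem)
        then have "v \<in> positions (spine \<mu> P L full (Suc d) c (\<lambda>_. 0))"
          using ad Cons by (cases b) (auto simp only: sp positions.simps, auto)
        then show ?thesis by blast
      next
        assume "\<exists>i u'. length i = d \<and> admissible full i \<and> x (b # i) \<noteq> 0 \<and> u' \<in> positions (balanced L) \<and>
          u = slot \<mu> P (c' b) i @ u'"
        then obtain i u' where i: "length i = d" "admissible full i" "x (b # i) \<noteq> 0"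
          "u' \<in> positions (balanced L)" "u = slot \<mu> P (c' b) i @ u'" by blast
        have "v = slot \<mu> P c (b # i) @ u'"
          using Cons sub(2) i by (simp add: c'_def k_def Let_def)
        moreover have "length (b # i) = Suc d" "admissible full (b # i)" using i ad by auto
        ultimately show ?thesis using i by blast
      qed
    qed
  qed
qed

text \<open>The prefix is strict because the slot itself is already the place of the root of the
  gadget. Strictness is what later separates skeleton nodes from gadget nodes.\<close>

lemma skeleton_positions:
  assumes "v \<in> positions (spine \<mu> P L full d c (\<lambda>_. 0))"
  shows "\<exists>i. length i = d \<and> strict_prefix v (slot \<mu> P c i)"
  using assms
proof (induction d arbitrary: c v)
  case 0
  then show ?case by auto
next
  case (Suc d)
  define c' where "c' b = (if odd d then next_offset P c b else c)" for b
  define k where "k b = (if odd d then \<mu> + c' b - 1 else \<mu> - 1)" for b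
  define br where "br b = stem (k b) (spine \<mu> P L full d (c' b) (\<lambda>i. 0))" for b
  have sp: "spine \<mu> P L full (Suc d) c (\<lambda>_. 0) = Node (if odd d \<or> full then br False else Leaf) () (br True)"
    by (simp add: br_def c'_def k_def Let_def)
  have sl: "slot \<mu> P c (b # i) = b # replicate (k b) True @ slot \<mu> P (c' b) i" if "length i = d" for b i
    using that by (simp add: c'_def k_def Let_def)
  show ?case
  proof (cases v)
    case Nil
    have "strict_prefix v (slot \<mu> P c (True # replicate d True))"
      using Nil sl[of "replicate d True" True] by (simp add: strict_prefix_def)
    then show ?thesis by (intro exI[of _ "True # replicate d True"]) simp
  next
    case (Cons b w)
    have w: "w \<in> positions (br b)"
      using Suc.prems unfolding Cons sp by (cases b) (auto split: if_splits)
    then consider (stem) m where "m < k b" "w = replicate m True"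
      | (sub) u where "u \<in> positions (spine \<mu> P L full d (c' b) (\<lambda>i. 0))" "w = replicate (k b) True @ u"
      by (auto simp: br_def positions_stem)
    then show ?thesis
    proof cases
      case stem
      let ?i = "replicate d True"
      have "replicate (k b) True = replicate m True @ replicate (k b - m) True"
        using stem(1) by (simp flip: replicate_add)
      then have "slot \<mu> P c (b # ?i) = v @ replicate (k b - m) True @ slot \<mu> P (c' b) ?i"
        using stem Cons sl[of ?i b] by simp
      then have "strict_prefix v (slot \<mu> P c (b # ?i))"
        using stem(1) by (auto simp: strict_prefix_def)
      then show ?thesis by (intro exI[of _ "b # ?i"]) simp
    next
      case sub
      then obtain i where i: "length i = d" "strict_prefix u (slot \<mu> P (c' b) i)" using Suc.IH by blast
      then have "strict_prefix v (slot \<mu> P c (b # i))"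
        using sub Cons sl[of i b] by (auto simp: strict_prefix_def)
      then show ?thesis using i by (intro exI[of _ "b # i"]) simp
    qed
  qed
qed

lemma spine_cong:
  "(\<And>i. length i = d \<Longrightarrow> x i = y i) \<Longrightarrow> spine \<mu> P L full d c x = spine \<mu> P L full d c y"
proof (induction d arbitrary: c x y)
  case (Suc d)
  have "spine \<mu> P L full d c' (\<lambda>i. x (b # i)) = spine \<mu> P L full d c' (\<lambda>i. y (b # i))" for c' b
    by (rule Suc.IH) (simp add: Suc.prems)
  then show ?case by simp
qed simp

lemma next_offset_less: "c < 2 * P \<Longrightarrow> next_offset P c b < 2 * P"
  by (auto simp: next_offset_def)

lemma size_spine:
  "c < 2 * P \<Longrightarrow> size (spine \<mu> P L full d c x) \<le> 2 ^ d * (L + 2 * (\<mu> + 2 * P) + 1)"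
proof -
  let ?H = "\<mu> + 2 * P"
  \<comment> \<open>The recurrence has the form \<open>a' \<le> 2 * a + (2 * ?H + 1)\<close>; adding
    \<open>2 * ?H + 1\<close> to both sides turns it into plain doubling.\<close>
  have "c < 2 * P \<Longrightarrow> size (spine \<mu> P L full d c x) + (2 * ?H + 1) \<le> 2 ^ d * (L + 2 * ?H + 1)"
  proof (induction d arbitrary: c x)
    case (Suc d)
    define c' where "c' b = (if odd d then next_offset P c b else c)" for b
    define k where "k b = (if odd d then \<mu> + c' b - 1 else \<mu> - 1)" for b
    define br where "br b = stem (k b) (spine \<mu> P L full d (c' b) (\<lambda>i. x (b # i)))" for b
    have c': "c' b < 2 * P" for b using Suc.prems by (simp add: c'_def next_offset_less)
    have k: "k b \<le> ?H" for b using c'[of b] unfolding k_def by (cases "odd d") auto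
    have br: "size (br b) + ?H + 1 \<le> 2 ^ d * (L + 2 * ?H + 1)" for b
      using Suc.IH[OF c', of b "\<lambda>i. x (b # i)"] k[of b] by (simp add: br_def)
    have "spine \<mu> P L full (Suc d) c x = Node (if odd d \<or> full then br False else Leaf) () (br True)"
      by (simp add: br_def c'_def k_def Let_def)
    then have "size (spine \<mu> P L full (Suc d) c x) \<le> size (br False) + size (br True) + 1"
      by (simp del: spine.simps)
    then show ?case using br[of False] br[of True] by simp
  qed auto
  then show "c < 2 * P \<Longrightarrow> ?thesis" by fastforce
qed

lemma height_spine:
  assumes "height (balanced L) \<le> l"
  shows "c < 2 * P \<Longrightarrow> height (spine \<mu> P L full d c x) \<le> d * (\<mu> + 2 * P) + l"
proof (induction d arbitrary: c x)
  case 0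
  then show ?case using assms by simp
next
  case (Suc d)
  define c' where "c' b = (if odd d then next_offset P c b else c)" for b
  define k where "k b = (if odd d then \<mu> + c' b - 1 else \<mu> - 1)" for b
  define br where "br b = stem (k b) (spine \<mu> P L full d (c' b) (\<lambda>i. x (b # i)))" for b
  have c': "c' b < 2 * P" for b using Suc.prems by (simp add: c'_def next_offset_less)
  have k: "Suc (k b) \<le> \<mu> + 2 * P" for b
    using c'[of b] Suc.prems unfolding k_def by (cases "odd d") auto
  have br: "Suc (height (br b)) \<le> Suc d * (\<mu> + 2 * P) + l" for b
    using Suc.IH[OF c', of b "\<lambda>i. x (b # i)"] k[of b] by (simp add: br_def height_stem)
  have "spine \<mu> P L full (Suc d) c x = Node (if odd d \<or> full then br False else Leaf) () (br True)"
    by (simp add: br_def c'_def k_def Let_def)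
  then have "height (spine \<mu> P L full (Suc d) c x) \<le> max (Suc (height (br False))) (Suc (height (br True)))"
    by (simp del: spine.simps)
  then show ?case using br[of False] br[of True] by (meson max.bounded_iff order_trans)
qed

text \<open>Without \<open>full\<close> only every second coordinate branches, hence the factor
  \<open>2 ^ k\<close> for \<open>2 * k\<close> coordinates. With a factor
  \<open>2 ^ (2 * k)\<close> the skeleton would not fit into an error of order
  \<open>L\<close>.\<close>

lemma size_skeleton:
  "c < 2 * P \<Longrightarrow> size (spine \<mu> P L False (2 * k) c (\<lambda>_. 0)) \<le> 2 ^ k * (2 * (2 * \<mu> + 2 * P) + 1)"
proof -
  let ?H = "2 * \<mu> + 2 * P"
  have "c < 2 * P \<Longrightarrow> size (spine \<mu> P L False (2 * k) c (\<lambda>_. 0)) + (2 * ?H + 1) \<le> 2 ^ k * (2 * ?H + 1)"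
  proof (induction k arbitrary: c)
    case (Suc k)
    let ?s = "\<lambda>b. size (spine \<mu> P L False (2 * k) (next_offset P c b) (\<lambda>_. 0))"
    have n: "next_offset P c b < 2 * P" for b using Suc.prems by (rule next_offset_less)
    have "size (spine \<mu> P L False (2 * Suc k) c (\<lambda>_. 0)) =
      Suc ((\<mu> + next_offset P c False - 1) + Suc (\<mu> - 1 + ?s False)
        + ((\<mu> + next_offset P c True - 1) + Suc (\<mu> - 1 + ?s True)))"
      by (simp add: Let_def)
    then show ?case
      using Suc.IH[OF n, of False] Suc.IH[OF n, of True] n[of False] n[of True] by simp
  qed simp
  then show "c < 2 * P \<Longrightarrow> ?thesis" by fastforce
qed

section \<open>The lower bound: common rooted subtrees\<close>

lemma embeds_stem: "embeds T U \<Longrightarrow> embeds (stem k T) (stem k U)"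
  by (induction k) (auto intro: embeds.intros)

lemma alternate_bounds:
  "(\<And>i. f i \<le> 1) \<Longrightarrow> (\<And>i. f i \<ge> 0) \<Longrightarrow> 0 \<le> alternate avg d f \<and> alternate avg d f \<le> 1"
proof (induction d arbitrary: avg f)
  case (Suc d)
  have "0 \<le> alternate (\<not> avg) d (\<lambda>i. f (b # i)) \<and> alternate (\<not> avg) d (\<lambda>i. f (b # i)) \<le> 1" for b
    by (rule Suc.IH) (use Suc.prems in auto)
  from this[of False] this[of True] show ?case by (auto simp: Let_def)
qed simp

lemma alternate_cong:
  "(\<And>i. length i = d \<Longrightarrow> f i = g i) \<Longrightarrow> alternate avg d f = alternate avg d g"
proof (induction d arbitrary: avg f g)
  case (Suc d)
  have "alternate (\<not> avg) d (\<lambda>i. f (b # i)) = alternate (\<not> avg) d (\<lambda>i. g (b # i))" for b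
    by (rule Suc.IH) (use Suc.prems in auto)
  then show ?case by simp
qed simp

text \<open>Positions are counted from the end: fixing the first coordinate leaves the parity of
  \<open>d - k\<close> unchanged, so slices inherit the property also when an odd number of
  coordinates is left. For even \<open>d\<close> it coincides with
  \<open>max_invariant d\<close>.\<close>

definition max_coordinate_invariant :: "nat \<Rightarrow> tensor \<Rightarrow> bool" where
  "max_coordinate_invariant d x \<longleftrightarrow>
     (\<forall>i j. length i = d \<and> length j = d \<and> (\<forall>k<d. even (d - k) \<longrightarrow> i ! k = j ! k) \<longrightarrow> x i = x j)"

lemma max_coordinate_invariant_Cons:
  assumes "max_coordinate_invariant (Suc d) x"
  shows "max_coordinate_invariant d (\<lambda>i. x (b # i))"
  unfolding max_coordinate_invariant_def
proof (intro allI impI)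
  fix i j :: "bool list" assume ij: "length i = d \<and> length j = d \<and> (\<forall>k<d. even (d - k) \<longrightarrow> i ! k = j ! k)"
  have "(b # i) ! k = (b # j) ! k" if "k < Suc d" "even (Suc d - k)" for k
    using that ij by (cases k) auto
  then show "x (b # i) = x (b # j)"
    using assms ij unfolding max_coordinate_invariant_def by (metis length_Cons)
qed

lemma max_coordinate_invariant_head:
  assumes "max_coordinate_invariant (Suc d) x" "even d" "length i = d"
  shows "x (False # i) = x (True # i)"
proof -
  have "(False # i) ! k = (True # i) ! k" if "k < Suc d" "even (Suc d - k)" for k
    using that assms(2) by (cases k) auto
  then show ?thesis using assms unfolding max_coordinate_invariant_def by (metis length_Cons)
qed

text \<open>The common subtree follows an optimal choice of the max coordinates.\<close>

lemma common_embedded_tree: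
  fixes x y :: tensor
  assumes "max_coordinate_invariant d x" "\<And>i. x i \<in> {0, 1}" "\<And>i. y i \<in> {0, 1}"
  shows "\<exists>C. embeds C (spine \<mu> P L False d c x) \<and> embeds C (spine \<mu> P L True d c y) \<and>
    2 ^ (d div 2) * alternate (even d) d (\<lambda>i. real (x i * y i)) * real L \<le> real (size C) \<and>
    (alternate (even d) d (\<lambda>i. real (x i * y i)) = 1 \<longrightarrow> C = spine \<mu> P L False d c x)"
  using assms
proof (induction d arbitrary: c x y)
  case 0
  have "x [] * y [] = 0 \<or> x [] = 1 \<and> y [] = 1" using 0(2)[of "[]"] 0(3)[of "[]"] by auto
  then show ?case
  proof
    assume "x [] * y [] = 0"
    then show ?thesis by (intro exI[of _ Leaf]) (auto intro: embeds.intros)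
  next
    assume "x [] = 1 \<and> y [] = 1"
    then show ?thesis by (intro exI[of _ "balanced L"]) (auto intro: embeds_refl)
  qed
next
  case (Suc d)
  have inv: "max_coordinate_invariant d (\<lambda>i. x (b # i))" for b
    using Suc.prems(1) by (rule max_coordinate_invariant_Cons)

  define s where "s b b' = alternate (even d) d (\<lambda>i. real (x (b # i) * y (b' # i)))" for b b'
  have s1: "s b b' \<le> 1" for b b'
  proof -
    have "real (x (b # i) * y (b' # i)) \<le> 1" for i
      using Suc.prems(2)[of "b # i"] Suc.prems(3)[of "b' # i"] by auto
    then show ?thesis
      using alternate_bounds[of "\<lambda>i. real (x (b # i) * y (b' # i))" "even d" d] by (simp add: s_def)
  qed
  have "\<exists>C. embeds C (spine \<mu> P L False d c' (\<lambda>i. x (b # i))) \<and>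
      embeds C (spine \<mu> P L True d c' (\<lambda>i. y (b' # i))) \<and>
      2 ^ (d div 2) * s b b' * real L \<le> real (size C) \<and>
      (s b b' = 1 \<longrightarrow> C = spine \<mu> P L False d c' (\<lambda>i. x (b # i)))" for c' b b'
    unfolding s_def by (rule Suc.IH[OF inv]) (use Suc.prems in auto)
  then obtain C where C: "\<And>c' b b'. embeds (C c' b b') (spine \<mu> P L False d c' (\<lambda>i. x (b # i)))"
    "\<And>c' b b'. embeds (C c' b b') (spine \<mu> P L True d c' (\<lambda>i. y (b' # i)))"
    "\<And>c' b b'. 2 ^ (d div 2) * s b b' * real L \<le> real (size (C c' b b'))"
    "\<And>c' b b'. s b b' = 1 \<Longrightarrow> C c' b b' = spine \<mu> P L False d c' (\<lambda>i. x (b # i))"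
    by metis
  show ?case
  proof (cases "odd d")
    case True
    define k where "k b = \<mu> + next_offset P c b - 1" for b
    let ?C = "\<lambda>b. stem (k b) (C (next_offset P c b) b b)"
    have A: "spine \<mu> P L full (Suc d) c z = Node (stem (k False) (spine \<mu> P L full d (next_offset P c False) (\<lambda>i. z (False # i)))) ()
       (stem (k True) (spine \<mu> P L full d (next_offset P c True) (\<lambda>i. z (True # i))))" for full z
      using True by (simp add: k_def Let_def)
    have al: "alternate (even (Suc d)) (Suc d) (\<lambda>i. real (x i * y i)) = (s False False + s True True) / 2"
      using True by (simp add: s_def Let_def)
    have d2: "Suc d div 2 = Suc (d div 2)" using True by presburger
    show ?thesis
    proof (intro exI[of _ "Node (?C False) () (?C True)"] conjI impI)
      show "embeds (Node (?C False) () (?C True)) (spine \<mu> P L False (Suc d) c x)"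
        "embeds (Node (?C False) () (?C True)) (spine \<mu> P L True (Suc d) c y)"
        unfolding A by (intro embeds.straight embeds_stem C)+
      show "2 ^ (Suc d div 2) * alternate (even (Suc d)) (Suc d) (\<lambda>i. real (x i * y i)) * real L
        \<le> real (size (Node (?C False) () (?C True)))"
        unfolding al d2
        using C(3)[of False False "next_offset P c False"] C(3)[of True True "next_offset P c True"]
        by (simp add: algebra_simps)
      assume "alternate (even (Suc d)) (Suc d) (\<lambda>i. real (x i * y i)) = 1"
      \<comment> \<open>An average of two numbers that are at most 1 equals 1 only if both
        do.\<close>
      then have "s False False = 1" "s True True = 1"
        using s1[of False False] s1[of True True] unfolding al by auto
      then show "Node (?C False) () (?C True) = spine \<mu> P L False (Suc d) c x"
        unfolding A using C(4) by simp
    qed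
  next
    case False
    have xx: "x (False # i) = x (True # i)" if "length i = d" for i
      using max_coordinate_invariant_head[OF Suc.prems(1) _ that] False by simp
    \<comment> \<open>By max-invariance the only child \<open>True\<close> of the first tree stands
      for both values of the coordinate, so the choice \<open>b\<close> concerns the second tree
      alone.\<close>
    have sF: "s False b' = s True b'" for b'
      unfolding s_def by (rule alternate_cong) (simp add: xx)
    have al: "alternate (even (Suc d)) (Suc d) (\<lambda>i. real (x i * y i)) = max (s True False) (s True True)"
      using False sF[of False] by (simp add: s_def Let_def)
    define b where "b = (s True False \<le> s True True)"
    have mx: "max (s True False) (s True True) = s True b"
      unfolding b_def by (cases "s True False \<le> s True True") auto
    let ?C = "stem (\<mu> - 1) (C c True b)"
    have A: "spine \<mu> P L False (Suc d) c x = Node Leaf () (stem (\<mu> - 1) (spine \<mu> P L False d c (\<lambda>i. x (True # i))))"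
      using False by (simp add: Let_def)
    have B: "spine \<mu> P L True (Suc d) c y = Node (stem (\<mu> - 1) (spine \<mu> P L True d c (\<lambda>i. y (False # i)))) ()
         (stem (\<mu> - 1) (spine \<mu> P L True d c (\<lambda>i. y (True # i))))"
      using False by (simp add: Let_def)
    have d2: "Suc d div 2 = d div 2" using False by presburger
    have e: "embeds ?C (stem (\<mu> - 1) (spine \<mu> P L True d c (\<lambda>i. y (b # i))))"
      by (intro embeds_stem C)
    show ?thesis
    proof (intro exI[of _ "Node Leaf () ?C"] conjI impI)
      show "embeds (Node Leaf () ?C) (spine \<mu> P L False (Suc d) c x)"
        unfolding A by (intro embeds.straight embeds_stem C embeds.Leaf)
      show "embeds (Node Leaf () ?C) (spine \<mu> P L True (Suc d) c y)"
      proof (cases b)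
        case True
        then show ?thesis unfolding B using e by (intro embeds.straight embeds.Leaf) simp
      next
        case False
        then show ?thesis unfolding B using e by (intro embeds.crossed embeds.Leaf) simp
      qed
      show "2 ^ (Suc d div 2) * alternate (even (Suc d)) (Suc d) (\<lambda>i. real (x i * y i)) * real L
        \<le> real (size (Node Leaf () ?C))"
        unfolding al d2 mx using C(3)[of True b c] by simp
      assume "alternate (even (Suc d)) (Suc d) (\<lambda>i. real (x i * y i)) = 1"
      then show "Node Leaf () ?C = spine \<mu> P L False (Suc d) c x"
        unfolding A using C(4)[of True b c] al mx by simp
    qed
  qed
qed

section \<open>Valuations of distances\<close>

text \<open>The 2-adic valuation of \<open>z\<close> is \<open>e\<close>; in particular
  \<open>z\<close> is nonzero.\<close>

definition exact_power :: "nat \<Rightarrow> int \<Rightarrow> bool" where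
  "exact_power e z \<longleftrightarrow> 2 ^ e dvd z \<and> \<not> 2 ^ Suc e dvd z"

lemma exact_power_add: "exact_power e z \<Longrightarrow> 2 ^ Suc e dvd x \<Longrightarrow> exact_power e (z + x)"
  unfolding exact_power_def by (metis dvd_add_left_iff dvd_mult_right dvd_add power_Suc)

lemma exact_power_add': "2 ^ Suc e dvd x \<Longrightarrow> exact_power e z \<Longrightarrow> exact_power e (x + z)"
  using exact_power_add[of e z x] by (simp add: add.commute)

lemma exact_power_mult: "exact_power e z \<Longrightarrow> exact_power (a + e) (2 ^ a * z)"
proof -
  have "(2::int) ^ Suc (a + e) = 2 ^ a * 2 ^ Suc e" "(2::int) ^ (a + e) = 2 ^ a * 2 ^ e"
    by (simp_all add: power_add)
  then show "exact_power e z \<Longrightarrow> ?thesis"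
    unfolding exact_power_def by (simp only: dvd_mult_cancel_left) simp
qed

lemma exact_power_odd: "odd z \<Longrightarrow> exact_power a (2 ^ a * z)"
  using exact_power_mult[of 0 z a] by (simp add: exact_power_def)

lemma exact_power_minus: "exact_power e (- z) \<longleftrightarrow> exact_power e z"
  by (simp add: exact_power_def)

lemma exact_power_dvd_le: "exact_power e z \<Longrightarrow> 2 ^ m dvd z \<Longrightarrow> m \<le> e"
  unfolding exact_power_def by (meson dvd_trans le_imp_power_dvd not_less_eq_eq)

lemma exact_power_unique: "exact_power e z \<Longrightarrow> exact_power e' z \<Longrightarrow> e = e'"
  by (meson exact_power_def exact_power_dvd_le le_antisym)

lemma exact_power_le: "exact_power e z \<Longrightarrow> 2 ^ e \<le> \<bar>z\<bar>"
  unfolding exact_power_def by (metis dvd_0_right dvd_imp_le_int abs_of_nonneg zero_le_power zero_le_numeral)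

text \<open>The ultrametric isosceles property. The third length is strictly larger because over two
  letters three lists cannot all part at the same place.\<close>

lemma lcp_lengths_three:
  assumes "length i1 = length i2" "length i2 = length i3" "i1 \<noteq> i2" "i1 \<noteq> i3" "i2 \<noteq> i3"
  shows "length (lcp i1 i2) = length (lcp i1 i3) \<and> length (lcp i1 i3) < length (lcp i2 i3) \<or>
    length (lcp i1 i2) = length (lcp i2 i3) \<and> length (lcp i2 i3) < length (lcp i1 i3) \<or>
    length (lcp i1 i3) = length (lcp i2 i3) \<and> length (lcp i2 i3) < length (lcp i1 i2)"
  using assms
  by (induction i1 i2 i3 rule: list_induct3) auto

lemma lcp_nth: "l < length (lcp i i') \<Longrightarrow> i ! l = i' ! l"
  by (metis lcp_comm lcp_eq_take nth_take)

lemma lcp_length_less: "length i = length i' \<Longrightarrow> i \<noteq> i' \<Longrightarrow> length (lcp i i') < length i"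
  by (metis lcp_comm lcp_eq_take length_lcp_le(1) nat_less_le order_refl take_all)

lemma lcp_nth_differ:
  "length i = length i' \<Longrightarrow> i \<noteq> i' \<Longrightarrow> i ! length (lcp i i') \<noteq> i' ! length (lcp i i')"
  by (induction i i' rule: list_induct2) auto

text \<open>Pigeonhole in a binary trie: follow the branch that holds more than half of the lists.
  Each time the abandoned branch is nonempty, the list that is finally reached gains a new length at
  which it parts from another one.\<close>

lemma many_lcp_lengths:
  assumes "finite Y" "\<And>y. y \<in> Y \<Longrightarrow> length y = n" "2 ^ m < card Y"
  shows "\<exists>y\<in>Y. Suc m \<le> card ((\<lambda>z. length (lcp y z)) ` (Y - {y}))"
  using assms
proof (induction n arbitrary: Y m)
  case 0
  then have "Y \<subseteq> {[]}" by auto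
  then have "card Y \<le> 1" by (metis card_mono card.empty card_insert_if finite.emptyI finite.insertI empty_iff One_nat_def)
  moreover have "(1::nat) \<le> 2 ^ m" by simp
  ultimately show ?case using 0(3) by linarith
next
  case (Suc n)
  define X where "X b = {y. b # y \<in> Y}" for b
  have img: "(#) b ` X b \<subseteq> Y" for b by (auto simp: X_def)
  have fin: "finite (X b)" for b
    using finite_imageD[OF finite_subset[OF img[of b] Suc.prems(1)]] by auto
  have len: "length y = n" if "y \<in> X b" for y b using Suc.prems(2) that by (force simp: X_def)
  have Y: "Y = (#) False ` X False \<union> (#) True ` X True"
  proof
    show "Y \<subseteq> (#) False ` X False \<union> (#) True ` X True"
    proof
      fix y assume y: "y \<in> Y"
      then obtain b z where "y = b # z" using Suc.prems(2) by (metis length_Suc_conv)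
      then show "y \<in> (#) False ` X False \<union> (#) True ` X True" using y by (cases b) (auto simp: X_def)
    qed
  qed (use img in auto)
  have IH: "\<exists>y\<in>X b. Suc k \<le> card ((\<lambda>z. length (lcp y z)) ` (X b - {y}))" if "2 ^ k < card (X b)" for k b
    by (rule Suc.IH[OF fin _ that]) (rule len)
  have cY: "card Y = card (X False) + card (X True)"
    unfolding Y by (subst card_Un_disjoint) (auto simp: fin card_image)
  have lift: "Suc ` (\<lambda>z. length (lcp y z)) ` (X b - {y}) \<subseteq> (\<lambda>z. length (lcp (b # y) z)) ` (Y - {b # y})" for y b
    unfolding image_image
  proof (rule image_subsetI)
    fix z assume z: "z \<in> X b - {y}"
    have "b # z \<in> Y - {b # y}" using z by (auto simp: X_def)
    then show "Suc (length (lcp y z)) \<in> (\<lambda>z. length (lcp (b # y) z)) ` (Y - {b # y})"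
      by (rule rev_image_eqI) simp
  qed
  show ?case
  proof (cases "\<exists>b. X b = {}")
    case True
    then obtain b where "X b = {}" by blast
    then have "card Y = card (X (\<not> b))" using cY by (cases b) auto
    then obtain y where y: "y \<in> X (\<not> b)" "Suc m \<le> card ((\<lambda>z. length (lcp y z)) ` (X (\<not> b) - {y}))"
      using IH[of m "\<not> b"] Suc.prems(3) by auto
    have "Suc m \<le> card (Suc ` (\<lambda>z. length (lcp y z)) ` (X (\<not> b) - {y}))"
      using y(2) by (subst card_image) auto
    also have "\<dots> \<le> card ((\<lambda>z. length (lcp ((\<not> b) # y) z)) ` (Y - {(\<not> b) # y}))"
      by (rule card_mono[OF _ lift]) (use Suc.prems(1) in auto)
    finally show ?thesis using y(1) by (auto simp: X_def)
  next
    case False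
    show ?thesis
    proof (cases m)
      case 0
      obtain y z where y: "y \<in> X True" "z \<in> X False" using False by blast
      then have "False # z \<in> Y - {True # y}" by (auto simp: X_def)
      then have "(\<lambda>z. length (lcp (True # y) z)) ` (Y - {True # y}) \<noteq> {}" by blast
      then have "Suc m \<le> card ((\<lambda>z. length (lcp (True # y) z)) ` (Y - {True # y}))"
        using 0 Suc.prems(1) by (simp add: Suc_le_eq card_gt_0_iff)
      then show ?thesis using y by (auto simp: X_def)
    next
      case (Suc m')
      have "\<exists>b. 2 ^ m' < card (X b)"
      proof (rule ccontr)
        assume "\<not> ?thesis"
        then have "card (X False) \<le> 2 ^ m'" "card (X True) \<le> 2 ^ m'" by (simp_all add: not_less)
        then show False using cY Suc.prems(3) Suc by simp
      qed
      then obtain b where "2 ^ m' < card (X b)" by blast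
      then obtain y where y: "y \<in> X b" "Suc m' \<le> card ((\<lambda>z. length (lcp y z)) ` (X b - {y}))"
        using IH[of m' b] by auto
      obtain z where z: "z \<in> X (\<not> b)" using False by blast
      let ?S = "Suc ` (\<lambda>z. length (lcp y z)) ` (X b - {y})"
      have "(\<not> b) # z \<in> Y - {b # y}" using z by (auto simp: X_def)
      then have "0 \<in> (\<lambda>z. length (lcp (b # y) z)) ` (Y - {b # y})"
        by (rule rev_image_eqI) simp
      then have sub: "insert 0 ?S \<subseteq> (\<lambda>z. length (lcp (b # y) z)) ` (Y - {b # y})"
        using lift[of y b] by simp
      have "card ?S = card ((\<lambda>z. length (lcp y z)) ` (X b - {y}))" by (subst card_image) auto
      moreover have "card (insert 0 ?S) = Suc (card ?S)"
        by (rule card_insert_disjoint) (auto simp: fin)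
      ultimately have "Suc m \<le> card (insert 0 ?S)" using y(2) Suc by simp
      also have "\<dots> \<le> card ((\<lambda>z. length (lcp (b # y) z)) ` (Y - {b # y}))"
        by (rule card_mono[OF _ sub]) (use Suc.prems(1) in auto)
      finally show ?thesis using y(1) by (auto simp: X_def)
    qed
  qed
qed

section \<open>Depths of skeleton nodes and their valuations\<close>

locale spacing =
  fixes n \<mu> :: nat
  assumes \<mu>_dvd: "2 ^ (n + 2) dvd \<mu>" and \<mu>_pos: "0 < \<mu>"
begin

text \<open>The expectation bits read as a binary number whose least significant digit is the first
  bit. Hence the valuation of a difference of two such numbers is the first place where the bits
  differ.\<close>

definition reversal :: "bool list \<Rightarrow> nat \<Rightarrow> int" where
  "reversal i k = (\<Sum>l<k. of_bool (i ! (2 * l)) * 2 ^ l)"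

definition dep :: "bool list \<Rightarrow> nat \<Rightarrow> int" where
  "dep i k = (\<Sum>l<k. 2 * int \<mu> + 2 ^ (n - Suc l) * (2 * reversal i (Suc l) + 1))"

text \<open>The depth of the skeleton node reached after \<open>f\<close> coordinates of
  \<open>i\<close>. For odd \<open>f\<close> this is a max node, \<mu> above the next expectation
  node: therefore the level is rounded up and \<mu> subtracted.\<close>

definition bdep :: "bool list \<Rightarrow> nat \<Rightarrow> int" where
  "bdep i f = dep i (Suc f div 2) - (if odd f then int \<mu> else 0)"

lemma int_\<mu>_dvd: "2 ^ (n + 2) dvd int \<mu>"
proof -
  have "int (2 ^ (n + 2)) dvd int \<mu>" using \<mu>_dvd by (simp only: of_nat_dvd_iff)
  then show ?thesis by simp
qed

lemma reversal_nonneg: "0 \<le> reversal i k"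
  unfolding reversal_def by (intro sum_nonneg) auto

lemma dep_Suc: "dep i (Suc k) = dep i k + (2 * int \<mu> + 2 ^ (n - Suc k) * (2 * reversal i (Suc k) + 1))"
  by (simp add: dep_def)

lemma dep_0 [simp]: "dep i 0 = 0"
  by (simp add: dep_def)

lemma dep_cong: "(\<And>l. l < k \<Longrightarrow> i ! (2 * l) = i' ! (2 * l)) \<Longrightarrow> dep i k = dep i' k"
  unfolding dep_def reversal_def by (intro sum.cong) auto

lemma dep_less_Suc: "dep i k + 2 * int \<mu> < dep i (Suc k)"
proof -
  have "0 < (2::int) ^ (n - Suc k) * (2 * reversal i (Suc k) + 1)"
    using reversal_nonneg[of i "Suc k"] by (intro mult_pos_pos) auto
  then show ?thesis by (simp add: dep_Suc)
qed

lemma dep_less: "k < k' \<Longrightarrow> dep i k + 2 * int \<mu> < dep i k'"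
proof (induction k' rule: less_induct)
  case (less k')
  then show ?case
  proof (cases "k' = Suc k")
    case False
    then obtain k'' where k: "k' = Suc k''" "k < k''" using less.prems by (cases k') auto
    then show ?thesis using less.IH[of k''] dep_less_Suc[of i k''] by simp
  qed (simp add: dep_less_Suc)
qed

lemma bdep_Suc: "bdep i f + int \<mu> \<le> bdep i (Suc f)"
proof (cases "odd f")
  case True
  then obtain m where "f = 2 * m + 1" by (rule oddE)
  then show ?thesis by (simp add: bdep_def)
next
  case False
  then obtain m where "f = 2 * m" by auto
  then show ?thesis using dep_less_Suc[of i m] by (simp add: bdep_def)
qed

lemma bdep_less: "f < f' \<Longrightarrow> bdep i f + int \<mu> \<le> bdep i f'"
proof (induction f')
  case (Suc f')
  then show ?case using bdep_Suc[of i f'] by (cases "f = f'") auto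
qed simp

lemma bdep_mono_iff: "bdep i f < bdep i f' \<longleftrightarrow> f < f'"
  using bdep_less[of f f' i] bdep_less[of f' f i] \<mu>_pos by (cases f f' rule: linorder_cases) auto

lemma dep_mono_iff: "dep i k < dep i k' \<longleftrightarrow> k < k'"
  using dep_less[of k k' i] dep_less[of k' k i] \<mu>_pos by (cases k k' rule: linorder_cases) auto

lemma bdep_cong: "(\<And>l. l < f \<Longrightarrow> i ! l = i' ! l) \<Longrightarrow> bdep i f = bdep i' f"
  unfolding bdep_def by (subst dep_cong[of _ i i']) auto

lemma dep_diff_dvd: "k \<le> k' \<Longrightarrow> k' \<le> n \<Longrightarrow> 2 ^ (n - k') dvd dep i k' - dep i k"
proof (induction k' rule: dec_induct)
  case (step k')
  have *: "(2::int) ^ (n - Suc k') dvd 2 ^ (n - k')" "(2::int) ^ (n - Suc k') dvd 2 ^ (n + 2)"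
    by (rule le_imp_power_dvd, simp)+
  have "2 ^ (n - k') dvd dep i k' - dep i k" using step by simp
  then have "(2::int) ^ (n - Suc k') dvd dep i k' - dep i k"
    by (rule dvd_trans[OF *(1)])
  moreover have "(2::int) ^ (n - Suc k') dvd 2 * int \<mu>"
    by (rule dvd_mult[OF dvd_trans[OF *(2) int_\<mu>_dvd]])
  ultimately have "(2::int) ^ (n - Suc k') dvd (dep i k' - dep i k) +
      (2 * int \<mu> + 2 ^ (n - Suc k') * (2 * reversal i (Suc k') + 1))"
    by (intro dvd_add dvd_triv_left)
  also have "\<dots> = dep i (Suc k') - dep i k" by (simp add: dep_Suc)
  finally show ?case .
qed simp

text \<open>The last summand decides: its cofactor \<open>2 * reversal i k' + 1\<close> is odd,
  while the earlier summands and the multiples of \<mu> contain higher powers of 2.\<close>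

lemma dep_diff_exact:
  assumes "k < k'" "k' \<le> n"
  shows "exact_power (n - k') (dep i k' - dep i k)"
proof -
  obtain m where m: "k' = Suc m" using assms(1) by (cases k') auto
  have s: "Suc (n - k') = n - m" using m assms(2) by simp
  have "2 ^ Suc (n - k') dvd dep i m - dep i k"
    unfolding s using dep_diff_dvd[of k m i] assms m by simp
  moreover have "(2::int) ^ Suc (n - k') dvd 2 * int \<mu>"
    by (rule dvd_mult[OF dvd_trans[OF _ int_\<mu>_dvd]], rule le_imp_power_dvd) simp
  ultimately have "2 ^ Suc (n - k') dvd dep i m - dep i k + 2 * int \<mu>" by (rule dvd_add)
  moreover have "exact_power (n - k') (2 ^ (n - k') * (2 * reversal i k' + 1))"
    by (rule exact_power_odd) simp
  ultimately have "exact_power (n - k') (dep i m - dep i k + 2 * int \<mu> + 2 ^ (n - k') * (2 * reversal i k' + 1))"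
    by (rule exact_power_add')
  then show ?thesis unfolding m dep_Suc by (simp add: algebra_simps)
qed

lemma reversal_diff_exact:
  assumes "\<And>l. l < e \<Longrightarrow> i ! (2 * l) = i' ! (2 * l)" "i ! (2 * e) \<noteq> i' ! (2 * e)" "e < k"
  shows "exact_power e (reversal i k - reversal i' k)"
  using assms(3)
proof (induction k)
  case (Suc k)
  show ?case
  proof (cases "e = k")
    case True
    have "reversal i k = reversal i' k" unfolding reversal_def by (intro sum.cong) (use assms(1) True in auto)
    then have "reversal i (Suc k) - reversal i' (Suc k) = 2 ^ e * (of_bool (i ! (2 * e)) - of_bool (i' ! (2 * e)))"
      by (simp add: reversal_def True algebra_simps)
    moreover have "odd (of_bool (i ! (2 * e)) - of_bool (i' ! (2 * e)) :: int)" using assms(2) by auto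
    ultimately show ?thesis using exact_power_odd by metis
  next
    case False
    then have ih: "exact_power e (reversal i k - reversal i' k)" using Suc by simp
    have "(2::int) ^ Suc e dvd 2 ^ k" using False Suc.prems by (intro le_imp_power_dvd) simp
    then have "2 ^ Suc e dvd 2 ^ k * (of_bool (i ! (2 * k)) - of_bool (i' ! (2 * k)) :: int)" by (rule dvd_mult2)
    from exact_power_add[OF ih this] show ?thesis by (simp add: reversal_def algebra_simps)
  qed
qed simp

lemma dep_difference_dvd:
  assumes eq: "\<And>l. l < e \<Longrightarrow> i ! (2 * l) = i' ! (2 * l)" and k: "k \<le> k'" "k' \<le> n"
  shows "2 ^ (n - k' + 1 + e) dvd (dep i k' - dep i k) - (dep i' k' - dep i' k)"
  using k
proof (induction k' rule: dec_induct)
  case (step m)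
  have "(2::int) ^ e dvd reversal i (Suc m) - reversal i' (Suc m)"
  proof -
    have "2 ^ e dvd reversal i q - reversal i' q" for q
    proof (induction q)
      case (Suc q)
      show ?case
      proof (cases "q < e")
        case True
        then show ?thesis using Suc eq by (simp add: reversal_def)
      next
        case False
        then have "(2::int) ^ e dvd 2 ^ q" by (intro le_imp_power_dvd) simp
        then have "(2::int) ^ e dvd 2 ^ q * (of_bool (i ! (2 * q)) - of_bool (i' ! (2 * q)))" by (rule dvd_mult2)
        from dvd_add[OF Suc this] show ?thesis by (simp add: reversal_def algebra_simps)
      qed
    qed (simp add: reversal_def)
    then show ?thesis .
  qed
  then have "(2::int) ^ (n - Suc m + 1) * 2 ^ e dvd 2 ^ (n - Suc m + 1) * (reversal i (Suc m) - reversal i' (Suc m))"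
    by (rule mult_dvd_mono[OF dvd_refl])
  then have 1: "(2::int) ^ (n - Suc m + 1 + e) dvd 2 ^ (n - Suc m + 1) * (reversal i (Suc m) - reversal i' (Suc m))"
    by (simp add: power_add)
  have "(2::int) ^ (n - Suc m + 1 + e) dvd 2 ^ (n - m + 1 + e)" by (rule le_imp_power_dvd) simp
  moreover have "2 ^ (n - m + 1 + e) dvd (dep i m - dep i k) - (dep i' m - dep i' k)"
    using step by simp
  ultimately have 2: "2 ^ (n - Suc m + 1 + e) dvd (dep i m - dep i k) - (dep i' m - dep i' k)"
    by (rule dvd_trans)
  from dvd_add[OF 2 1] show ?case by (simp add: dep_Suc algebra_simps)
qed simp

text \<open>The odd parts cancel between the two paths, and what remains in level \<open>l\<close>
  is \<open>2 ^ (n - l + 1)\<close> times a difference of reversals. That difference is zero up to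
  level \<open>e\<close> and has valuation \<open>e\<close> afterwards, so again the last level has
  the lowest power of 2.\<close>

lemma dep_difference_exact:
  assumes "\<And>l. l < e \<Longrightarrow> i ! (2 * l) = i' ! (2 * l)" "i ! (2 * e) \<noteq> i' ! (2 * e)" "e < k'"
    and k: "k < k'" "k' \<le> n"
  shows "exact_power (n - k' + 1 + e) ((dep i k' - dep i k) - (dep i' k' - dep i' k))"
proof -
  obtain m where m: "k' = Suc m" using k(1) by (cases k') auto
  have s: "Suc (n - k' + 1 + e) = n - m + 1 + e" using m k(2) by simp
  have 1: "2 ^ Suc (n - k' + 1 + e) dvd (dep i m - dep i k) - (dep i' m - dep i' k)"
    unfolding s using dep_difference_dvd[OF assms(1), of e k m] k m by simp
  have "exact_power (n - k' + 1 + e) (2 ^ (n - k' + 1) * (reversal i k' - reversal i' k'))"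
    by (rule exact_power_mult[OF reversal_diff_exact[OF assms(1-3)]])
  from exact_power_add'[OF 1 this] show ?thesis unfolding m dep_Suc by (simp add: algebra_simps)
qed

text \<open>Up to multiples of \<mu>, to which valuations below \<open>n + 2\<close> are blind, a
  max node counts as the expectation node beneath it.\<close>

lemma bdep_diff:
  "\<exists>t. bdep i f' - bdep i f = dep i (Suc f' div 2) - dep i (Suc f div 2) + t * int \<mu>"
proof -
  have "bdep i f' - bdep i f = dep i (Suc f' div 2) - dep i (Suc f div 2) +
     ((if odd f then 1 else 0) - (if odd f' then 1 else 0)) * int \<mu>"
    by (simp add: bdep_def)
  then show ?thesis by blast
qed

lemma \<mu>_mult_dvd: "m \<le> n + 2 \<Longrightarrow> 2 ^ m dvd t * int \<mu>"
  by (rule dvd_mult[OF dvd_trans[OF le_imp_power_dvd int_\<mu>_dvd]])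

text \<open>The length of a vertical path betrays the level of its lower end through its valuation
  \<open>n - k'\<close>. Were both ends on the right of the same rounded level, the length would be
  a multiple of \<mu>, whose valuation is too large.\<close>

lemma equal_difference_level:
  assumes "dep j k' - dep j k = bdep i f' - bdep i f" "k < k'" "k' \<le> n" "f < f'" "f' \<le> 2 * n"
  shows "k' = Suc f' div 2" "Suc f div 2 < Suc f' div 2"
proof -
  have e: "exact_power (n - k') (bdep i f' - bdep i f)"
    using dep_diff_exact[OF assms(2,3), of j] assms(1) by simp
  obtain t where t: "bdep i f' - bdep i f = dep i (Suc f' div 2) - dep i (Suc f div 2) + t * int \<mu>"
    using bdep_diff by blast
  show lt: "Suc f div 2 < Suc f' div 2"
  proof (rule ccontr)
    assume "\<not> ?thesis"
    then have "Suc f div 2 = Suc f' div 2" using assms(4) by (meson Suc_le_mono div_le_mono le_antisym less_imp_le not_less)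
    then have "bdep i f' - bdep i f = t * int \<mu>" using t by simp
    then have "n + 2 \<le> n - k'" using exact_power_dvd_le[OF e, of "n + 2"] \<mu>_mult_dvd[of "n + 2" t] by simp
    then show False by simp
  qed
  have f': "Suc f' div 2 \<le> n" using assms(5) by linarith
  have "exact_power (n - Suc f' div 2) (bdep i f' - bdep i f)"
    unfolding t by (rule exact_power_add[OF dep_diff_exact[OF lt f'] \<mu>_mult_dvd]) simp
  from exact_power_unique[OF e this] show "k' = Suc f' div 2" using f' assms(3) by linarith
qed

text \<open>A first disagreement at \<open>e < k'\<close> would produce the valuation
  \<open>n - k' + 1 + e\<close>, which is at most \<open>n\<close>.\<close>

lemma congruent_depths_agree:
  assumes "2 ^ (n + 2) dvd dep i k' - dep i k - (dep i' k' - dep i' k)" "k < k'" "k' \<le> n" "l < k'"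
  shows "i ! (2 * l) = i' ! (2 * l)"
proof (rule ccontr)
  assume ne: "\<not> ?thesis"
  define e where "e = (LEAST l. i ! (2 * l) \<noteq> i' ! (2 * l))"
  have e: "i ! (2 * e) \<noteq> i' ! (2 * e)" unfolding e_def by (rule LeastI) (rule ne)
  have lt: "\<And>l. l < e \<Longrightarrow> i ! (2 * l) = i' ! (2 * l)" unfolding e_def using not_less_Least by blast
  have "e < k'" using ne assms(4) lt by (metis linorder_neqE_nat order.strict_trans)
  from dep_difference_exact[OF lt e this assms(2,3)] assms(1) have "n + 2 \<le> n - k' + 1 + e"
    by (rule exact_power_dvd_le)
  then show False using \<open>e < k'\<close> assms(3) by simp
qed

text \<open>Of two depths at different levels the deeper one has the smaller valuation, which the
  other cannot cancel; so the levels are equal. The bits then follow by comparing the paths from the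
  root.\<close>

lemma congruent_depths_level:
  assumes "2 ^ (n + 2) dvd dep i k - dep i' k'" "k \<le> n" "k' \<le> n"
  shows "k = k' \<and> (\<forall>l<k. i ! (2 * l) = i' ! (2 * l))"
proof -
  have less: "\<not> a < b" if "2 ^ (n + 2) dvd dep x a - dep y b" "b \<le> n" for x y a b
  proof
    assume ab: "a < b"
    have "2 ^ Suc (n - b) dvd dep x a"
    proof -
      have "2 ^ (n - a) dvd dep x a" using dep_diff_dvd[of 0 a x] ab that(2) by simp
      moreover have "(2::int) ^ Suc (n - b) dvd 2 ^ (n - a)" using ab that(2) by (intro le_imp_power_dvd) simp
      ultimately show ?thesis by (rule dvd_trans[rotated])
    qed
    moreover have "exact_power (n - b) (- dep y b)"
      unfolding exact_power_minus using dep_diff_exact[of 0 b y] ab that(2) by simp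
    ultimately have "exact_power (n - b) (dep x a + - dep y b)" by (rule exact_power_add')
    then have "n + 2 \<le> n - b" using that(1) by (intro exact_power_dvd_le[of _ "dep x a - dep y b"]) auto
    then show False by simp
  qed
  have "2 ^ (n + 2) dvd dep i' k' - dep i k" using assms(1) by (metis dvd_minus_iff minus_diff_eq)
  then have k: "k = k'" using less[of i k i' k'] less[of i' k' i k] assms by simp
  moreover have "i ! (2 * l) = i' ! (2 * l)" if "l < k" for l
    by (rule congruent_depths_agree[of i k 0 i']) (use assms k that in auto)
  ultimately show ?thesis by blast
qed

end

section \<open>Matched gadgets\<close>

lemma sum_half_powers: "(\<Sum>k=1..n. (1 / 2 :: real) ^ k) \<le> 1"
proof -
  have "(\<Sum>k=1..n. (1 / 2 :: real) ^ k) = 1 - (1 / 2) ^ n" by (induction n) auto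
  then show ?thesis by simp
qed

lemma card_bool_lists: "card {q :: bool list. length q = k} = 2 ^ k"
  using card_lists_length_eq[of "UNIV :: bool set" k] by simp

lemma finite_bool_lists: "finite {q :: bool list. length q = k}"
  using finite_lists_length_eq[of "UNIV :: bool set" k] by simp

lemma three_in_set:
  assumes "3 \<le> card S" "finite S"
  obtains a b c :: nat where "a \<in> S" "b \<in> S" "c \<in> S" "a < b" "b < c"
proof -
  let ?l = "sorted_list_of_set S"
  have l: "length ?l = card S" "sorted_wrt (<) ?l" "set ?l = S" using assms(2) by auto
  have "?l ! 0 < ?l ! 1" "?l ! 1 < ?l ! 2"
    using l(1,2) assms(1) by (simp_all add: sorted_wrt_iff_nth_less)
  moreover have "?l ! 0 \<in> S" "?l ! 1 \<in> S" "?l ! 2 \<in> S"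
    using nth_mem[of 0 ?l] nth_mem[of 1 ?l] nth_mem[of 2 ?l] l(1,3) assms(1) by simp_all
  ultimately show thesis using that by blast
qed

text \<open>The isosceles pattern of three common prefixes passes to the depths, since a depth may
  be computed from either list of the pair. Information on the levels is kept in the alternatives
  where \<open>shift_order\<close> draws on it: the first for \<open>dep\<close>, the third for
  \<open>bdep\<close>.\<close>

lemma three_transfer:
  fixes D :: "'a \<Rightarrow> nat \<Rightarrow> int"
  assumes mono: "\<And>j k k'. D j k < D j k' \<longleftrightarrow> k < k'"
    and agree: "D j1 a = D j2 a" "D j1 b = D j3 b" "D j2 c = D j3 c"
    and three: "a = b \<and> b < c \<or> a = c \<and> c < b \<or> b = c \<and> c < a"
  shows "D j1 a = D j1 b \<and> D j1 b < D j2 c \<and> a = b \<and> b < c \<or> D j1 a = D j2 c \<and> D j2 c < D j1 b \<or>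
    D j1 b = D j2 c \<and> D j2 c < D j1 a \<and> b = c \<and> b < a"
  using three
proof (elim disjE conjE)
  assume "a = b" "b < c"
  then show ?thesis using mono[of j3 b c] agree by simp
next
  assume "a = c" "c < b"
  then show ?thesis using mono[of j3 c b] agree by simp
next
  assume "b = c" "c < a"
  then show ?thesis using mono[of j2 c a] agree by simp
qed

lemma double_Suc_le_power: "2 * Suc m \<le> 2 ^ Suc m"
  by (induction m) auto

text \<open>The upper bound reduced to arithmetic: \<open>R\<close> consists of the matched gadgets
  of the first tree, \<open>\<kappa> j\<close> is the partner of \<open>j\<close>, and
  \<open>\<sigma> j\<close> is the depth of a node of gadget \<open>j\<close> minus the depth of its
  image. The assumption \<open>shifts\<close> is the equality of distances for a pair of gadgets;
  \<open>even_lcp\<close> reflects that trees of \<open>A\<close> branch at expectation coordinates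
  only.\<close>

locale matching = spacing +
  fixes R :: "bool list set" and \<kappa> :: "bool list \<Rightarrow> bool list" and \<sigma> :: "bool list \<Rightarrow> int"
  assumes fin: "finite R"
    and len: "\<And>j. j \<in> R \<Longrightarrow> length j = 2 * n" "\<And>j. j \<in> R \<Longrightarrow> length (\<kappa> j) = 2 * n"
    and inj: "inj_on \<kappa> R"
    and even_lcp: "\<And>j j'. j \<in> R \<Longrightarrow> j' \<in> R \<Longrightarrow> j \<noteq> j' \<Longrightarrow> even (length (lcp j j'))"
    and shifts: "\<And>j j'. j \<in> R \<Longrightarrow> j' \<in> R \<Longrightarrow> j \<noteq> j' \<Longrightarrow>
      \<sigma> j + \<sigma> j' = 2 * (dep j (length (lcp j j') div 2) - bdep (\<kappa> j) (length (lcp (\<kappa> j) (\<kappa> j'))))"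
begin

definition lev :: "bool list \<Rightarrow> bool list \<Rightarrow> nat" where "lev j j' = length (lcp j j') div 2"
definition blev :: "bool list \<Rightarrow> bool list \<Rightarrow> nat" where "blev j j' = length (lcp (\<kappa> j) (\<kappa> j'))"

lemma lev_less: "j \<in> R \<Longrightarrow> j' \<in> R \<Longrightarrow> j \<noteq> j' \<Longrightarrow> lev j j' < n"
  using lcp_length_less[of j j'] len by (simp add: lev_def)

lemma \<kappa>_ne: "j \<in> R \<Longrightarrow> j' \<in> R \<Longrightarrow> j \<noteq> j' \<Longrightarrow> \<kappa> j \<noteq> \<kappa> j'"
  using inj by (auto dest: inj_onD)

lemma blev_less: "j \<in> R \<Longrightarrow> j' \<in> R \<Longrightarrow> j \<noteq> j' \<Longrightarrow> blev j j' < 2 * n"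
  using lcp_length_less[of "\<kappa> j" "\<kappa> j'"] len \<kappa>_ne by (simp add: blev_def)

lemma dep_lev: "dep j (lev j j') = dep j' (lev j j')"
  by (rule dep_cong) (rule lcp_nth, auto simp: lev_def)

lemma bdep_blev: "bdep (\<kappa> j) (blev j j') = bdep (\<kappa> j') (blev j j')"
  by (rule bdep_cong) (rule lcp_nth, auto simp: blev_def)

lemma shift_pair: "j \<in> R \<Longrightarrow> j' \<in> R \<Longrightarrow> j \<noteq> j' \<Longrightarrow>
    \<sigma> j + \<sigma> j' = 2 * (dep j (lev j j') - bdep (\<kappa> j) (blev j j'))"
  using shifts by (simp add: lev_def blev_def)

lemma lev_three:
  assumes "j1 \<in> R" "j2 \<in> R" "j3 \<in> R" "j1 \<noteq> j2" "j1 \<noteq> j3" "j2 \<noteq> j3"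
  shows "lev j1 j2 = lev j1 j3 \<and> lev j1 j3 < lev j2 j3 \<or>
    lev j1 j2 = lev j2 j3 \<and> lev j2 j3 < lev j1 j3 \<or> lev j1 j3 = lev j2 j3 \<and> lev j2 j3 < lev j1 j2"
proof -
  have "even (length (lcp j1 j2))" "even (length (lcp j1 j3))" "even (length (lcp j2 j3))"
    using even_lcp assms by auto
  then show ?thesis
    using lcp_lengths_three[of j1 j2 j3] assms len unfolding lev_def by (auto elim!: evenE)
qed

lemma blev_three:
  assumes "j1 \<in> R" "j2 \<in> R" "j3 \<in> R" "j1 \<noteq> j2" "j1 \<noteq> j3" "j2 \<noteq> j3"
  shows "blev j1 j2 = blev j1 j3 \<and> blev j1 j3 < blev j2 j3 \<or>
    blev j1 j2 = blev j2 j3 \<and> blev j2 j3 < blev j1 j3 \<or> blev j1 j3 = blev j2 j3 \<and> blev j2 j3 < blev j1 j2"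
  using lcp_lengths_three[of "\<kappa> j1" "\<kappa> j2" "\<kappa> j3"] assms len \<kappa>_ne unfolding blev_def by simp

text \<open>The shift sums of the pairs \<open>(j1, j2)\<close>, \<open>(j1, j3)\<close>,
  \<open>(j2, j3)\<close> increase strictly, while on either side the branching depths follow the
  pattern of two equal values and a larger third. Only one combination of patterns is compatible:
  \<open>j2\<close> and \<open>j3\<close> part last in the first tree, the partners of
  \<open>j1\<close> and \<open>j2\<close> part last in the second.\<close>

lemma shift_order:
  assumes R: "j1 \<in> R" "j2 \<in> R" "j3 \<in> R" and s: "\<sigma> j1 < \<sigma> j2" "\<sigma> j2 < \<sigma> j3"
  shows "lev j1 j2 = lev j1 j3 \<and> lev j1 j3 < lev j2 j3 \<and> blev j1 j3 = blev j2 j3 \<and> blev j1 j3 < blev j1 j2"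
proof -
  have ne: "j1 \<noteq> j2" "j1 \<noteq> j3" "j2 \<noteq> j3" using s by auto
  let ?p = "\<lambda>j j'. dep j (lev j j')" and ?q = "\<lambda>j j'. bdep (\<kappa> j) (blev j j')"
  have P: "?p j1 j2 = ?p j1 j3 \<and> ?p j1 j3 < ?p j2 j3 \<and> lev j1 j2 = lev j1 j3 \<and> lev j1 j3 < lev j2 j3 \<or>
    ?p j1 j2 = ?p j2 j3 \<and> ?p j2 j3 < ?p j1 j3 \<or> ?p j1 j3 = ?p j2 j3 \<and> ?p j2 j3 < ?p j1 j2"
    using three_transfer[of dep, OF dep_mono_iff dep_lev[of j1 j2] dep_lev[of j1 j3] dep_lev[of j2 j3] lev_three[OF R ne]]
    by blast
  have Q: "?q j1 j2 = ?q j1 j3 \<and> ?q j1 j3 < ?q j2 j3 \<or> ?q j1 j2 = ?q j2 j3 \<and> ?q j2 j3 < ?q j1 j3 \<or>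
    ?q j1 j3 = ?q j2 j3 \<and> ?q j2 j3 < ?q j1 j2 \<and> blev j1 j3 = blev j2 j3 \<and> blev j1 j3 < blev j1 j2"
    using three_transfer[of bdep, OF bdep_mono_iff bdep_blev[of j1 j2] bdep_blev[of j1 j3] bdep_blev[of j2 j3] blev_three[OF R ne]]
    by blast
  have eqs: "\<sigma> j1 + \<sigma> j2 = 2 * (?p j1 j2 - ?q j1 j2)" "\<sigma> j1 + \<sigma> j3 = 2 * (?p j1 j3 - ?q j1 j3)"
    "\<sigma> j2 + \<sigma> j3 = 2 * (?p j2 j3 - ?q j2 j3)"
    using shift_pair R ne by auto
  show ?thesis using P Q eqs s by (elim disjE conjE) auto
qed

text \<open>Between pieces of different shift the matching reverses the direction of the skeleton, so
  levels increase on one side while they decrease on the other; valuations allow this only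
  a bounded number of times.\<close>

lemma card_shifts_le: "card (\<sigma> ` R) \<le> 4"
proof (rule ccontr)
  assume "\<not> ?thesis"
  then have c: "5 \<le> card (\<sigma> ` R)" by simp
  let ?l = "sorted_list_of_set (\<sigma> ` R)"
  have l: "length ?l = card (\<sigma> ` R)" "sorted_wrt (<) ?l" "set ?l = \<sigma> ` R" using fin by auto
  have lt: "?l ! a < ?l ! b" if "a < b" "b < 5" for a b
    using l(1,2) c that by (simp add: sorted_wrt_iff_nth_less)
  have "\<exists>j\<in>R. \<sigma> j = ?l ! a" if "a < 5" for a
    using l(1,3) c that by (metis (no_types, opaque_lifting) imageE less_le_trans nth_mem)
  then obtain j where j: "\<And>a. a < 5 \<Longrightarrow> j a \<in> R" "\<And>a. a < 5 \<Longrightarrow> \<sigma> (j a) = ?l ! a"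
    by metis
  have R: "j 0 \<in> R" "j 1 \<in> R" "j 2 \<in> R" "j 3 \<in> R" "j 4 \<in> R" using j(1) by auto
  have s: "\<sigma> (j 0) < \<sigma> (j 1)" "\<sigma> (j 1) < \<sigma> (j 2)" "\<sigma> (j 2) < \<sigma> (j 3)" "\<sigma> (j 3) < \<sigma> (j 4)"
    using lt j(2) by auto
  have ne: "j 0 \<noteq> j 1" "j 0 \<noteq> j 2" "j 0 \<noteq> j 3" "j 1 \<noteq> j 4" "j 2 \<noteq> j 4" "j 3 \<noteq> j 4" using s by auto
  note o1 = shift_order[OF R(1) R(2) R(5)] and o2 = shift_order[OF R(2) R(3) R(5)]
    and o3 = shift_order[OF R(2) R(4) R(5)] and o4 = shift_order[OF R(3) R(4) R(5)]
    and o5 = shift_order[OF R(1) R(2) R(3)] and o6 = shift_order[OF R(1) R(2) R(4)]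
  have k: "lev (j 1) (j 4) < lev (j 2) (j 4)" "lev (j 1) (j 4) < lev (j 3) (j 4)" "lev (j 2) (j 4) < lev (j 3) (j 4)"
    "blev (j 1) (j 4) = blev (j 2) (j 4)" "blev (j 1) (j 4) = blev (j 3) (j 4)"
    using o2 o3 o4 s by auto
  have f: "lev (j 0) (j 1) = lev (j 0) (j 2)" "lev (j 0) (j 1) = lev (j 0) (j 3)"
    "blev (j 0) (j 2) < blev (j 0) (j 1)" "blev (j 0) (j 3) < blev (j 0) (j 1)"
    using o5 o6 s by auto
  have A: "dep (j 4) (lev (j a) (j 4)) = dep (j a) (lev (j a) (j 4))" for a
    using dep_lev[of "j a" "j 4"] by simp
  have B: "bdep (\<kappa> (j a)) (blev (j a) (j 4)) = bdep (\<kappa> (j 4)) (blev (j a) (j 4))" for a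
    by (rule bdep_blev)
  \<comment> \<open>Both sides are half of \<open>\<sigma> (j 2) - \<sigma> (j 1)\<close>: on the
    left from the pairs with \<open>j 4\<close>, which share their branching node in the second
    tree, on the right from the pairs with \<open>j 0\<close>, which share it in the first
    tree.\<close>
  have e1: "dep (j 4) (lev (j 2) (j 4)) - dep (j 4) (lev (j 1) (j 4)) =
      bdep (\<kappa> (j 0)) (blev (j 0) (j 1)) - bdep (\<kappa> (j 0)) (blev (j 0) (j 2))"
    using shift_pair[OF R(2,5) ne(4)] shift_pair[OF R(3,5) ne(5)] shift_pair[OF R(1,2) ne(1)]
      shift_pair[OF R(1,3) ne(2)] A B[of 1] B[of 2] k(4) f(1) by simp
  have e2: "dep (j 4) (lev (j 3) (j 4)) - dep (j 4) (lev (j 1) (j 4)) =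
      bdep (\<kappa> (j 0)) (blev (j 0) (j 1)) - bdep (\<kappa> (j 0)) (blev (j 0) (j 3))"
    using shift_pair[OF R(2,5) ne(4)] shift_pair[OF R(4,5) ne(6)] shift_pair[OF R(1,2) ne(1)]
      shift_pair[OF R(1,4) ne(3)] A B[of 1] B[of 3] k(5) f(2) by simp
  have n: "lev (j 2) (j 4) \<le> n" "lev (j 3) (j 4) \<le> n" "blev (j 0) (j 1) \<le> 2 * n"
    using lev_less[OF R(3,5) ne(5)] lev_less[OF R(4,5) ne(6)] blev_less[OF R(1,2) ne(1)] by auto
  \<comment> \<open>In \<open>e1\<close> and \<open>e2\<close> the lower end on the right is the
    same node, yet the levels on the left differ.\<close>
  have "lev (j 2) (j 4) = Suc (blev (j 0) (j 1)) div 2"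
    by (rule equal_difference_level(1)[OF e1 k(1) n(1) f(3) n(3)])
  moreover have "lev (j 3) (j 4) = Suc (blev (j 0) (j 1)) div 2"
    by (rule equal_difference_level(1)[OF e2 k(2) n(2) f(4) n(3)])
  ultimately show False using k(3) by simp
qed

text \<open>More than \<open>2 ^ 2\<close> members provide one gadget \<open>y\<close> that parts
  from others at three levels. The two successive differences of its equations align the second and
  third level with those of \<open>\<kappa> y\<close>. The difference between these levels then
  forces the bits to agree, and the second equation leaves \<open>s = 0\<close> or
  \<open>s = \<mu>\<close>.\<close>

lemma shift_dvd:
  assumes Y: "Y \<subseteq> R" "\<And>j. j \<in> Y \<Longrightarrow> \<sigma> j = s" and c: "4 < card Y"
  shows "2 ^ (n + 2) dvd s"
proof -
  have finY: "finite Y" using Y(1) fin finite_subset by blast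
  obtain y where y: "y \<in> Y" "Suc 2 \<le> card ((\<lambda>z. length (lcp y z)) ` (Y - {y}))"
    using many_lcp_lengths[of Y "2 * n" 2] finY Y(1) len c by auto
  have "3 \<le> card ((\<lambda>z. length (lcp y z)) ` (Y - {y}))" using y(2) by simp
  then obtain a b c where abc: "a \<in> (\<lambda>z. length (lcp y z)) ` (Y - {y})"
    "b \<in> (\<lambda>z. length (lcp y z)) ` (Y - {y})" "c \<in> (\<lambda>z. length (lcp y z)) ` (Y - {y})" "a < b" "b < c"
    by (rule three_in_set) (use finY in auto)
  then obtain z0 z1 z2 where z: "z0 \<in> Y - {y}" "z1 \<in> Y - {y}" "z2 \<in> Y - {y}"
    "length (lcp y z0) < length (lcp y z1)" "length (lcp y z1) < length (lcp y z2)" by auto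
  have R: "y \<in> R" "z0 \<in> R" "z1 \<in> R" "z2 \<in> R" "y \<noteq> z0" "y \<noteq> z1" "y \<noteq> z2" using y(1) z Y(1) by auto
  have "even (length (lcp y z0))" "even (length (lcp y z1))" "even (length (lcp y z2))"
    using even_lcp R by auto
  then have lev: "lev y z0 < lev y z1" "lev y z1 < lev y z2"
    using z(4,5) unfolding lev_def by (auto elim!: evenE)
  have eq: "s = dep y (lev y z) - bdep (\<kappa> y) (blev y z)" if "z \<in> Y" "z \<noteq> y" for z
  proof -
    have "y \<in> R" "z \<in> R" "\<sigma> y = s" "\<sigma> z = s" using Y y(1) that by auto
    then show ?thesis using shift_pair[of y z] that(2) by simp
  qed
  have e: "s = dep y (lev y z0) - bdep (\<kappa> y) (blev y z0)" "s = dep y (lev y z1) - bdep (\<kappa> y) (blev y z1)"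
    "s = dep y (lev y z2) - bdep (\<kappa> y) (blev y z2)" using eq z by auto
  have b1: "blev y z0 < blev y z1" and b2: "blev y z1 < blev y z2"
    using e dep_mono_iff[of y "lev y z0" "lev y z1"] dep_mono_iff[of y "lev y z1" "lev y z2"] lev
    by (simp_all flip: bdep_mono_iff[of "\<kappa> y"])
  have le: "lev y z1 \<le> n" "lev y z2 \<le> n" "blev y z1 \<le> 2 * n" "blev y z2 \<le> 2 * n"
    using lev_less blev_less R by (metis less_imp_le)+
  have k1: "lev y z1 = Suc (blev y z1) div 2"
    by (rule equal_difference_level(1)[of y _ "lev y z0" "\<kappa> y", OF _ lev(1) le(1) b1 le(3)]) (use e in simp)
  have k2: "lev y z2 = Suc (blev y z2) div 2"
    by (rule equal_difference_level(1)[of y _ "lev y z1" "\<kappa> y", OF _ lev(2) le(2) b2 le(4)]) (use e in simp)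
  obtain t where t: "bdep (\<kappa> y) (blev y z2) - bdep (\<kappa> y) (blev y z1) =
      dep (\<kappa> y) (lev y z2) - dep (\<kappa> y) (lev y z1) + t * int \<mu>"
    using bdep_diff[of "\<kappa> y" "blev y z2" "blev y z1"] unfolding k1[symmetric] k2[symmetric] by blast
  have "dep y (lev y z2) - dep y (lev y z1) - (dep (\<kappa> y) (lev y z2) - dep (\<kappa> y) (lev y z1)) = t * int \<mu>"
    using t e by simp
  then have "2 ^ (n + 2) dvd dep y (lev y z2) - dep y (lev y z1) - (dep (\<kappa> y) (lev y z2) - dep (\<kappa> y) (lev y z1))"
    using \<mu>_mult_dvd[of "n + 2" t] by simp
  from congruent_depths_agree[OF this lev(2) le(2)]
  have "dep y (lev y z1) = dep (\<kappa> y) (lev y z1)" using lev(2) by (intro dep_cong) auto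
  then have "s = (if odd (blev y z1) then 1 else 0) * int \<mu>"
    using e(2) unfolding bdep_def k1[symmetric] by simp
  then show ?thesis by (simp only: \<mu>_mult_dvd order.refl)
qed

text \<open>With \<open>s\<close> divisible by \<open>2 ^ (n + 2)\<close> the two branching nodes
  have congruent depths, up to a multiple of \<mu>; hence they have the same level and the same bits
  before it.\<close>

lemma aligned_prefix:
  assumes "j \<in> R" "j' \<in> R" "j \<noteq> j'" "\<sigma> j = s" "\<sigma> j' = s" "2 ^ (n + 2) dvd s"
  shows "\<And>l. l < lev j j' \<Longrightarrow> j ! (2 * l) = \<kappa> j ! (2 * l)" "s = 0 \<or> s = int \<mu>"
proof -
  have s: "s = dep j (lev j j') - bdep (\<kappa> j) (blev j j')" using shift_pair[of j j'] assms by simp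
  define t where "t = (if odd (blev j j') then 1 else 0 :: int)"
  have st: "dep j (lev j j') - dep (\<kappa> j) (Suc (blev j j') div 2) = s - t * int \<mu>"
    using s by (simp add: bdep_def t_def)
  have dvd: "2 ^ (n + 2) dvd dep j (lev j j') - dep (\<kappa> j) (Suc (blev j j') div 2)"
    unfolding st using assms(6) \<mu>_mult_dvd[of "n + 2" t] by (intro dvd_diff) auto
  have le: "lev j j' \<le> n" "Suc (blev j j') div 2 \<le> n"
    using lev_less[OF assms(1-3)] blev_less[OF assms(1-3)] by auto
  have *: "lev j j' = Suc (blev j j') div 2" "\<forall>l<lev j j'. j ! (2 * l) = \<kappa> j ! (2 * l)"
    using congruent_depths_level[OF dvd le] by auto
  then show "\<And>l. l < lev j j' \<Longrightarrow> j ! (2 * l) = \<kappa> j ! (2 * l)" by simp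
  have "dep j (lev j j') = dep (\<kappa> j) (lev j j')" by (rule dep_cong) (use * in auto)
  then show "s = 0 \<or> s = int \<mu>" using st *(1) by (auto simp: t_def)
qed

text \<open>The shift \<open>\<sigma> j\<close> compares depths in the whole trees. Removing the
  depths of the two gadget roots leaves the displacement of the gadgets against each other.\<close>

definition \<delta> :: "bool list \<Rightarrow> int" where "\<delta> j = \<sigma> j - dep j n + dep (\<kappa> j) n"

definition exact :: "bool list \<Rightarrow> bool" where
  "exact j \<longleftrightarrow> \<delta> j = 0 \<and> (\<forall>l<n. j ! (2 * l) = \<kappa> j ! (2 * l))"

text \<open>For exact matches the shifts vanish, so the branching nodes have equal depth. The one in
  the first tree is an expectation node; a max node lies just \<mu> above the next level, while
  levels are more than \<open>2 * \<mu>\<close> apart, so the other is an expectation node too. The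
  partners thus never disagree first at a max coordinate.\<close>

lemma exact_lcp_even:
  assumes "j \<in> R" "j' \<in> R" "j \<noteq> j'" "exact j" "exact j'"
  shows "even (length (lcp (\<kappa> j) (\<kappa> j')))"
proof -
  have "dep j n = dep (\<kappa> j) n" "dep j' n = dep (\<kappa> j') n"
    using assms(4,5) by (auto simp: exact_def intro!: dep_cong)
  then have s: "\<sigma> j = 0" "\<sigma> j' = 0" using assms(4,5) by (auto simp: exact_def \<delta>_def)
  have z: "dep j (lev j j') = bdep (\<kappa> j) (blev j j')" using shift_pair[OF assms(1-3)] s by simp
  have k: "Suc (blev j j') div 2 \<le> n" using blev_less[OF assms(1-3)] by auto
  have d: "dep (\<kappa> j) (Suc (blev j j') div 2) = dep j (Suc (blev j j') div 2)"
    by (rule dep_cong) (use assms(4) k in \<open>auto simp: exact_def\<close>)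
  have "even (blev j j')"
  proof (rule ccontr)
    assume o: "odd (blev j j')"
    then have "dep j (Suc (blev j j') div 2) = dep j (lev j j') + int \<mu>"
      using z d by (simp add: bdep_def)
    then show False
      using dep_less[of "lev j j'" "Suc (blev j j') div 2" j]
        dep_less[of "Suc (blev j j') div 2" "lev j j'" j] \<mu>_pos
      by (cases "lev j j'" "Suc (blev j j') div 2" rule: linorder_cases) auto
  qed
  then show ?thesis by (simp add: blev_def)
qed

text \<open>Four members weigh at most 4. In a larger class \<open>s\<close> is 0 or \<mu>. Inexact
  members with the bits of their partner are displaced by \<open>\<mu> \<ge> n\<close>, and there
  are at most \<open>2 ^ n\<close> of them. If the bits first differ at \<open>e\<close>, the
  displacement is at least \<open>2 ^ (e + 1)\<close>, and there are at most
  \<open>2 ^ (e + 1)\<close> such members.\<close>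

lemma shift_class_weight:
  assumes Y: "Y \<subseteq> R" "\<And>j. j \<in> Y \<Longrightarrow> \<sigma> j = s" and n\<mu>: "n \<le> \<mu>"
  shows "(\<Sum>j\<in>{j \<in> Y. \<not> exact j}. (1 / 2 :: real) ^ nat \<bar>\<delta> j\<bar>) \<le> 4"
proof (cases "card Y \<le> 4")
  case True
  have "(\<Sum>j\<in>{j \<in> Y. \<not> exact j}. (1 / 2 :: real) ^ nat \<bar>\<delta> j\<bar>) \<le> real (card {j \<in> Y. \<not> exact j})"
    using sum_bounded_above[of "{j \<in> Y. \<not> exact j}" "\<lambda>j. (1 / 2 :: real) ^ nat \<bar>\<delta> j\<bar>" 1]
    by (simp add: power_le_one)
  also have "\<dots> \<le> real (card Y)"
    using Y(1) fin by (intro of_nat_mono card_mono) (auto intro: finite_subset)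
  finally show ?thesis using True by linarith
next
  case False
  then have dvd: "2 ^ (n + 2) dvd s" using shift_dvd[OF Y] by simp
  have finY: "finite Y" using Y(1) fin finite_subset by blast
  have two: "\<exists>j'\<in>Y. j' \<noteq> j" for j
  proof (rule ccontr)
    assume "\<not> ?thesis"
    then have "Y \<subseteq> {j}" by auto
    then have "card Y \<le> 1" using card_mono[of "{j}" Y] by simp
    then show False using False by simp
  qed
  define agree where "agree j \<longleftrightarrow> (\<forall>l<n. j ! (2 * l) = \<kappa> j ! (2 * l))" for j
  define Z where "Z = {j \<in> Y. \<not> exact j \<and> agree j}"
  define W where "W = {j \<in> Y. \<not> agree j}"
  have split: "{j \<in> Y. \<not> exact j} = Z \<union> W" "Z \<inter> W = {}"
    by (auto simp: Z_def W_def exact_def agree_def)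
  have Zw: "(1 / 2 :: real) ^ nat \<bar>\<delta> j\<bar> \<le> (1 / 2) ^ n" if "j \<in> Z" for j
  proof -
    have j: "j \<in> Y" "\<not> exact j" "agree j" using that by (auto simp: Z_def)
    then have "dep j n = dep (\<kappa> j) n" by (auto simp: agree_def intro!: dep_cong)
    then have "\<delta> j = s" using Y(2)[OF j(1)] by (simp add: \<delta>_def)
    moreover obtain j' where "j' \<in> Y" "j' \<noteq> j" using two by blast
    then have "s = 0 \<or> s = int \<mu>" using aligned_prefix(2)[of j j' s] Y j(1) dvd by auto
    ultimately have "\<delta> j = int \<mu>" using j by (auto simp: exact_def agree_def)
    then show ?thesis using n\<mu> by (simp add: power_decreasing)
  qed
  \<comment> \<open>Indices in \<open>R\<close> part at expectation coordinates, so their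
    \<open>n\<close> expectation bits tell them apart.\<close>
  have "card Z \<le> 2 ^ n"
  proof -
    have inj: "inj_on (\<lambda>j. map (\<lambda>l. j ! (2 * l)) [0..<n]) Y"
    proof (rule inj_onI, rule ccontr)
      fix j j' assume j: "j \<in> Y" "j' \<in> Y" "j \<noteq> j'"
        and eq: "map (\<lambda>l. j ! (2 * l)) [0..<n] = map (\<lambda>l. j' ! (2 * l)) [0..<n]"
      have R: "j \<in> R" "j' \<in> R" using j Y(1) by auto
      then have "even (length (lcp j j'))" "length (lcp j j') < 2 * n" "j ! length (lcp j j') \<noteq> j' ! length (lcp j j')"
        using even_lcp j(3) lcp_length_less[of j j'] lcp_nth_differ[of j j'] len by auto
      then have "lev j j' < n" "j ! (2 * lev j j') \<noteq> j' ! (2 * lev j j')" by (auto simp: lev_def)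
      then show False using eq by simp
    qed
    have "card Z \<le> card Y" using finY by (intro card_mono) (auto simp: Z_def)
    also have "\<dots> = card ((\<lambda>j. map (\<lambda>l. j ! (2 * l)) [0..<n]) ` Y)" using inj by (simp add: card_image)
    also have "\<dots> \<le> card {q :: bool list. length q = n}"
      by (intro card_mono finite_bool_lists) auto
    finally show ?thesis by (simp add: card_bool_lists)
  qed
  then have "real (card Z) \<le> real (2 ^ n)" by (simp only: of_nat_le_iff)
  then have "real (card Z) \<le> 2 ^ n" by simp
  have "(\<Sum>j\<in>Z. (1 / 2 :: real) ^ nat \<bar>\<delta> j\<bar>) \<le> real (card Z) * (1 / 2) ^ n"
    using sum_bounded_above[of Z _ "(1 / 2) ^ n :: real"] Zw by simp
  also have "\<dots> \<le> 2 ^ n * (1 / 2) ^ n" using \<open>real (card Z) \<le> 2 ^ n\<close> by (intro mult_right_mono) auto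
  finally have sumZ: "(\<Sum>j\<in>Z. (1 / 2 :: real) ^ nat \<bar>\<delta> j\<bar>) \<le> 1" by (simp flip: power_mult_distrib)
  define e where "e j = (LEAST l. j ! (2 * l) \<noteq> \<kappa> j ! (2 * l))" for j
  have e: "e j < n" "j ! (2 * e j) \<noteq> \<kappa> j ! (2 * e j)" "\<And>l. l < e j \<Longrightarrow> j ! (2 * l) = \<kappa> j ! (2 * l)"
    if "j \<in> W" for j
  proof -
    obtain l where l: "l < n" "j ! (2 * l) \<noteq> \<kappa> j ! (2 * l)" using \<open>j \<in> W\<close> by (auto simp: W_def agree_def)
    show "j ! (2 * e j) \<noteq> \<kappa> j ! (2 * e j)" unfolding e_def by (rule LeastI) (rule l(2))
    show "\<And>l. l < e j \<Longrightarrow> j ! (2 * l) = \<kappa> j ! (2 * l)" unfolding e_def using not_less_Least by blast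
    have "e j \<le> l" unfolding e_def by (rule Least_le) (rule l(2))
    then show "e j < n" using l(1) by simp
  qed
  have Ww: "(1 / 2 :: real) ^ nat \<bar>\<delta> j\<bar> \<le> (1 / 4) ^ Suc (e j)" if j: "j \<in> W" for j
  proof -
    have "exact_power (n - n + 1 + e j) (dep j n - dep j 0 - (dep (\<kappa> j) n - dep (\<kappa> j) 0))"
      by (rule dep_difference_exact[OF e(3)[OF j] e(2)[OF j] e(1)[OF j]]) (use e(1)[OF j] in auto)
    then have "exact_power (Suc (e j)) (- (dep j n - dep (\<kappa> j) n))" unfolding exact_power_minus by simp
    moreover have "2 ^ Suc (Suc (e j)) dvd s"
      by (rule dvd_trans[OF le_imp_power_dvd dvd]) (use e(1)[OF j] in simp)
    ultimately have "exact_power (Suc (e j)) (- (dep j n - dep (\<kappa> j) n) + s)" by (rule exact_power_add)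
    moreover have "- (dep j n - dep (\<kappa> j) n) + s = \<delta> j"
      using Y(2)[of j] j by (simp add: \<delta>_def W_def)
    ultimately have "2 ^ Suc (e j) \<le> \<bar>\<delta> j\<bar>" using exact_power_le by metis
    \<comment> \<open>Half of the exponent \<open>2 * Suc (e j)\<close> pays for the number of
      members with this \<open>e j\<close>, the other half makes the sum converge.\<close>
    moreover have "2 * Suc (e j) \<le> 2 ^ Suc (e j)"
      by (rule double_Suc_le_power)
    then have "int (2 * Suc (e j)) \<le> int (2 ^ Suc (e j))" by (simp only: of_nat_le_iff)
    then have "int (2 * Suc (e j)) \<le> 2 ^ Suc (e j)" by simp
    ultimately have "2 * Suc (e j) \<le> nat \<bar>\<delta> j\<bar>" by linarith
    then have "(1 / 2 :: real) ^ nat \<bar>\<delta> j\<bar> \<le> (1 / 2) ^ (2 * Suc (e j))" by (intro power_decreasing) auto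
    also have "\<dots> = (1 / 4) ^ Suc (e j)" by (simp add: power_mult power2_eq_square)
    finally show ?thesis .
  qed
  \<comment> \<open>If two members had the same first \<open>k\<close> expectation bits, they would
    part beyond level \<open>e j\<close>, and \<open>aligned_prefix\<close> would make
    \<open>j\<close> agree with its partner at \<open>e j\<close>.\<close>
  have cardW: "card {j \<in> W. Suc (e j) = k} \<le> 2 ^ k" for k
  proof -
    let ?W = "{j \<in> W. Suc (e j) = k}"
    have inj: "inj_on (\<lambda>j. map (\<lambda>l. j ! (2 * l)) [0..<k]) ?W"
    proof (rule inj_onI, rule ccontr)
      fix j j' assume j: "j \<in> ?W" "j' \<in> ?W" "j \<noteq> j'"
        and eq: "map (\<lambda>l. j ! (2 * l)) [0..<k] = map (\<lambda>l. j' ! (2 * l)) [0..<k]"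
      have W: "j \<in> W" "j' \<in> W" "e j < k" using j by auto
      have R: "j \<in> Y" "j' \<in> Y" "j \<in> R" "j' \<in> R" using W Y(1) by (auto simp: W_def)
      have ev: "even (length (lcp j j'))" "j ! length (lcp j j') \<noteq> j' ! length (lcp j j')"
        using even_lcp R j(3) lcp_nth_differ[of j j'] len by auto
      then have "length (lcp j j') = 2 * lev j j'" by (simp add: lev_def)
      then have "\<not> lev j j' < k" using ev(2) eq by auto
      then have "e j < lev j j'" using W(3) by simp
      then have "j ! (2 * e j) = \<kappa> j ! (2 * e j)"
        using aligned_prefix(1)[of j j' s "e j"] R Y(2) j(3) dvd by simp
      then show False using e(2)[OF W(1)] by simp
    qed
    have "card ?W = card ((\<lambda>j. map (\<lambda>l. j ! (2 * l)) [0..<k]) ` ?W)" using inj by (simp add: card_image)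
    also have "\<dots> \<le> card {q :: bool list. length q = k}"
      by (intro card_mono finite_bool_lists) auto
    finally show ?thesis by (simp add: card_bool_lists)
  qed
  have finW: "finite W" using finY by (simp add: W_def)
  have "(\<Sum>j\<in>W. (1 / 2 :: real) ^ nat \<bar>\<delta> j\<bar>) \<le> (\<Sum>j\<in>W. (1 / 4) ^ Suc (e j))"
    by (rule sum_mono) (rule Ww)
  also have "\<dots> = (\<Sum>k=1..n. \<Sum>j\<in>{j \<in> W. Suc (e j) = k}. (1 / 4) ^ Suc (e j))"
    by (rule sum.group[symmetric]) (use finW e(1) in \<open>auto simp: Suc_le_eq\<close>)
  also have "\<dots> = (\<Sum>k=1..n. real (card {j \<in> W. Suc (e j) = k}) * (1 / 4) ^ k)"
    by (rule sum.cong) auto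
  also have "\<dots> \<le> (\<Sum>k=1..n. 2 ^ k * (1 / 4) ^ k)"
    using of_nat_mono[OF cardW, where 'a = real] by (intro sum_mono mult_right_mono) auto
  also have "\<dots> = (\<Sum>k=1..n. (1 / 2) ^ k)" by (simp flip: power_mult_distrib)
  also have "\<dots> \<le> 1" by (rule sum_half_powers)
  finally have sumW: "(\<Sum>j\<in>W. (1 / 2 :: real) ^ nat \<bar>\<delta> j\<bar>) \<le> 1" .
  have "(\<Sum>j\<in>{j \<in> Y. \<not> exact j}. (1 / 2 :: real) ^ nat \<bar>\<delta> j\<bar>) =
      (\<Sum>j\<in>Z. (1 / 2) ^ nat \<bar>\<delta> j\<bar>) + (\<Sum>j\<in>W. (1 / 2) ^ nat \<bar>\<delta> j\<bar>)"
    unfolding split(1) by (rule sum.union_disjoint) (use finY finW split in \<open>auto simp: Z_def\<close>)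
  then show ?thesis using sumZ sumW by simp
qed

text \<open>At most four shifts occur, and each class weighs at most 4.\<close>

lemma inexact_weight:
  assumes "n \<le> \<mu>"
  shows "(\<Sum>j\<in>{j \<in> R. \<not> exact j}. (1 / 2 :: real) ^ nat \<bar>\<delta> j\<bar>) \<le> 16"
proof -
  let ?w = "\<lambda>j. (1 / 2 :: real) ^ nat \<bar>\<delta> j\<bar>"
  have "(\<Sum>j\<in>{j \<in> R. \<not> exact j}. ?w j) = (\<Sum>s\<in>\<sigma> ` R. \<Sum>j\<in>{j \<in> {j \<in> R. \<not> exact j}. \<sigma> j = s}. ?w j)"
    by (rule sum.group[symmetric]) (use fin in auto)
  also have "\<dots> = (\<Sum>s\<in>\<sigma> ` R. \<Sum>j\<in>{j \<in> {j \<in> R. \<sigma> j = s}. \<not> exact j}. ?w j)"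
    by (intro sum.cong) auto
  also have "\<dots> \<le> (\<Sum>s\<in>\<sigma> ` R. 4)"
    by (intro sum_mono shift_class_weight assms) auto
  also have "\<dots> \<le> 16" using card_shifts_le by simp
  finally show ?thesis .
qed

end


section \<open>Lengths of slots and of their common prefixes\<close>

fun slot_depth :: "nat \<Rightarrow> nat \<Rightarrow> nat \<Rightarrow> bool list \<Rightarrow> nat \<Rightarrow> nat" where
  "slot_depth \<mu> P c (b # i) (Suc f) =
     (if odd (length i) then \<mu> + next_offset P c b + slot_depth \<mu> P (next_offset P c b) i f
      else \<mu> + slot_depth \<mu> P c i f)"
| "slot_depth \<mu> P c i f = 0"

fun offset :: "nat \<Rightarrow> nat \<Rightarrow> bool list \<Rightarrow> nat \<Rightarrow> nat" where
  "offset P c i 0 = c"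
| "offset P c i (Suc k) = next_offset P (offset P c i k) (i ! (2 * k))"

lemma lcp_append: "lcp (s @ u) (s @ v) = s @ lcp u v"
  by (induction s) auto

lemma lcp_append_diverging:
  assumes "length (lcp s s') < length s" "length (lcp s s') < length s'"
  shows "lcp (s @ u) (s' @ v) = lcp s s'"
  using assms by (induction s s' rule: longest_common_prefix.induct) auto

lemma lcp_of_prefixes:
  assumes "prefix v s" "prefix w s'" "length v = length w" "v \<noteq> w"
  shows "lcp v w = lcp s s'"
proof -
  obtain u u' where u: "s = v @ u" "s' = w @ u'" using assms(1,2) by (auto simp: prefix_def)
  have "length (lcp v w) < length v" using lcp_length_less assms(3,4) by blast
  then show ?thesis unfolding u using lcp_append_diverging[of v w u u'] assms(3) by simp
qed

lemma length_slot: "0 < \<mu> \<Longrightarrow> length (slot \<mu> P c i) = slot_depth \<mu> P c i (length i)"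
  by (induction i arbitrary: c) (auto simp: Let_def)

text \<open>Stems offer no choice, so two slots part exactly at the branching node of the first
  coordinate that differs.\<close>

lemma length_lcp_slot:
  assumes "0 < \<mu>" "length i = length i'" "i \<noteq> i'"
  shows "length (lcp (slot \<mu> P c i) (slot \<mu> P c i')) = slot_depth \<mu> P c i (length (lcp i i'))"
  using assms(2,3)
proof (induction i i' arbitrary: c rule: list_induct2)
  case (Cons b i b' i')
  show ?case
  proof (cases "b = b'")
    case True
    then have "i \<noteq> i'" using Cons.prems by simp
    then show ?thesis using True Cons assms(1) by (auto simp: Let_def lcp_append)
  qed simp
qed simp

lemma offset_Cons: "offset P c (b # b' # i) (Suc k) = offset P (next_offset P c b) i k"
  by (induction k) auto

lemma slot_depth_even:
  "length i = 2 * m \<Longrightarrow> k \<le> m \<Longrightarrow> slot_depth \<mu> P c i (2 * k) = (\<Sum>l<k. 2 * \<mu> + offset P c i (Suc l))"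
proof (induction k arbitrary: c i m)
  case 0
  then show ?case by (cases i) auto
next
  case (Suc k)
  obtain b b' j where i: "i = b # b' # j" using Suc.prems by (cases i; cases "tl i") auto
  have j: "length j = 2 * (m - 1)" "k \<le> m - 1" using Suc.prems i by auto
  have "slot_depth \<mu> P c i (2 * Suc k) = 2 * \<mu> + next_offset P c b + slot_depth \<mu> P (next_offset P c b) j (2 * k)"
    using j(1) by (simp add: i)
  also have "\<dots> = 2 * \<mu> + next_offset P c b + (\<Sum>l<k. 2 * \<mu> + offset P (next_offset P c b) j (Suc l))"
    using Suc.IH[OF j] by simp
  also have "\<dots> = (\<Sum>l<Suc k. 2 * \<mu> + offset P c i (Suc l))"
    unfolding i by (subst sum.lessThan_Suc_shift) (simp only: offset_Cons offset.simps(1))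
  finally show ?case .
qed

lemma slot_depth_odd:
  "length i = 2 * m \<Longrightarrow> k < m \<Longrightarrow>
   slot_depth \<mu> P c i (Suc (2 * k)) = (\<Sum>l<k. 2 * \<mu> + offset P c i (Suc l)) + \<mu> + offset P c i (Suc k)"
proof (induction k arbitrary: c i m)
  case 0
  then obtain b b' j where i: "i = b # b' # j" by (cases i; cases "tl i") auto
  have "length j = 2 * (m - 1)" using 0 i by simp
  then show ?case by (simp add: i)
next
  case (Suc k)
  obtain b b' j where i: "i = b # b' # j" using Suc.prems by (cases i; cases "tl i") auto
  have j: "length j = 2 * (m - 1)" "k < m - 1" using Suc.prems i by auto
  have "slot_depth \<mu> P c i (Suc (2 * Suc k)) = 2 * \<mu> + next_offset P c b + slot_depth \<mu> P (next_offset P c b) j (Suc (2 * k))"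
    using j(1) by (simp add: i)
  also have "\<dots> = 2 * \<mu> + next_offset P c b + (\<Sum>l<k. 2 * \<mu> + offset P (next_offset P c b) j (Suc l))
      + \<mu> + offset P (next_offset P c b) j (Suc k)"
    using Suc.IH[OF j] by simp
  also have "\<dots> = (\<Sum>l<Suc k. 2 * \<mu> + offset P c i (Suc l)) + \<mu> + offset P c i (Suc (Suc k))"
    unfolding i by (subst sum.lessThan_Suc_shift) (simp only: offset_Cons offset.simps(1))
  finally show ?case .
qed

section \<open>Strategies for the max coordinates, and parts of gadgets\<close>

lemma admissible_nth: "admissible False i \<Longrightarrow> f < length i \<Longrightarrow> even (length i - Suc f) \<Longrightarrow> i ! f"
proof (induction i arbitrary: f)
  case (Cons b i)
  then show ?case by (cases f) auto
qed simp

text \<open>The last hypothesis says that members of \<open>K\<close> never differ first at a max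
  coordinate: they are possible outcomes of one strategy. At a max coordinate one half of
  \<open>K\<close> is empty, and at an expectation coordinate the halves add up, which is twice the
  average.\<close>

lemma strategy_value:
  fixes f :: "bool list \<Rightarrow> real"
  assumes "finite K" "\<And>i. i \<in> K \<Longrightarrow> length i = d" "\<And>i. 0 \<le> f i"
    "\<And>i i'. i \<in> K \<Longrightarrow> i' \<in> K \<Longrightarrow> i \<noteq> i' \<Longrightarrow> even (d - length (lcp i i'))"
  shows "sum f K \<le> 2 ^ (d div 2) * alternate (even d) d f"
  using assms
proof (induction d arbitrary: K f)
  case 0
  then have "K \<subseteq> {[]}" by auto
  then have "K = {} \<or> K = {[]}" by auto
  then show ?case using 0(3)[of "[]"] by auto
next
  case (Suc d)
  define X where "X b = {i. b # i \<in> K}" for b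
  define g where "g b = alternate (even d) d (\<lambda>i. f (b # i))" for b
  have img: "(#) b ` X b \<subseteq> K" for b by (auto simp: X_def)
  have fin: "finite (X b)" for b
    using finite_imageD[OF finite_subset[OF img[of b] Suc.prems(1)]] by auto
  have K: "K = (#) False ` X False \<union> (#) True ` X True"
  proof
    show "K \<subseteq> (#) False ` X False \<union> (#) True ` X True"
    proof
      fix y assume y: "y \<in> K"
      then obtain b z where "y = b # z" using Suc.prems(2) by (metis length_Suc_conv)
      then show "y \<in> (#) False ` X False \<union> (#) True ` X True" using y by (cases b) (auto simp: X_def)
    qed
  qed (use img in auto)
  have sK: "sum f K = (\<Sum>i\<in>X False. f (False # i)) + (\<Sum>i\<in>X True. f (True # i))"
    unfolding K by (subst sum.union_disjoint) (auto simp: fin sum.reindex)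
  have IH: "(\<Sum>i\<in>X b. f (b # i)) \<le> 2 ^ (d div 2) * g b" for b
    unfolding g_def
  proof (rule Suc.IH)
    show "finite (X b)" by (rule fin)
    show "length i = d" if "i \<in> X b" for i using Suc.prems(2)[of "b # i"] that by (simp add: X_def)
    show "even (d - length (lcp i i'))" if "i \<in> X b" "i' \<in> X b" "i \<noteq> i'" for i i'
      using Suc.prems(4)[of "b # i" "b # i'"] that by (simp add: X_def)
  qed (use Suc.prems(3) in auto)
  show ?case
  proof (cases "even d")
    case False
    then have d2: "Suc d div 2 = Suc (d div 2)" by presburger
    have al: "alternate (even (Suc d)) (Suc d) f = (g False + g True) / 2"
      using False by (simp add: g_def Let_def)
    show ?thesis unfolding sK d2 al using IH[of False] IH[of True] by (simp add: algebra_simps)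
  next
    case True
    then have d2: "Suc d div 2 = d div 2" by presburger
    have al: "alternate (even (Suc d)) (Suc d) f = max (g False) (g True)"
      using True by (simp add: g_def Let_def)
    have "X False = {} \<or> X True = {}"
    proof (rule ccontr)
      assume "\<not> ?thesis"
      then obtain i i' where "False # i \<in> K" "True # i' \<in> K" by (auto simp: X_def)
      then show False using Suc.prems(4)[of "False # i" "True # i'"] True by simp
    qed
    then obtain b where "sum f K \<le> 2 ^ (d div 2) * g b"
    proof
      assume "X False = {}"
      then show thesis using that[of True] IH[of True] unfolding sK by simp
    next
      assume "X True = {}"
      then show thesis using that[of False] IH[of False] unfolding sK by simp
    qed
    also have "\<dots> \<le> 2 ^ (d div 2) * max (g False) (g True)"
      by (intro mult_left_mono) (cases b, auto)
    finally show ?thesis unfolding al d2 .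
  qed
qed

lemma lcp_closed_has_least:
  assumes "finite X" "X \<noteq> {}" "\<And>u v. u \<in> X \<Longrightarrow> v \<in> X \<Longrightarrow> lcp u v \<in> X"
  obtains m where "m \<in> X" "\<And>v. v \<in> X \<Longrightarrow> prefix m v"
proof -
  obtain m where m: "m \<in> X" "\<And>v. v \<in> X \<Longrightarrow> length m \<le> length v"
    using ex_has_least_nat[of "\<lambda>v. v \<in> X" _ length] assms(2) by blast
  have "prefix m v" if "v \<in> X" for v
  proof -
    have "length m \<le> length (lcp m v)" using m assms(3) that by blast
    then have "lcp m v = m" by (metis lcp_eq_take take_all)
    then show ?thesis by (metis longest_common_prefix_prefix2)
  qed
  then show thesis using that m(1) by blast
qed

text \<open>Closed under \<open>lcp\<close>, the set lies below its least element, which is at depth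
  \<open>m\<close> or more inside the gadget.\<close>

lemma card_gadget_part:
  assumes X: "X \<subseteq> (@) s ` positions (balanced L)" "\<And>u v. u \<in> X \<Longrightarrow> v \<in> X \<Longrightarrow> lcp u v \<in> X"
    and m: "\<And>v. v \<in> X \<Longrightarrow> length s + m \<le> length v"
  shows "real (card X) \<le> real L * (1 / 2) ^ m"
proof (cases "X = {}")
  case False
  have fin: "finite X" using X(1) by (rule finite_subset) simp
  obtain w where w: "w \<in> X" "\<And>v. v \<in> X \<Longrightarrow> prefix w v"
    using lcp_closed_has_least[OF fin False X(2)] by blast
  obtain u where u: "w = s @ u" "u \<in> positions (balanced L)" using X(1) w(1) by auto
  have "X \<subseteq> (@) s ` {v \<in> positions (balanced L). prefix u v}"
  proof
    fix v assume v: "v \<in> X"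
    then obtain z where z: "v = s @ z" "z \<in> positions (balanced L)" using X(1) by auto
    then show "v \<in> (@) s ` {v \<in> positions (balanced L). prefix u v}" using w(2)[OF v] u(1) by simp
  qed
  then have "card X \<le> card ((@) s ` {v \<in> positions (balanced L). prefix u v})" by (intro card_mono) auto
  also have "\<dots> \<le> card {v \<in> positions (balanced L). prefix u v}" by (rule card_image_le) simp
  finally have "card X * 2 ^ length u \<le> card {v \<in> positions (balanced L). prefix u v} * 2 ^ length u"
    by (rule mult_le_mono1)
  then have L: "card X * 2 ^ length u \<le> L" using card_balanced_below[of L u] by (rule le_trans)
  have "(2::nat) ^ m \<le> 2 ^ length u" using m[OF w(1)] u(1) by (intro power_increasing) auto
  then have "card X * 2 ^ m \<le> card X * 2 ^ length u" by (rule mult_le_mono2)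
  then have "card X * 2 ^ m \<le> L" using L by (rule le_trans)
  then have "real (card X * 2 ^ m) \<le> real L" by (simp only: of_nat_le_iff)
  then show ?thesis by (simp add: field_simps power_divide)
qed simp

context spacing
begin

abbreviation "gslot i \<equiv> slot \<mu> (2 ^ n) (2 ^ n) i"

text \<open>Halving lowers the exponent from \<open>n - k\<close> to \<open>n - Suc k\<close>, and
  the summand \<open>2 ^ n = 2 ^ (n - Suc k) * 2 * 2 ^ k\<close> enters as the new top digit of the
  reversal.\<close>

lemma offset_closed: "k \<le> n \<Longrightarrow> int (offset (2 ^ n) (2 ^ n) i k) = 2 ^ (n - k) * (2 * reversal i k + 1)"
proof (induction k)
  case (Suc k)
  have s: "n - k = Suc (n - Suc k)" using Suc.prems by simp
  have "int (offset (2 ^ n) (2 ^ n) i (Suc k)) = int (offset (2 ^ n) (2 ^ n) i k) div 2 + of_bool (i ! (2 * k)) * 2 ^ n"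
    by (simp add: next_offset_def zdiv_int)
  also have "int (offset (2 ^ n) (2 ^ n) i k) div 2 = 2 ^ (n - Suc k) * (2 * reversal i k + 1)"
    using Suc s by simp
  also have "(2::int) ^ n = 2 ^ (n - Suc k) * 2 * 2 ^ k"
    using Suc.prems s by (metis le_add_diff_inverse2 Suc_leD power_Suc2 power_add)
  finally show ?case by (simp add: reversal_def algebra_simps)
qed (simp add: reversal_def)

lemma slot_depth_bdep:
  assumes "length i = 2 * n" "f \<le> 2 * n"
  shows "int (slot_depth \<mu> (2 ^ n) (2 ^ n) i f) = bdep i f"
proof -
  have d: "int (\<Sum>l<k. 2 * \<mu> + offset (2 ^ n) (2 ^ n) i (Suc l)) = dep i k" if "k \<le> n" for k
    unfolding dep_def of_nat_sum using that by (intro sum.cong) (auto simp: offset_closed simp del: offset.simps)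
  show ?thesis
  proof (cases "even f")
    case True
    then obtain k where k: "f = 2 * k" by auto
    then show ?thesis using slot_depth_even[OF assms(1), of k] d[of k] assms(2) by (simp add: bdep_def)
  next
    case False
    then obtain k where k: "f = Suc (2 * k)" by (metis oddE Suc_eq_plus1)
    have "int (slot_depth \<mu> (2 ^ n) (2 ^ n) i f) = dep i k + int \<mu> + int (offset (2 ^ n) (2 ^ n) i (Suc k))"
      using slot_depth_odd[OF assms(1), of k] d[of k] assms(2) k by simp
    also have "\<dots> = dep i (Suc k) - int \<mu>"
      using assms(2) k by (simp add: dep_Suc offset_closed del: offset.simps)
    finally show ?thesis using k by (simp add: bdep_def)
  qed
qed

lemma length_gslot: "length i = 2 * n \<Longrightarrow> int (length (gslot i)) = dep i n"
  using length_slot[OF \<mu>_pos] slot_depth_bdep[of i "2 * n"] by (simp add: bdep_def)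

lemma length_lcp_gslot:
  "length i = 2 * n \<Longrightarrow> length i' = 2 * n \<Longrightarrow> i \<noteq> i' \<Longrightarrow>
   int (length (lcp (gslot i) (gslot i'))) = bdep i (length (lcp i i'))"
  using length_lcp_slot[OF \<mu>_pos, of i i'] slot_depth_bdep[of i "length (lcp i i')"] length_lcp_le[of i i']
  by simp

lemma gslot_diverge:
  assumes "length i = 2 * n" "length i' = 2 * n" "i \<noteq> i'"
  shows "length (lcp (gslot i) (gslot i')) + \<mu> \<le> length (gslot i)"
    "length (lcp (gslot i) (gslot i')) + \<mu> \<le> length (gslot i')"
proof -
  have *: "length (lcp (gslot j) (gslot j')) + \<mu> \<le> length (gslot j)"
    if "length j = 2 * n" "length j' = 2 * n" "j \<noteq> j'" for j j'
  proof -
    have "bdep j (length (lcp j j')) + int \<mu> \<le> bdep j (2 * n)"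
      using lcp_length_less[of j j'] that by (intro bdep_less) simp
    then show ?thesis using length_lcp_gslot[OF that] length_gslot[OF that(1)] by (simp add: bdep_def)
  qed
  show "length (lcp (gslot i) (gslot i')) + \<mu> \<le> length (gslot i)" using * assms by blast
  show "length (lcp (gslot i) (gslot i')) + \<mu> \<le> length (gslot i')"
    using *[of i' i] assms by (simp add: lcp_comm)
qed

text \<open>The paths to two different slots part at least \<mu> before either of them ends.\<close>

lemma gslot_prefix_unique:
  assumes "length i = 2 * n" "length i' = 2 * n" "prefix (gslot i) (gslot i' @ w)"
  shows "i = i'"
proof (rule ccontr)
  assume ne: "i \<noteq> i'"
  have "lcp (gslot i @ []) (gslot i' @ w) = lcp (gslot i) (gslot i')"
    using gslot_diverge[OF assms(1,2) ne] \<mu>_pos by (intro lcp_append_diverging) auto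
  moreover have "lcp (gslot i) (gslot i' @ w) = gslot i"
    using assms(3) by (metis prefix_lcp_iff prefix_order.antisym prefix_order.refl longest_common_prefix_prefix1)
  ultimately show False using gslot_diverge(1)[OF assms(1,2) ne] \<mu>_pos by simp
qed

lemma gslot_not_strict_prefix:
  assumes "length i = 2 * n" "length i' = 2 * n" "prefix (gslot i) v" "strict_prefix v (gslot i')"
  shows False
proof -
  have "strict_prefix (gslot i) (gslot i')" using assms(3,4) by (rule prefix_order.le_less_trans)
  moreover from this have "i = i'"
    using gslot_prefix_unique[of i i' "[]"] assms(1,2) by (simp add: strict_prefix_def)
  ultimately show False by simp
qed

end

section \<open>The upper bound\<close>

lemma pd_same_prefix_less:
  assumes "height (balanced L) \<le> l" "u \<in> positions (balanced L)" "u' \<in> positions (balanced L)"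
  shows "pd (s @ u) (s @ u') < 2 * l"
proof -
  have "length u < l" "length u' < l" using length_positions assms by (metis less_le_trans)+
  then show ?thesis using length_lcp_le[of u u'] by (simp add: pd_def lcp_append)
qed

context spacing
begin

text \<open>At equal depth neither of two distinct nodes is above the other, so they part at a
  branching node; and two branching nodes on one path are at least \<mu> apart.\<close>

lemma skeleton_lcp_gap:
  assumes "length i1 = 2 * n" "length i2 = 2 * n" "length i3 = 2 * n"
    and v: "strict_prefix v1 (gslot i1)" "strict_prefix v2 (gslot i2)" "strict_prefix v3 (gslot i3)"
    and len: "length v1 = length v2" "length v3 = length v2" and ne: "v1 \<noteq> v2" "v3 \<noteq> v2"
    and lt: "length (lcp v1 v2) < length (lcp v3 v2)"
  shows "length (lcp v1 v2) + \<mu> \<le> length (lcp v3 v2)"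
proof -
  have *: "int (length (lcp v v2)) = bdep i2 (length (lcp i i2))"
    if "length i = 2 * n" "strict_prefix v (gslot i)" "length v = length v2" "v \<noteq> v2" for v i
  proof -
    have p: "prefix v (gslot i)" "prefix v2 (gslot i2)" using that(2) v(2) by auto
    have "i \<noteq> i2" using p that(3,4) by (metis order_refl prefix_length_prefix prefix_order.antisym)
    moreover have "lcp v v2 = lcp (gslot i) (gslot i2)" by (rule lcp_of_prefixes[OF p that(3,4)])
    ultimately show ?thesis using length_lcp_gslot[of i2 i] assms(2) that(1) by (simp add: lcp_comm)
  qed
  have 1: "int (length (lcp v1 v2)) = bdep i2 (length (lcp i1 i2))" using * assms by blast
  have 3: "int (length (lcp v3 v2)) = bdep i2 (length (lcp i3 i2))" using * assms by blast
  have "length (lcp i1 i2) < length (lcp i3 i2)"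
    using lt 1 3 bdep_mono_iff[of i2 "length (lcp i1 i2)" "length (lcp i3 i2)"] by simp
  then show ?thesis using bdep_less[of "length (lcp i1 i2)" "length (lcp i3 i2)" i2] 1 3 by simp
qed

text \<open>A connected piece of diameter below \<mu> cannot contain two branching nodes on one
  path. Hence it has at most two nodes of each depth, since three would part at two such nodes, and
  it covers at most \<open>2 * l\<close> depths below its least node.\<close>

lemma card_skeleton_part:
  assumes fin: "finite X" and closed: "\<And>u v. u \<in> X \<Longrightarrow> v \<in> X \<Longrightarrow> lcp u v \<in> X"
    and diam: "\<And>u v. u \<in> X \<Longrightarrow> v \<in> X \<Longrightarrow> pd u v < 2 * l" and l: "2 * l \<le> \<mu>"
    and skel: "\<And>v. v \<in> X \<Longrightarrow> \<exists>i. length i = 2 * n \<and> strict_prefix v (gslot i)"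
  shows "card X \<le> 4 * l"
proof (cases "X = {}")
  case False
  obtain m where m: "m \<in> X" "\<And>v. v \<in> X \<Longrightarrow> prefix m v"
    using lcp_closed_has_least[OF fin False closed] by blast
  have pre: "pd p q = length q - length p" if "prefix p q" for p q
  proof -
    have "lcp p q = p" using that by (metis prefix_lcp_iff prefix_order.antisym prefix_order.refl longest_common_prefix_prefix1)
    then show ?thesis using that prefix_length_le by (simp add: pd_def)
  qed
  have gap: False
    if "v1 \<in> X" "v2 \<in> X" "v3 \<in> X" "length v1 = length v2" "length v3 = length v2" "v1 \<noteq> v2" "v3 \<noteq> v2"
      "length (lcp v1 v2) < length (lcp v3 v2)" for v1 v2 v3
  proof -
    have g: "length (lcp v1 v2) + \<mu> \<le> length (lcp v3 v2)"
      using skeleton_lcp_gap skel that by metis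
    have "prefix (lcp v1 v2) (lcp v3 v2)"
      using that(8) by (meson longest_common_prefix_prefix2 less_imp_le prefix_length_prefix)
    then have "pd (lcp v1 v2) (lcp v3 v2) \<ge> \<mu>" using pre g by simp
    moreover have "pd (lcp v1 v2) (lcp v3 v2) < 2 * l" using diam closed that by blast
    ultimately show False using l by simp
  qed
  have two: "card {v \<in> X. length v = k} \<le> 2" for k
  proof (rule ccontr)
    assume "\<not> ?thesis"
    then have "3 \<le> card {v \<in> X. length v = k}" by simp
    then obtain T where T: "T \<subseteq> {v \<in> X. length v = k}" "card T = 3" by (meson obtain_subset_with_card_n)
    then obtain a b c where abc: "T = {a, b, c}" "a \<noteq> b" "a \<noteq> c" "b \<noteq> c" by (auto simp: card_3_iff)
    then have X: "a \<in> X" "b \<in> X" "c \<in> X" "length a = length b" "length b = length c" using T(1) by auto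
    have g: "length (lcp b c) \<le> length (lcp a b)" "length (lcp a c) \<le> length (lcp b c)" "length (lcp a b) \<le> length (lcp a c)"
      using gap[of a b c] gap[of b c a] gap[of c a b] X abc(2,3,4) by (metis lcp_comm not_less)+
    show False using lcp_lengths_three[OF X(4,5) abc(2,3,4)] g by linarith
  qed
  have "X \<subseteq> (\<Union>k\<in>{length m..<length m + 2 * l}. {v \<in> X. length v = k})"
  proof
    fix v assume v: "v \<in> X"
    have "pd m v < 2 * l" using diam m(1) v by blast
    then show "v \<in> (\<Union>k\<in>{length m..<length m + 2 * l}. {v \<in> X. length v = k})"
      using pre[OF m(2)[OF v]] prefix_length_le[OF m(2)[OF v]] v by auto
  qed
  then have "card X \<le> card (\<Union>k\<in>{length m..<length m + 2 * l}. {v \<in> X. length v = k})"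
    by (intro card_mono) (use fin in auto)
  also have "\<dots> \<le> (\<Sum>k\<in>{length m..<length m + 2 * l}. card {v \<in> X. length v = k})"
    by (rule card_UN_le) simp
  also have "\<dots> \<le> (\<Sum>k\<in>{length m..<length m + 2 * l}. 2)" by (rule sum_mono) (rule two)
  finally show ?thesis by simp
qed simp

text \<open>The nodes of \<open>V\<close> are of three kinds, to which the terms of the bound
  correspond: skeleton nodes (\<open>Sk\<close>), gadget nodes sent into the skeleton
  (\<open>W\<close>), and gadget nodes sent into gadgets (\<open>U\<close>), whose share is the
  similarity plus \<open>16 * L\<close>.\<close>

lemma partial_isometry_card:
  fixes x y :: tensor
  assumes V: "V \<subseteq> positions (spine \<mu> (2 ^ n) L False (2 * n) (2 ^ n) x)"
    and \<phi>V: "\<phi> ` V \<subseteq> positions (spine \<mu> (2 ^ n) L True (2 * n) (2 ^ n) y)"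
    and iso: "partial_isometry \<phi> V"
    and bits: "\<And>i. x i \<in> {0, 1}" "\<And>i. y i \<in> {0, 1}"
    and inv: "max_coordinate_invariant (2 * n) x"
    and l: "height (balanced L) \<le> l" "2 * l \<le> \<mu>" and n\<mu>: "n \<le> \<mu>"
  shows "real (card V) \<le> real (size (spine \<mu> (2 ^ n) L False (2 * n) (2 ^ n) (\<lambda>_. 0)))
     + 2 ^ n * (4 * real l) + 2 ^ n * alternate True (2 * n) (\<lambda>i. real (x i * y i)) * real L + 16 * real L"
proof -
  define A where "A = {j. length j = 2 * n \<and> admissible False j \<and> x j \<noteq> 0}"
  define Sk where "Sk = positions (spine \<mu> (2 ^ n) L False (2 * n) (2 ^ n) (\<lambda>_. 0))"
  define G where "G j = (@) (gslot j) ` positions (balanced L)" for j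
  define U where "U j = {v \<in> V \<inter> G j. \<exists>i. length i = 2 * n \<and> y i \<noteq> 0 \<and> \<phi> v \<in> G i}" for j
  define W where "W j = {v \<in> V \<inter> G j. \<exists>i. length i = 2 * n \<and> strict_prefix (\<phi> v) (gslot i)}" for j
  have finV: "finite V" using V finite_positions by (rule finite_subset)
  have inj\<phi>: "inj_on \<phi> V" and pd\<phi>: "\<And>u v. u \<in> V \<Longrightarrow> v \<in> V \<Longrightarrow> pd (\<phi> u) (\<phi> v) = pd u v"
    and lcpV: "\<And>u v. u \<in> V \<Longrightarrow> v \<in> V \<Longrightarrow> lcp u v \<in> V"
    and lcp\<phi>: "\<And>u v. u \<in> V \<Longrightarrow> v \<in> V \<Longrightarrow> \<exists>w\<in>V. lcp (\<phi> u) (\<phi> v) = \<phi> w"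
    using iso unfolding partial_isometry_def by blast+
  have lenA: "length j = 2 * n" if "j \<in> A" for j using that by (simp add: A_def)
  have Vcases: "v \<in> Sk \<or> (\<exists>j\<in>A. v \<in> G j)" if "v \<in> V" for v
    using spine_positions[OF subsetD[OF V that]] by (auto simp: Sk_def A_def G_def)
  have Bcases: "(\<exists>i. length i = 2 * n \<and> strict_prefix (\<phi> v) (gslot i)) \<or>
      (\<exists>i. length i = 2 * n \<and> y i \<noteq> 0 \<and> \<phi> v \<in> G i)" if "v \<in> V" for v
  proof -
    have "\<phi> v \<in> positions (spine \<mu> (2 ^ n) L True (2 * n) (2 ^ n) y)" using \<phi>V that by auto
    from spine_positions[OF this] show ?thesis
      using skeleton_positions[of "\<phi> v" \<mu> "2 ^ n" L True "2 * n" "2 ^ n"] by (auto simp: G_def)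
  qed
  have VG: "v \<in> G j" if "v \<in> V" "length j = 2 * n" "prefix (gslot j) v" for v j
    using Vcases[OF that(1)]
  proof
    assume "v \<in> Sk"
    then obtain i where "length i = 2 * n" "strict_prefix v (gslot i)"
      using skeleton_positions unfolding Sk_def by blast
    then show ?thesis using gslot_not_strict_prefix[OF that(2) _ that(3)] by blast
  next
    assume "\<exists>i\<in>A. v \<in> G i"
    then obtain i u where i: "i \<in> A" "v \<in> G i" "v = gslot i @ u" by (auto simp: G_def)
    then have "j = i" using gslot_prefix_unique[OF that(2) lenA] that(3) by blast
    then show ?thesis using i by simp
  qed
  have BG: "\<exists>i. length i = 2 * n \<and> y i \<noteq> 0 \<and> i = k \<and> \<phi> v \<in> G k"
    if "v \<in> V" "length k = 2 * n" "prefix (gslot k) (\<phi> v)" for v k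
    using Bcases[OF that(1)]
  proof
    assume "\<exists>i. length i = 2 * n \<and> strict_prefix (\<phi> v) (gslot i)"
    then show ?thesis using gslot_not_strict_prefix[OF that(2) _ that(3)] by blast
  next
    assume "\<exists>i. length i = 2 * n \<and> y i \<noteq> 0 \<and> \<phi> v \<in> G i"
    then obtain i u where i: "length i = 2 * n" "y i \<noteq> 0" "\<phi> v \<in> G i" "\<phi> v = gslot i @ u" by (auto simp: G_def)
    then have "k = i" using gslot_prefix_unique[OF that(2) i(1)] that(3) by metis
    then show ?thesis using i by auto
  qed
  have Gprefix: "prefix (gslot j) v" if "v \<in> G j" for v j using that by (auto simp: G_def)

  have near: "pd u v < 2 * l" if "u \<in> G j" "v \<in> G j" for u v j
    using that pd_same_prefix_less[OF l(1)] by (auto simp: G_def)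
  have lcpG: "lcp u v = lcp (gslot j) (gslot j')" if "u \<in> G j" "v \<in> G j'" "length j = 2 * n" "length j' = 2 * n" "j \<noteq> j'"
    for u v j j'
    using that gslot_diverge[OF that(3,4,5)] \<mu>_pos
    by (auto simp: G_def intro!: lcp_append_diverging)
  \<comment> \<open>Two slots part at least \<mu> above either gadget, so distinct gadgets are
    farther apart than the diameter of one.\<close>
  have far: "2 * l \<le> pd u v" if G: "u \<in> G j" "v \<in> G j'" and j: "length j = 2 * n" "length j' = 2 * n" "j \<noteq> j'"
    for u v j j'
  proof -
    have "length (gslot j) \<le> length u" "length (gslot j') \<le> length v" using G Gprefix prefix_length_le by blast+
    then show ?thesis using lcpG[OF G j] gslot_diverge[OF j] l(2) by (simp add: pd_def)
  qed

  have W: "card (W j) \<le> 4 * l" if "j \<in> A" for j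
  proof -
    have "card (\<phi> ` W j) \<le> 4 * l"
    proof (rule card_skeleton_part[OF _ _ _ l(2)])
      show "finite (\<phi> ` W j)" using finV by (simp add: W_def)
      show "lcp u v \<in> \<phi> ` W j" if "u \<in> \<phi> ` W j" "v \<in> \<phi> ` W j" for u v
      proof -
        from that obtain a b where ab: "a \<in> W j" "b \<in> W j" "u = \<phi> a" "v = \<phi> b" by blast
        have abV: "a \<in> V" "b \<in> V" "a \<in> G j" "b \<in> G j" using ab by (auto simp: W_def)
        obtain w where w: "w \<in> V" "lcp (\<phi> a) (\<phi> b) = \<phi> w" using lcp\<phi> abV by blast
        \<comment> \<open>The meeting point of the images lies between them, and the isometry
          transports betweenness back; below one slot this keeps \<open>w\<close> in gadget
          \<open>j\<close>.\<close>
        have "pd a w + pd w b = pd a b"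
          using between_lcp[of "\<phi> a" "\<phi> b"] w abV pd\<phi> by simp
        then have "prefix (lcp a b) w" by (rule between_prefix_lcp)
        moreover have "prefix (gslot j) (lcp a b)" using abV Gprefix by (simp add: prefix_lcp_iff)
        ultimately have "w \<in> G j" using VG[OF w(1) lenA[OF \<open>j \<in> A\<close>]] by simp
        moreover have "\<exists>i. length i = 2 * n \<and> strict_prefix (\<phi> w) (gslot i)"
        proof -
          obtain i where "length i = 2 * n" "strict_prefix (\<phi> a) (gslot i)" using ab(1) by (auto simp: W_def)
          moreover have "prefix (\<phi> w) (\<phi> a)" using w(2) by (metis longest_common_prefix_prefix1)
          ultimately show ?thesis using prefix_order.le_less_trans by blast
        qed
        ultimately show ?thesis using w ab by (auto simp: W_def)
      qed
      show "pd u v < 2 * l" if "u \<in> \<phi> ` W j" "v \<in> \<phi> ` W j" for u v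
        using that near[of _ j] pd\<phi> by (auto simp: W_def)
      show "\<exists>i. length i = 2 * n \<and> strict_prefix v (gslot i)" if "v \<in> \<phi> ` W j" for v
        using that by (auto simp: W_def)
    qed
    moreover have "inj_on \<phi> (W j)" using inj\<phi> by (rule inj_on_subset) (auto simp: W_def)
    ultimately show ?thesis by (simp add: card_image)
  qed

  define R where "R = {j \<in> A. U j \<noteq> {}}"
  \<comment> \<open>The image of a matched part has diameter below \<open>2 * l\<close> and
    therefore cannot reach two gadgets.\<close>
  have "\<forall>j\<in>R. \<exists>i. length i = 2 * n \<and> y i \<noteq> 0 \<and> (\<forall>v\<in>U j. \<phi> v \<in> G i)"
  proof
    fix j assume "j \<in> R"
    then obtain v where v: "v \<in> U j" by (auto simp: R_def)
    then obtain i where i: "length i = 2 * n" "y i \<noteq> 0" "\<phi> v \<in> G i" by (auto simp: U_def)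
    have "\<phi> w \<in> G i" if w: "w \<in> U j" for w
    proof -
      obtain i' where i': "length i' = 2 * n" "\<phi> w \<in> G i'" using w by (auto simp: U_def)
      have "pd (\<phi> v) (\<phi> w) < 2 * l" using near[of v j w] v w pd\<phi> by (auto simp: U_def)
      then have "i = i'" using far[OF i(3) i'(2) i(1) i'(1)] by force
      then show ?thesis using i'(2) by simp
    qed
    then show "\<exists>i. length i = 2 * n \<and> y i \<noteq> 0 \<and> (\<forall>v\<in>U j. \<phi> v \<in> G i)" using i by blast
  qed
  then obtain \<kappa> where \<kappa>: "\<And>j. j \<in> R \<Longrightarrow> length (\<kappa> j) = 2 * n" "\<And>j. j \<in> R \<Longrightarrow> y (\<kappa> j) \<noteq> 0"
    "\<And>j v. j \<in> R \<Longrightarrow> v \<in> U j \<Longrightarrow> \<phi> v \<in> G (\<kappa> j)" by metis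
  have "\<forall>j\<in>R. \<exists>v. v \<in> U j" by (auto simp: R_def)
  then obtain c where c: "\<And>j. j \<in> R \<Longrightarrow> c j \<in> U j" by metis
  define \<sigma> where "\<sigma> j = int (length (c j)) - int (length (\<phi> (c j)))" for j
  have RA: "j \<in> A" "length j = 2 * n" if "j \<in> R" for j using that lenA by (auto simp: R_def)
  have UV: "v \<in> V" "v \<in> G j" if "v \<in> U j" for v j using that by (auto simp: U_def)
  have finA: "finite A" unfolding A_def by (rule finite_subset[OF _ finite_bool_lists[of "2 * n"]]) auto
  have finR: "finite R" using finA by (simp add: R_def)
  have inj\<kappa>: "inj_on \<kappa> R"
  proof (rule inj_onI, rule ccontr)
    fix j j' assume j: "j \<in> R" "j' \<in> R" "\<kappa> j = \<kappa> j'" "j \<noteq> j'"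
    have "pd (\<phi> (c j)) (\<phi> (c j')) < 2 * l" using near \<kappa>(3) c j by metis
    then show False using far[of "c j" j "c j'" j'] c UV RA j pd\<phi> by (metis not_less)
  qed
  \<comment> \<open>An admissible index of the first tree has \<open>True\<close> at every max
    coordinate, so two of them cannot differ there.\<close>
  have even: "even (length (lcp j j'))" if "j \<in> A" "j' \<in> A" "j \<noteq> j'" for j j'
  proof (rule ccontr)
    assume o: "odd (length (lcp j j'))"
    have len: "length j = 2 * n" "length j' = 2 * n" using that lenA by auto
    have lt: "length (lcp j j') < 2 * n" using lcp_length_less[of j j'] len that(3) by simp
    have "even (2 * n - Suc (length (lcp j j')))" using o lt by simp
    then have "j ! length (lcp j j')" "j' ! length (lcp j j')"
      using admissible_nth[of j] admissible_nth[of j'] lt len that by (auto simp: A_def)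
    then show False using lcp_nth_differ[of j j'] len that(3) by simp
  qed
  \<comment> \<open>For arbitrary nodes of the two gadgets: the nodes \<open>c j\<close> and
    \<open>c j'\<close> give the assumption of the locale, and varying \<open>v\<close> against a
    fixed \<open>v'\<close> shows that the shift is constant on \<open>U j\<close>.\<close>
  have sum_shift: "(int (length v) - int (length (\<phi> v))) + (int (length v') - int (length (\<phi> v'))) =
      2 * (dep j (length (lcp j j') div 2) - bdep (\<kappa> j) (length (lcp (\<kappa> j) (\<kappa> j'))))"
    if j: "j \<in> R" "j' \<in> R" "j \<noteq> j'" and v: "v \<in> U j" "v' \<in> U j'" for j j' v v'
  proof -
    have ne: "\<kappa> j \<noteq> \<kappa> j'" using inj\<kappa> j by (auto dest: inj_onD)
    have "int (length (lcp v v')) = bdep j (length (lcp j j'))"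
      using lcpG[of v j v' j'] length_lcp_gslot[of j j'] UV v RA j by simp
    moreover have "bdep j (length (lcp j j')) = dep j (length (lcp j j') div 2)"
      using even[of j j'] RA j by (auto simp: bdep_def elim!: evenE)
    moreover have "int (length (lcp (\<phi> v) (\<phi> v'))) = bdep (\<kappa> j) (length (lcp (\<kappa> j) (\<kappa> j')))"
      using lcpG[of "\<phi> v" "\<kappa> j" "\<phi> v'" "\<kappa> j'"] length_lcp_gslot[of "\<kappa> j" "\<kappa> j'"] \<kappa> v j ne by simp
    moreover have "int (pd (\<phi> v) (\<phi> v')) = int (pd v v')" using pd\<phi> UV v by metis
    ultimately show ?thesis by (simp add: pd_int)
  qed
  interpret matching n \<mu> R \<kappa> \<sigma>
  proof
    show "\<sigma> j + \<sigma> j' = 2 * (dep j (length (lcp j j') div 2) - bdep (\<kappa> j) (length (lcp (\<kappa> j) (\<kappa> j'))))"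
      if "j \<in> R" "j' \<in> R" "j \<noteq> j'" for j j'
      unfolding \<sigma>_def by (rule sum_shift[OF that]) (use c that in auto)
  qed (use finR RA \<kappa> inj\<kappa> even in auto)

  have between_G: "w \<in> U j" if j: "j \<in> R" and ab: "a \<in> U j" "b \<in> U j" and w: "w \<in> V" "pd a w + pd w b = pd a b" for a b w j
  proof -
    have "prefix (lcp a b) w" using w(2) by (rule between_prefix_lcp)
    moreover have "prefix (gslot j) (lcp a b)" using ab UV Gprefix by (simp add: prefix_lcp_iff)
    ultimately have wG: "w \<in> G j" using VG[OF w(1)] RA(2)[OF j] by simp
    have "pd (\<phi> a) (\<phi> w) + pd (\<phi> w) (\<phi> b) = pd (\<phi> a) (\<phi> b)" using w ab UV pd\<phi> by simp
    then have "prefix (lcp (\<phi> a) (\<phi> b)) (\<phi> w)" by (rule between_prefix_lcp)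
    moreover have "prefix (gslot (\<kappa> j)) (lcp (\<phi> a) (\<phi> b))" using \<kappa>(3) ab j Gprefix by (simp add: prefix_lcp_iff)
    ultimately have "prefix (gslot (\<kappa> j)) (\<phi> w)" by simp
    then have "\<phi> w \<in> G (\<kappa> j)" using BG[OF w(1) \<kappa>(1)[OF j]] by blast
    then show ?thesis using w(1) wG \<kappa>(1,2)[OF j] by (auto simp: U_def)
  qed
  have UL: "real (card (U j)) \<le> real L * (1 / 2) ^ m"
    if j: "j \<in> R" and m: "(\<forall>v\<in>U j. length (gslot j) + m \<le> length v) \<or>
      (\<forall>v\<in>U j. length (gslot (\<kappa> j)) + m \<le> length (\<phi> v))" for j m
    using m
  proof
    assume m: "\<forall>v\<in>U j. length (gslot j) + m \<le> length v"
    show ?thesis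
    proof (rule card_gadget_part)
      show "U j \<subseteq> (@) (gslot j) ` positions (balanced L)" using UV by (auto simp: G_def)
      show "lcp a b \<in> U j" if "a \<in> U j" "b \<in> U j" for a b
        using between_G[OF j that] lcpV UV that between_lcp by blast
    qed (use m in auto)
  next
    assume m: "\<forall>v\<in>U j. length (gslot (\<kappa> j)) + m \<le> length (\<phi> v)"
    have "real (card (\<phi> ` U j)) \<le> real L * (1 / 2) ^ m"
    proof (rule card_gadget_part)
      show "\<phi> ` U j \<subseteq> (@) (gslot (\<kappa> j)) ` positions (balanced L)" using \<kappa>(3)[OF j] by (auto simp: G_def)
      show "lcp p q \<in> \<phi> ` U j" if "p \<in> \<phi> ` U j" "q \<in> \<phi> ` U j" for p q
      proof -
        from that obtain a b where ab: "a \<in> U j" "b \<in> U j" "p = \<phi> a" "q = \<phi> b" by blast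
        obtain w where w: "w \<in> V" "lcp (\<phi> a) (\<phi> b) = \<phi> w" using lcp\<phi> ab UV by blast
        have "pd a w + pd w b = pd a b" using between_lcp[of "\<phi> a" "\<phi> b"] w ab UV pd\<phi> by simp
        then have "w \<in> U j" using between_G[OF j ab(1,2) w(1)] by simp
        then show ?thesis using w ab by auto
      qed
    qed (use m in auto)
    moreover have "inj_on \<phi> (U j)" using inj\<phi> by (rule inj_on_subset) (auto simp: U_def)
    ultimately show ?thesis by (simp add: card_image)
  qed
  have UL0: "real (card (U j)) \<le> real L" if "j \<in> R" for j
    using UL[OF that, of 0] UV Gprefix prefix_length_le by fastforce
  have U\<delta>: "real (card (U j)) \<le> real L * (1 / 2) ^ nat \<bar>\<delta> j\<bar>" if j: "j \<in> R" and two: "\<exists>j'\<in>R. j' \<noteq> j" for j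
  proof -
    obtain j' where j': "j' \<in> R" "j' \<noteq> j" using two by blast
    have "int (length v) - int (length (gslot j)) = int (length (\<phi> v)) - int (length (gslot (\<kappa> j))) + \<delta> j"
      if v: "v \<in> U j" for v
    proof -
      have "int (length v) - int (length (\<phi> v)) = \<sigma> j"
        using sum_shift[OF j j'(1) _ v c[OF j'(1)]] sum_shift[OF j j'(1) _ c[OF j] c[OF j'(1)]] j'(2)
        by (auto simp: \<sigma>_def)
      then show ?thesis using length_gslot RA(2)[OF j] \<kappa>(1)[OF j] by (simp add: \<delta>_def)
    qed
    moreover have "length (gslot j) \<le> length v" "length (gslot (\<kappa> j)) \<le> length (\<phi> v)" if "v \<in> U j" for v
      using UV that \<kappa>(3)[OF j that] Gprefix prefix_length_le by blast+
    \<comment> \<open>If the displacement is nonnegative, the nodes of \<open>U j\<close> lie that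
      far below the root of their gadget; otherwise their images lie that far below the root of the
      partner.\<close>
    ultimately show ?thesis
      by (intro UL[OF j]) (cases "0 \<le> \<delta> j"; force)
  qed

  have x1: "x j = 1" if "j \<in> A" for j using bits(1)[of j] that by (auto simp: A_def)
  have sumU: "(\<Sum>j\<in>R. real (card (U j))) \<le>
      2 ^ n * alternate True (2 * n) (\<lambda>i. real (x i * y i)) * real L + 16 * real L"
  \<comment> \<open>A single matched gadget offers no pair to compare, and the trivial bound
    \<open>L\<close> is enough.\<close>
  proof (cases "card R \<le> 1")
    case True
    have "(\<Sum>j\<in>R. real (card (U j))) \<le> real (card R) * real L"
      using sum_bounded_above[of R "\<lambda>j. real (card (U j))" "real L"] UL0 by simp
    also have "\<dots> \<le> 1 * real L" using True by (intro mult_right_mono) auto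
    also have "\<dots> \<le> 16 * real L" by simp
    \<comment> \<open>For the empty set \<open>strategy_value\<close> says that the similarity term
      is nonnegative.\<close>
    finally show ?thesis
      using alternate_bounds[of "\<lambda>i. real (x i * y i)" True "2 * n"] strategy_value[of "{}" "2 * n" "\<lambda>i. real (x i * y i)"]
      by (simp add: add_increasing)
  next
    case False
    have two: "\<exists>j'\<in>R. j' \<noteq> j" for j
    proof (rule ccontr)
      assume "\<not> ?thesis"
      then have "R \<subseteq> {j}" by auto
      then have "card R \<le> 1" using card_mono[of "{j}" R] by simp
      then show False using False by simp
    qed
    define E where "E = {j \<in> R. exact j}"
    \<comment> \<open>The partners of exact gadgets are outcomes of one strategy. Both tensors have
      entry 1 there: \<open>x (\<kappa> j) = x j\<close>, because the expectation bits agree and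
      \<open>x\<close> is max-invariant.\<close>
    have "real (card E) \<le> 2 ^ n * alternate True (2 * n) (\<lambda>i. real (x i * y i))"
    proof -
      have one: "real (x (\<kappa> j) * y (\<kappa> j)) = 1" if "j \<in> E" for j
      proof -
        have j: "j \<in> R" "exact j" using that by (auto simp: E_def)
        have "x (\<kappa> j) = x j"
        proof -
          have "\<kappa> j ! k = j ! k" if "k < 2 * n" "even (2 * n - k)" for k
          proof -
            have "even k" using that by auto
            then obtain h where "k = 2 * h" by auto
            then show ?thesis using j(2) that by (auto simp: exact_def)
          qed
          then show ?thesis using inv \<kappa>(1)[OF j(1)] RA(2)[OF j(1)] unfolding max_coordinate_invariant_def by blast
        qed
        then show ?thesis using x1 RA j(1) \<kappa>(2)[OF j(1)] bits(2)[of "\<kappa> j"] by auto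
      qed
      have "real (card E) = (\<Sum>i\<in>\<kappa> ` E. real (x i * y i))"
      proof -
        have "inj_on \<kappa> E" using inj\<kappa> by (rule inj_on_subset) (auto simp: E_def)
        then have "(\<Sum>i\<in>\<kappa> ` E. real (x i * y i)) = (\<Sum>j\<in>E. real (x (\<kappa> j) * y (\<kappa> j)))"
          by (simp add: sum.reindex)
        also have "\<dots> = (\<Sum>j\<in>E. 1)" by (rule sum.cong) (auto simp: one simp del: of_nat_mult)
        finally show ?thesis by simp
      qed
      also have "\<dots> \<le> 2 ^ (2 * n div 2) * alternate (even (2 * n)) (2 * n) (\<lambda>i. real (x i * y i))"
      proof (rule strategy_value)
        show "finite (\<kappa> ` E)" using finR by (simp add: E_def)
        show "length i = 2 * n" if "i \<in> \<kappa> ` E" for i using that \<kappa>(1) by (auto simp: E_def)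
        show "even (2 * n - length (lcp i i'))" if "i \<in> \<kappa> ` E" "i' \<in> \<kappa> ` E" "i \<noteq> i'" for i i'
          using that exact_lcp_even by (auto simp: E_def)
      qed simp
      finally show ?thesis by simp
    qed
    then have sE: "(\<Sum>j\<in>E. real (card (U j))) \<le> 2 ^ n * alternate True (2 * n) (\<lambda>i. real (x i * y i)) * real L"
      using sum_bounded_above[of E "\<lambda>j. real (card (U j))" "real L"] UL0
      by (smt (verit) E_def mem_Collect_eq mult_right_mono of_nat_0_le_iff)
    have "(\<Sum>j\<in>{j \<in> R. \<not> exact j}. real (card (U j))) \<le> (\<Sum>j\<in>{j \<in> R. \<not> exact j}. real L * (1 / 2) ^ nat \<bar>\<delta> j\<bar>)"
      by (rule sum_mono) (use U\<delta> two in auto)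
    also have "\<dots> = real L * (\<Sum>j\<in>{j \<in> R. \<not> exact j}. (1 / 2) ^ nat \<bar>\<delta> j\<bar>)" by (simp add: sum_distrib_left)
    also have "\<dots> \<le> real L * 16" using inexact_weight[OF n\<mu>] by (intro mult_left_mono) auto
    finally have sN: "(\<Sum>j\<in>{j \<in> R. \<not> exact j}. real (card (U j))) \<le> 16 * real L" by simp
    have "(\<Sum>j\<in>R. real (card (U j))) = (\<Sum>j\<in>E. real (card (U j))) + (\<Sum>j\<in>{j \<in> R. \<not> exact j}. real (card (U j)))"
      unfolding E_def using finR by (subst sum.union_disjoint[symmetric]) (auto intro!: sum.cong)
    then show ?thesis using sE sN by simp
  qed

  have cardA: "card A \<le> 2 ^ n"
  proof -
    have inj: "inj_on (\<lambda>j. map (\<lambda>l. j ! (2 * l)) [0..<n]) A"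
    proof (rule inj_onI, rule ccontr)
      fix j j' assume j: "j \<in> A" "j' \<in> A" "j \<noteq> j'"
        and eq: "map (\<lambda>l. j ! (2 * l)) [0..<n] = map (\<lambda>l. j' ! (2 * l)) [0..<n]"
      have "even (length (lcp j j'))" "length (lcp j j') < 2 * n" "j ! length (lcp j j') \<noteq> j' ! length (lcp j j')"
        using even j lcp_length_less[of j j'] lcp_nth_differ[of j j'] lenA by auto
      then obtain h where "h < n" "length (lcp j j') = 2 * h" "j ! (2 * h) \<noteq> j' ! (2 * h)" by (metis evenE nat_mult_less_cancel_disj)
      then show False using eq by simp
    qed
    have "card A = card ((\<lambda>j. map (\<lambda>l. j ! (2 * l)) [0..<n]) ` A)" using inj by (simp add: card_image)
    also have "\<dots> \<le> card {q :: bool list. length q = n}" by (intro card_mono finite_bool_lists) auto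
    finally show ?thesis by (simp add: card_bool_lists)
  qed
  have "V \<subseteq> Sk \<union> (\<Union>j\<in>A. W j) \<union> (\<Union>j\<in>R. U j)"
  proof
    fix v assume v: "v \<in> V"
    show "v \<in> Sk \<union> (\<Union>j\<in>A. W j) \<union> (\<Union>j\<in>R. U j)"
    proof (cases "v \<in> Sk")
      case False
      then obtain j where j: "j \<in> A" "v \<in> G j" using Vcases v by blast
      have "v \<in> W j \<or> v \<in> U j" using Bcases[OF v] v j(2) by (auto simp: W_def U_def)
      then show ?thesis using j(1) by (auto simp: R_def)
    qed simp
  qed
  moreover have fins: "finite Sk" "finite (W j)" "finite (U j)" for j
    using finV by (auto simp: Sk_def W_def U_def)
  ultimately have "card V \<le> card (Sk \<union> (\<Union>j\<in>A. W j) \<union> (\<Union>j\<in>R. U j))"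
    using finA finR by (intro card_mono) auto
  also have "\<dots> \<le> card Sk + card (\<Union>j\<in>A. W j) + card (\<Union>j\<in>R. U j)"
    by (meson add_le_mono1 card_Un_le le_trans)
  also have "\<dots> \<le> card Sk + (\<Sum>j\<in>A. card (W j)) + (\<Sum>j\<in>R. card (U j))"
    by (intro add_mono card_UN_le finA finR order.refl)
  also have "(\<Sum>j\<in>A. card (W j)) \<le> (\<Sum>j\<in>A. 4 * l)" by (rule sum_mono) (rule W)
  also have "(\<Sum>j\<in>A. 4 * l) \<le> 2 ^ n * (4 * l)" using cardA by simp
  finally have "card V \<le> card Sk + 2 ^ n * (4 * l) + (\<Sum>j\<in>R. card (U j))" by simp
  then have "real (card V) \<le> real (card Sk + 2 ^ n * (4 * l) + (\<Sum>j\<in>R. card (U j)))" by (simp only: of_nat_le_iff)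
  then have "real (card V) \<le> real (card Sk) + 2 ^ n * (4 * real l) + (\<Sum>j\<in>R. real (card (U j)))" by simp
  then show ?thesis using sumU by (simp add: Sk_def card_positions)
qed

end

section \<open>Choice of the parameters\<close>

fun bitlen :: "nat \<Rightarrow> nat" where
  "bitlen 0 = 0"
| "bitlen (Suc m) = Suc (bitlen (Suc m div 2))"

lemma less_power_bitlen: "m < 2 ^ bitlen m"
proof (induction m rule: bitlen.induct)
  case (2 m)
  then show ?case unfolding bitlen.simps power_Suc by linarith
qed simp

lemma power_bitlen_le: "2 ^ bitlen m \<le> max 1 (2 * m)"
proof (induction m rule: bitlen.induct)
  case (2 m)
  have "max 1 (2 * (Suc m div 2)) \<le> Suc m" by (simp; presburger)
  then have "2 ^ bitlen (Suc m div 2) \<le> Suc m" using 2 by (rule le_trans[rotated])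
  then have "2 * 2 ^ bitlen (Suc m div 2) \<le> 2 * Suc m" by (rule mult_le_mono2)
  then show ?case by simp
qed simp

lemma square_le_power: "k * k \<le> 2 * 2 ^ k" for k :: nat
proof (induction k rule: less_induct)
  case (less k)
  show ?case
  proof (cases "k < 5")
    case True
    then have "k \<in> {0, 1, 2, 3, 4}" by auto
    then show ?thesis by auto
  next
    case False
    then obtain m where m: "k = Suc m" "4 \<le> m" by (cases k) auto
    have "m * m \<le> 2 * 2 ^ m" using less m by simp
    moreover have "4 * m \<le> m * m" using m(2) by simp
    ultimately have "Suc m * Suc m \<le> 4 * 2 ^ m" using m(2) by (simp only: mult_Suc mult_Suc_right)
    then show ?thesis using m(1) by simp
  qed
qed

text \<open>The product of \<open>2 ^ n\<close>, at most the square root of \<open>L\<close>, and a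
  logarithm; squaring avoids roots. It absorbs the logarithmic part of the stems, which occur about
  \<open>2 ^ n\<close> times.\<close>

lemma root_mult_bitlen_le:
  assumes "4 ^ n \<le> L" shows "2 ^ n * bitlen L \<le> 2 * L"
proof -
  have "0 < L" using assms by (metis gr0I le_zero_eq power_eq_0_iff zero_neq_numeral)
  then have "2 ^ bitlen L \<le> 2 * L" using power_bitlen_le[of L] by simp
  then have "bitlen L * bitlen L \<le> 4 * L" using square_le_power[of "bitlen L"] by linarith
  moreover have "(2 ^ n * bitlen L)\<^sup>2 = 4 ^ n * (bitlen L * bitlen L)"
    by (simp add: power2_eq_square power_mult_distrib[of 2 2 n, symmetric] mult.commute mult.left_commute
        flip: power_mult_distrib)
  ultimately have "(2 ^ n * bitlen L)\<^sup>2 \<le> L * (4 * L)" using assms mult_le_mono by metis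
  then have "(2 ^ n * bitlen L)\<^sup>2 \<le> (2 * L)\<^sup>2" by (simp add: power2_eq_square)
  then show ?thesis by (rule power2_le_imp_le) simp
qed

lemma bitlen_le: "bitlen m \<le> m"
proof (induction m rule: bitlen.induct)
  case (2 m)
  then show ?case by (simp; presburger)
qed simp

text \<open>The least multiple of \<open>4 * P\<close> above \<open>2 * bitlen L\<close>. With
  \<open>P = 2 ^ n\<close> the factor is \<open>2 ^ (n + 2)\<close>, and \<open>bitlen L\<close>
  bounds the height of a gadget.\<close>

definition gap :: "nat \<Rightarrow> nat \<Rightarrow> nat" where
  "gap P L = 4 * P * (2 * bitlen L div (4 * P) + 1)"

lemma gap_bounds:
  assumes "0 < P" shows "2 * bitlen L \<le> gap P L" "4 * P \<le> gap P L" "gap P L \<le> 4 * P + 2 * bitlen L"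
proof -
  let ?q = "2 * bitlen L div (4 * P)"
  have g: "gap P L = 4 * P * ?q + 4 * P" by (simp add: gap_def algebra_simps)
  have "4 * P * ?q \<le> 2 * bitlen L" by (rule times_div_less_eq_dividend)
  moreover have "2 * bitlen L < 4 * P * ?q + 4 * P"
    using assms mult_div_mod_eq[of "4 * P" "2 * bitlen L"] mod_less_divisor[of "4 * P" "2 * bitlen L"] by linarith
  ultimately show "2 * bitlen L \<le> gap P L" "4 * P \<le> gap P L" "gap P L \<le> 4 * P + 2 * bitlen L"
    using g by linarith+
qed

text \<open>A one-element tree for \<open>t = 0\<close>: there the depth bound leaves no room for a gadget.\<close>

definition gadget_tree :: "bool \<Rightarrow> nat \<Rightarrow> nat \<Rightarrow> tensor \<Rightarrow> unit tree" where
  "gadget_tree full t L x = (if t = 0 then Node Leaf () Leaf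
     else spine (gap (2 ^ (t div 2)) L) (2 ^ (t div 2)) L full t (2 ^ (t div 2)) x)"

lemma gadget_tree_not_Leaf: "gadget_tree full t L x \<noteq> Leaf"
  by (cases t) (simp_all add: gadget_tree_def Let_def)

section \<open>Size, depth and common subtrees of the final trees\<close>

lemma half_power_le: "2 ^ (t div 2) \<le> (2::nat) ^ t"
  by (rule power_increasing) auto

lemma size_gadget_tree:
  assumes "2 ^ t \<le> L" shows "size (gadget_tree full t L x) \<le> 18 * 2 ^ t * L"
proof (cases "t = 0")
  case True
  then show ?thesis using assms by (simp add: gadget_tree_def)
next
  case False
  let ?P = "2 ^ (t div 2) :: nat" and ?g = "gap (2 ^ (t div 2)) L"
  have "size (gadget_tree full t L x) \<le> 2 ^ t * (L + 2 * (?g + 2 * ?P) + 1)"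
    using False size_spine[of ?P ?P ?g L full t x] by (simp add: gadget_tree_def)
  also have "L + 2 * (?g + 2 * ?P) + 1 \<le> 18 * L"
  proof -
    have *: "L + 2 * (g + 2 * P) + 1 \<le> 18 * L"
      if "g \<le> 4 * P + 2 * l" "1 \<le> P" "l \<le> L" "P \<le> L" for g P l :: nat
      using that by simp
    show ?thesis
      by (rule *[OF gap_bounds(3) _ bitlen_le le_trans[OF half_power_le assms]]) simp_all
  qed
  finally show ?thesis by (simp add: mult.commute mult.left_commute)
qed

lemma depth_gadget_tree:
  assumes "2 ^ t \<le> L" "even t"
  shows "real (depth (gadget_tree full t L x)) \<le> 6 * ((2 ^ (t div 2) + log 2 (real L)) * real t)"
proof (cases "t = 0")
  case True
  then show ?thesis by (simp add: gadget_tree_def depth_def)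
next
  case False
  let ?P = "2 ^ (t div 2) :: nat" and ?g = "gap (2 ^ (t div 2)) L" and ?l = "bitlen L"
  \<comment> \<open>With \<open>t \<ge> 2\<close> also \<open>log 2 L \<ge> 2\<close>, which absorbs
    the rounding of the logarithm and the height of the gadget.\<close>
  have t2: "2 \<le> t" using False assms(2) by presburger
  have L0: "0 < L" using assms(1) by (metis gr0I le_zero_eq power_eq_0_iff zero_neq_numeral)
  have "real (2 ^ t) \<le> real L" using assms(1) by (simp only: of_nat_le_iff)
  then have "2 ^ t \<le> real L" by simp
  then have "real t \<le> log 2 (real L)" by (rule le_log_of_power) simp
  then have log2: "2 \<le> log 2 (real L)" using t2 by simp
  have "2 ^ ?l \<le> 2 * L" using power_bitlen_le[of L] L0 by simp
  then have "real (2 ^ ?l) \<le> real (2 * L)" by (simp only: of_nat_le_iff)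
  then have "2 ^ ?l \<le> 2 * real L" by simp
  then have "real ?l \<le> log 2 (2 * real L)" by (rule le_log_of_power) simp
  also have "\<dots> = 1 + log 2 (real L)" using L0 by (simp add: log_mult)
  finally have l: "real ?l \<le> 2 * log 2 (real L)" using log2 by simp
  have "height (balanced L) \<le> ?l" by (rule height_balanced) (rule less_power_bitlen)
  then have "height (gadget_tree full t L x) \<le> t * (?g + 2 * ?P) + ?l"
    using False height_spine[of L ?l ?P ?P ?g full t x] by (simp add: gadget_tree_def)
  then have "depth (gadget_tree full t L x) \<le> t * (?g + 2 * ?P) + ?l"
    unfolding depth_def by (rule le_trans[OF diff_le_self])
  also have "\<dots> \<le> t * (6 * ?P + 2 * ?l) + ?l"
    using gap_bounds(3)[of ?P L] by simp
  finally have "real (depth (gadget_tree full t L x)) \<le> real (t * (6 * ?P + 2 * ?l) + ?l)" by (simp only: of_nat_le_iff)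
  also have "\<dots> = real t * (6 * 2 ^ (t div 2) + 2 * real ?l) + real ?l" by simp
  also have "\<dots> \<le> real t * (6 * 2 ^ (t div 2) + 4 * log 2 (real L)) + 2 * log 2 (real L)"
    using l by (intro add_mono mult_left_mono) auto
  also have "2 * log 2 (real L) \<le> real t * log 2 (real L)" using t2 log2 by (intro mult_right_mono) auto
  also have "real t * (6 * 2 ^ (t div 2) + 4 * log 2 (real L)) + real t * log 2 (real L) =
      real t * (6 * 2 ^ (t div 2) + 5 * log 2 (real L))" by (simp add: algebra_simps)
  also have "\<dots> \<le> real t * (6 * (2 ^ (t div 2) + log 2 (real L)))"
    using log2 by (intro mult_left_mono) auto
  finally show ?thesis by (simp add: algebra_simps)
qed

text \<open>The constant 61 consists of 37 for the skeleton, 8 for gadget nodes sent into the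
  skeleton, and 16 for displaced gadgets. The additional \<open>L\<close> in the first inequality
  accommodates the one-node trees for \<open>t = 0\<close>.\<close>

lemma gadget_tree_similarity:
  assumes "even t" "2 ^ t \<le> L" and a: "a \<in> tensors t" "max_invariant t a" and b: "b \<in> tensors t"
  defines "s \<equiv> tropical_similarity t a b"
  defines "T \<equiv> gadget_tree False t L a" and "U \<equiv> gadget_tree True t L b"
  shows "2 ^ (t div 2) * s * real L \<le> real (RLCST T U) + real L" "RLCST T U \<le> LCST T U"
    "real (LCST T U) \<le> 2 ^ (t div 2) * s * real L + 61 * real L"
    "s = 1 \<Longrightarrow> RLCST T U = size T \<and> LCST T U = size T"
proof -
  \<comment> \<open>A tensor is \<open>undefined\<close> at lists of other lengths, whereas the
    lemmas on spines want entries in \<open>{0, 1}\<close> everywhere.\<close>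
  define x where "x i = (if length i = t then a i else 0)" for i
  define y where "y i = (if length i = t then b i else 0)" for i
  have x01: "x i \<in> {0, 1}" "y i \<in> {0, 1}" for i using a b by (auto simp: x_def y_def tensors_def)
  have s: "s = alternate True t (\<lambda>i. real (x i * y i))"
    unfolding s_def tropical_similarity_def by (rule alternate_cong) (simp add: x_def y_def)
  have inv: "max_coordinate_invariant t x"
    using a(2) assms(1) unfolding max_coordinate_invariant_def max_invariant_def x_def by auto
  have s01: "0 \<le> s" "s \<le> 1"
  proof -
    have "real (x i * y i) \<le> 1" for i using x01[of i] by auto
    then show "0 \<le> s" "s \<le> 1" using alternate_bounds[of "\<lambda>i. real (x i * y i)" True t] s by auto
  qed
  have TU: "T \<noteq> Leaf" "U \<noteq> Leaf" by (simp_all add: T_def U_def gadget_tree_not_Leaf)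
  have L0: "0 < L" using assms(2) by (metis gr0I le_zero_eq power_eq_0_iff zero_neq_numeral)
  have "\<exists>C. embeds C T \<and> embeds C U \<and> C \<noteq> Leaf \<and>
      2 ^ (t div 2) * s * real L \<le> real (size C) + real L \<and> (s = 1 \<longrightarrow> C = T)"
  proof (cases "t = 0")
    case True
    then have "T = Node Leaf () Leaf" "U = Node Leaf () Leaf" by (auto simp: T_def U_def gadget_tree_def)
    moreover have "s * real L \<le> 1 * real L" using s01 by (intro mult_right_mono) auto
    ultimately show ?thesis using True embeds_refl[of T]
      by (intro exI[of _ "Node Leaf () Leaf"]) auto
  next
    case False
    let ?P = "2 ^ (t div 2) :: nat" and ?g = "gap (2 ^ (t div 2)) L"
    have T: "T = spine ?g ?P L False t ?P x" and U: "U = spine ?g ?P L True t ?P y"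
      using False by (auto simp: T_def U_def gadget_tree_def x_def y_def intro!: spine_cong)
    obtain C where C: "embeds C T" "embeds C U" "2 ^ (t div 2) * s * real L \<le> real (size C)" "s = 1 \<longrightarrow> C = T"
      using common_embedded_tree[where d = t and x = x and y = y and \<mu> = ?g and P = ?P and L = L and c = ?P,
          OF inv x01(1) x01(2)] assms(1) unfolding T U s by auto
    show ?thesis
    proof (cases "C = Leaf")
      case True
      have "embeds (Node Leaf () Leaf) T" "embeds (Node Leaf () Leaf) U"
        using TU by (cases T; cases U; auto intro: embeds.intros)+
      moreover have "s \<noteq> 1" using C(4) True TU by auto
      ultimately show ?thesis using C(3) True False by (intro exI[of _ "Node Leaf () Leaf"]) auto
    next
      case C0: False
      then show ?thesis using C False by auto
    qed
  qed
  then obtain C where C: "embeds C T" "embeds C U" "C \<noteq> Leaf"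
    "2 ^ (t div 2) * s * real L \<le> real (size C) + real L" "s = 1 \<longrightarrow> C = T" by blast
  note ge = RLCST_ge[OF C(1-3)]
  show "2 ^ (t div 2) * s * real L \<le> real (RLCST T U) + real L" using ge(1) C(4) by linarith
  show "RLCST T U \<le> LCST T U" by (rule ge(2))
  show "RLCST T U = size T \<and> LCST T U = size T" if "s = 1"
    using LCST_le_size[OF TU] ge C(5) that by auto
  show "real (LCST T U) \<le> 2 ^ (t div 2) * s * real L + 61 * real L"
  proof (cases "t = 0")
    case True
    then have "size T = 1" by (simp add: T_def gadget_tree_def)
    then have "real (LCST T U) \<le> 1" using LCST_le_size[OF TU] by simp
    also have "\<dots> \<le> 61 * real L" using L0 by simp
    finally show ?thesis using s01 by (simp add: add_increasing)
  next
    case False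
    define n where "n = t div 2"
    have t: "t = 2 * n" using assms(1) by (simp add: n_def)
    let ?P = "2 ^ n :: nat" and ?g = "gap (2 ^ n) L" and ?l = "bitlen L"
    have T: "T = spine ?g ?P L False (2 * n) ?P x" and U: "U = spine ?g ?P L True (2 * n) ?P y"
      using False t by (auto simp: T_def U_def gadget_tree_def x_def y_def intro!: spine_cong)
    have g: "2 * ?l \<le> ?g" "4 * ?P \<le> ?g" "?g \<le> 4 * ?P + 2 * ?l" using gap_bounds[of ?P L] by auto
    interpret spacing n ?g
    proof
      have "(2::nat) ^ (n + 2) = 4 * ?P" by simp
      then show "2 ^ (n + 2) dvd ?g" unfolding gap_def by simp
      show "0 < ?g" using g(2) by (metis gr0I le_zero_eq mult_eq_0_iff power_eq_0_iff zero_neq_numeral)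
    qed
    have 4: "4 ^ n \<le> L" using assms(2) by (simp add: t power_mult)
    have P2: "?P * ?P = 4 ^ n" by (simp flip: power_mult_distrib)
    have l2: "?P * ?l \<le> 2 * L" by (rule root_mult_bitlen_le[OF 4])
    have "size (spine ?g ?P L False (2 * n) ?P (\<lambda>_. 0)) \<le> ?P * (2 * (2 * ?g + 2 * ?P) + 1)"
      by (rule size_skeleton) simp
    \<comment> \<open>From \<open>?g \<le> 4 * ?P + 2 * ?l\<close>. With
      \<open>?P * ?P \<le> L\<close> and \<open>?P * ?l \<le> 2 * L\<close> this becomes
      \<open>(21 + 16) * L\<close>.\<close>
    also have "\<dots> \<le> ?P * (21 * ?P + 8 * ?l)"
    proof (rule mult_le_mono2)
      have *: "2 * (2 * g + 2 * P) + 1 \<le> 21 * P + 8 * l" if "g \<le> 4 * P + 2 * l" "1 \<le> P" for g P l :: nat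
        using that by simp
      show "2 * (2 * ?g + 2 * ?P) + 1 \<le> 21 * ?P + 8 * ?l" by (rule *[OF g(3)]) simp
    qed
    also have "\<dots> = 21 * 4 ^ n + 8 * (?P * ?l)" by (simp add: algebra_simps flip: P2)
    also have "\<dots> \<le> 37 * L" using 4 l2 by linarith
    finally have sk: "real (size (spine ?g ?P L False (2 * n) ?P (\<lambda>_. 0))) \<le> 37 * real L" by linarith
    have "real (?P * ?l) \<le> real (2 * L)" using l2 by (simp only: of_nat_le_iff)
    then have l2': "2 ^ n * (4 * real ?l) \<le> 8 * real L" by (simp add: mult.commute)
    have hl: "height (balanced L) \<le> ?l" by (rule height_balanced) (rule less_power_bitlen)
    have ng: "n \<le> ?g" using g(2) less_exp[of n] by linarith
    let ?B = "2 ^ n * s * real L + 61 * real L"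
    have "card V \<le> nat \<lfloor>?B\<rfloor>" if V: "V \<subseteq> positions T" "\<phi> ` V \<subseteq> positions U" "partial_isometry \<phi> V" for V \<phi>
    proof -
      have "real (card V) \<le> real (size (spine ?g ?P L False (2 * n) ?P (\<lambda>_. 0))) + 2 ^ n * (4 * real ?l)
         + 2 ^ n * alternate True (2 * n) (\<lambda>i. real (x i * y i)) * real L + 16 * real L"
        by (rule partial_isometry_card[OF _ _ V(3) x01 _ hl g(1) ng]) (use V inv T U t in auto)
      then have "real (card V) \<le> ?B" using sk l2' unfolding s t by linarith
      then show ?thesis by (rule le_nat_floor)
    qed
    then have "LCST T U \<le> nat \<lfloor>?B\<rfloor>" by (rule LCST_le[OF TU])
    then have "real (LCST T U) \<le> real (nat \<lfloor>?B\<rfloor>)" by (simp only: of_nat_le_iff)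
    also have "\<dots> \<le> ?B" by (rule of_nat_floor) (use s01 in simp)
    finally show ?thesis by (simp add: n_def)
  qed
qed

section \<open>The program\<close>

text \<open>Loop-free code can be evaluated by simplification: \<open>run\<close> is the outcome,
  \<open>fits\<close> collects the overflow conditions, and \<open>cost\<close> bounds the steps. A
  loop never fits, so the values for \<open>While\<close> in \<open>run\<close> and
  \<open>cost\<close> are arbitrary.\<close>

fun run :: "com \<Rightarrow> state \<Rightarrow> state" where
  "run (Assign x e) s = s\<lparr>regs := (regs s)(x := expr_val e s)\<rparr>"
| "run (Put k a b) s = s\<lparr>arrays := (arrays s)(k := (arrays s k)(operand_val a s := operand_val b s))\<rparr>"
| "run (Write a) s = s\<lparr>written := written s @ [operand_val a s]\<rparr>"
| "run (Seq P Q) s = run Q (run P s)"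
| "run (Cond b P Q) s = (if test_val b s then run P s else run Q s)"
| "run (While b P) s = s"

fun fits :: "nat \<Rightarrow> com \<Rightarrow> state \<Rightarrow> bool" where
  "fits w (Assign x e) s \<longleftrightarrow> expr_val e s < 2 ^ w"
| "fits w (Put k a b) s \<longleftrightarrow> operand_val a s < 2 ^ w \<and> operand_val b s < 2 ^ w"
| "fits w (Write a) s \<longleftrightarrow> operand_val a s < 2 ^ w"
| "fits w (Seq P Q) s \<longleftrightarrow> fits w P s \<and> fits w Q (run P s)"
| "fits w (Cond b P Q) s \<longleftrightarrow> (if test_val b s then fits w P s else fits w Q s)"
| "fits w (While b P) s \<longleftrightarrow> False"

fun cost :: "com \<Rightarrow> nat" where
  "cost (Seq P Q) = cost P + cost Q"
| "cost (Cond b P Q) = Suc (cost P + cost Q)"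
| "cost (While b P) = 0"
| "cost P = 1"

lemma exec_run: "fits w P s \<Longrightarrow> \<exists>k\<le>cost P. exec w P s k (run P s)"
proof (induction P arbitrary: s)
  case (Seq P Q)
  then obtain k l where "k \<le> cost P" "exec w P s k (run P s)" "l \<le> cost Q" "exec w Q (run P s) l (run Q (run P s))"
    by (metis fits.simps(4))
  then show ?case by (intro exI[of _ "k + l"]) (auto intro: exec.Seq)
next
  case (Cond b P Q)
  show ?case
  proof (cases "test_val b s")
    case True
    then obtain k where "k \<le> cost P" "exec w P s k (run P s)" using Cond by auto
    then show ?thesis using True by (intro exI[of _ "Suc k"]) (auto intro: exec.CondTrue)
  next
    case False
    then obtain k where "k \<le> cost Q" "exec w Q s k (run Q s)" using Cond by auto
    then show ?thesis using False by (intro exI[of _ "Suc k"]) (auto intro: exec.CondFalse)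
  qed
next
  case (Assign x e)
  then show ?case by (metis cost.simps(4) exec.Assign fits.simps(1) order_refl run.simps(1))
next
  case (Put k a b)
  then show ?case by (metis cost.simps(5) exec.Put fits.simps(2) order_refl run.simps(2))
next
  case (Write a)
  then show ?case by (metis cost.simps(6) exec.Write fits.simps(3) order_refl run.simps(3))
qed simp

text \<open>The index of the invariant is the exact number of iterations left, so termination and
  running time come together.\<close>

lemma exec_while:
  assumes step: "\<And>m s. I (Suc m) s \<Longrightarrow> test_val b s \<and> (\<exists>k s'. exec w P s k s' \<and> k \<le> T \<and> I m s')"
    and stop: "\<And>s. I 0 s \<Longrightarrow> \<not> test_val b s"
  shows "I m s \<Longrightarrow> \<exists>k s'. exec w (While b P) s k s' \<and> k \<le> m * (T + 1) + 1 \<and> I 0 s'"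
proof (induction m arbitrary: s)
  case 0
  have "exec w (While b P) s 1 s" by (rule exec.WhileFalse) (rule stop[OF 0])
  then show ?case using 0 by (intro exI[of _ 1] exI[of _ s]) simp
next
  case (Suc m)
  obtain k s' where k: "test_val b s" "exec w P s k s'" "k \<le> T" "I m s'" using step[OF Suc.prems] by blast
  obtain l s'' where l: "exec w (While b P) s' l s''" "l \<le> m * (T + 1) + 1" "I 0 s''" using Suc.IH[OF k(4)] by blast
  show ?case using exec.WhileTrue[OF k(1,2) l(1)] k(3) l by (intro exI[of _ "Suc (k + l)"] exI[of _ s'']) auto
qed

lemma exec_fits_while:
  assumes step: "\<And>m s. I (Suc m) s \<Longrightarrow> test_val b s \<and> fits w P s \<and> I m (run P s)"
    and stop: "\<And>s. I 0 s \<Longrightarrow> \<not> test_val b s" and "I m s"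
  shows "\<exists>k s'. exec w (While b P) s k s' \<and> k \<le> m * (cost P + 1) + 1 \<and> I 0 s'"
proof (rule exec_while[of I b w P "cost P", OF _ stop \<open>I m s\<close>])
  fix m s assume "I (Suc m) s"
  then show "test_val b s \<and> (\<exists>k s'. exec w P s k s' \<and> k \<le> cost P \<and> I m s')"
    using step exec_run by meson
qed

section \<open>Writing a tree in preorder with an explicit stack\<close>

notation Seq (infixr ";;" 60)

type_synonym item = "nat \<times> nat \<times> nat \<times> nat"

text \<open>A stack item \<open>(k, e, c, i)\<close> stands for a pending subtree: a balanced tree with \<open>k\<close> nodes if
  \<open>e = 0\<close>, and otherwise a stem of length \<open>k\<close> above the spine over the last \<open>e - 1\<close> coordinates,
  where \<open>i\<close> is the binary value of the coordinates already fixed, preceded by the tensor number.\<close>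

definition tree_of :: "nat \<Rightarrow> nat \<Rightarrow> nat \<Rightarrow> bool \<Rightarrow> (nat \<Rightarrow> nat) \<Rightarrow> item \<Rightarrow> unit tree" where
  "tree_of \<mu> P L full cells = (\<lambda>(k, e, c, i). if e = 0 then balanced k
     else stem k (spine \<mu> P L full (e - 1) c (\<lambda>j. cells (foldl (\<lambda>m b. 2 * m + of_bool b) i j))))"

text \<open>One unfolding of the tree equations, with \<open>None\<close> for \<open>Leaf\<close>;
  each takes a bounded number of instructions, so the time is linear in the output. As
  \<open>e - 1\<close> coordinates are left, an odd \<open>e > 1\<close> announces an expectation
  coordinate.\<close>

definition expand :: "nat \<Rightarrow> nat \<Rightarrow> nat \<Rightarrow> bool \<Rightarrow> (nat \<Rightarrow> nat) \<Rightarrow> item \<Rightarrow> (item \<times> item) option" where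
  "expand \<mu> P L full cells = (\<lambda>(k, e, c, i).
     if e = 0 then (if k = 0 then None else Some ((k div 2, 0, 0, 0), ((k - 1) div 2, 0, 0, 0)))
     else if 0 < k then Some ((0, 0, 0, 0), (k - 1, e, c, i))
     else if e = 1 then (if cells i = 0 then None else Some ((L div 2, 0, 0, 0), ((L - 1) div 2, 0, 0, 0)))
     else if e mod 2 = 1 then Some ((\<mu> + c div 2 - 1, e - 1, c div 2, i * 2),
       (\<mu> + (c div 2 + P) - 1, e - 1, c div 2 + P, i * 2 + 1))
     else Some (if full then (\<mu> - 1, e - 1, c, i * 2) else (0, 0, 0, 0), (\<mu> - 1, e - 1, c, i * 2 + 1)))"

lemma balanced_expand: "0 < k \<Longrightarrow> balanced k = Node (balanced (k div 2)) () (balanced ((k - 1) div 2))"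
  by (cases k) simp_all

lemma tree_of_expand:
  assumes "0 < L"
  shows "tree_of \<mu> P L full cells it = (case expand \<mu> P L full cells it of None \<Rightarrow> Leaf
    | Some (l, r) \<Rightarrow> Node (tree_of \<mu> P L full cells l) () (tree_of \<mu> P L full cells r))"
proof -
  obtain k e c i where it: "it = (k, e, c, i)" by (cases it)
  have "e = 0 \<or> 0 < e \<and> 0 < k \<or> e = 1 \<and> k = 0 \<or> (\<exists>d. e = Suc (Suc d)) \<and> k = 0" by (cases e; cases "e - 1") auto
  then consider (bal) "e = 0" | (stem) k' e' where "e = Suc e'" "k = Suc k'" | (leaf) "e = 1" "k = 0"
    | (branch) d where "e = Suc (Suc d)" "k = 0"
    by (auto simp: gr0_conv_Suc)
  then show ?thesis
  proof cases
    case bal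
    then show ?thesis by (auto simp: it expand_def tree_of_def balanced_expand)
  next
    case stem
    then show ?thesis by (simp add: it expand_def tree_of_def)
  next
    case leaf
    then show ?thesis using assms by (auto simp: it expand_def tree_of_def balanced_expand)
  next
    case branch
    show ?thesis
    proof (cases "odd d")
      case True
      then have "e mod 2 = 1" using branch by (simp add: odd_iff_mod_2_eq_one)
      then show ?thesis using branch True
        by (simp add: it expand_def tree_of_def next_offset_def Let_def mult.commute)
    next
      case False
      then have "e mod 2 = 0" using branch by (simp add: even_iff_mod_2_eq_zero)
      then show ?thesis using branch False
        by (simp add: it expand_def tree_of_def Let_def mult.commute)
    qed
  qed
qed

text \<open>Registers 0 to 4 hold \<open>t\<close>, \<open>N\<close>, \<open>L\<close>,
  \<open>P\<close>, \<mu>, and register 5 the height of the stack, whose four components are in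
  arrays 2 to 5. The popped item goes to registers 10 to 13, its children to 20 to 23 and 30 to 33,
  and register 14 is 0 for a leaf.\<close>

definition pop_item :: com where
  "pop_item = Assign 5 (Arith Minus (Reg 5) (Const 1)) ;; Assign 10 (Get 2 (Reg 5)) ;;
     Assign 11 (Get 3 (Reg 5)) ;; Assign 12 (Get 4 (Reg 5)) ;; Assign 13 (Get 5 (Reg 5))"

definition halve_item :: com where
  "halve_item = Assign 20 (Arith Div (Reg 10) (Const 2)) ;; Assign 30 (Arith Minus (Reg 10) (Const 1)) ;;
     Assign 30 (Arith Div (Reg 30) (Const 2))"

definition clear_items :: com where
  "clear_items = Assign 14 (Atom (Const 1)) ;;
     Assign 20 (Atom (Const 0)) ;; Assign 21 (Atom (Const 0)) ;; Assign 22 (Atom (Const 0)) ;; Assign 23 (Atom (Const 0)) ;;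
     Assign 30 (Atom (Const 0)) ;; Assign 31 (Atom (Const 0)) ;; Assign 32 (Atom (Const 0)) ;; Assign 33 (Atom (Const 0))"

definition expand_item :: "nat \<Rightarrow> bool \<Rightarrow> com" where
  "expand_item arr full = clear_items ;;
     Cond (Equal (Reg 11) (Const 0))
       (Cond (Equal (Reg 10) (Const 0)) (Assign 14 (Atom (Const 0))) halve_item)
       (Cond (Less (Const 0) (Reg 10))
         (Assign 30 (Arith Minus (Reg 10) (Const 1)) ;; Assign 31 (Atom (Reg 11)) ;;
          Assign 32 (Atom (Reg 12)) ;; Assign 33 (Atom (Reg 13)))
         (Cond (Equal (Reg 11) (Const 1))
           (Assign 15 (Get arr (Reg 13)) ;;
            Cond (Equal (Reg 15) (Const 0)) (Assign 14 (Atom (Const 0))) (Assign 10 (Atom (Reg 2)) ;; halve_item))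
           (Assign 31 (Arith Minus (Reg 11) (Const 1)) ;; Assign 23 (Arith Times (Reg 13) (Const 2)) ;;
            Assign 33 (Arith Plus (Reg 23) (Const 1)) ;; Assign 15 (Arith Mod (Reg 11) (Const 2)) ;;
            Cond (Equal (Reg 15) (Const 1))
              (Assign 21 (Atom (Reg 31)) ;; Assign 22 (Arith Div (Reg 12) (Const 2)) ;;
               Assign 32 (Arith Plus (Reg 22) (Reg 3)) ;; Assign 20 (Arith Plus (Reg 4) (Reg 22)) ;;
               Assign 20 (Arith Minus (Reg 20) (Const 1)) ;; Assign 30 (Arith Plus (Reg 4) (Reg 32)) ;;
               Assign 30 (Arith Minus (Reg 30) (Const 1)))
              (Assign 32 (Atom (Reg 12)) ;; Assign 30 (Arith Minus (Reg 4) (Const 1)) ;;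
               (if full then Assign 20 (Atom (Reg 30)) ;; Assign 21 (Atom (Reg 31)) ;; Assign 22 (Atom (Reg 12))
                else Assign 23 (Atom (Const 0)))))))"

definition push_item :: "nat \<Rightarrow> nat \<Rightarrow> nat \<Rightarrow> nat \<Rightarrow> com" where
  "push_item k e c i = Put 2 (Reg 5) (Reg k) ;; Put 3 (Reg 5) (Reg e) ;; Put 4 (Reg 5) (Reg c) ;;
     Put 5 (Reg 5) (Reg i) ;; Assign 5 (Arith Plus (Reg 5) (Const 1))"

text \<open>The right child is pushed first, so the left one is popped next, as preorder
  demands.\<close>

definition emit_item :: com where
  "emit_item = Cond (Equal (Reg 14) (Const 0)) (Write (Const 0))
     (Write (Const 1) ;; push_item 30 31 32 33 ;; push_item 20 21 22 23)"

definition stack_step :: "nat \<Rightarrow> bool \<Rightarrow> com" where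
  "stack_step arr full = pop_item ;; expand_item arr full ;; emit_item"

definition stack_is :: "state \<Rightarrow> item list \<Rightarrow> bool" where
  "stack_is s st \<longleftrightarrow> regs s 5 = length st \<and>
     (\<forall>m<length st. (arrays s 2 m, arrays s 3 m, arrays s 4 m, arrays s 5 m) = st ! m)"

definition same_frame :: "state \<Rightarrow> state \<Rightarrow> bool" where
  "same_frame s s' \<longleftrightarrow> (\<forall>r\<in>{0, 1, 2, 3, 4, 7, 8}. regs s' r = regs s r) \<and> (\<forall>k\<in>{0, 1}. arrays s' k = arrays s k)"

lemma push_item_spec:
  assumes "stack_is s st" "length st + 1 < 2 ^ w" "\<forall>r\<in>{k, e, c, i}. regs s r < 2 ^ w" "5 \<notin> {k, e, c, i}"
  shows "fits w (push_item k e c i) s"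
    "stack_is (run (push_item k e c i) s) (st @ [(regs s k, regs s e, regs s c, regs s i)])"
    "same_frame s (run (push_item k e c i) s)" "written (run (push_item k e c i) s) = written s"
    "\<And>r. r \<noteq> 5 \<Longrightarrow> regs (run (push_item k e c i) s) r = regs s r"
  using assms by (auto simp: push_item_def stack_is_def same_frame_def nth_append less_Suc_eq)

lemma pop_item_spec:
  assumes "stack_is s (st @ [(k, e, c, i)])" "length st < 2 ^ w" "k < 2 ^ w" "e < 2 ^ w" "c < 2 ^ w" "i < 2 ^ w"
  shows "fits w pop_item s" "stack_is (run pop_item s) st" "same_frame s (run pop_item s)"
    "written (run pop_item s) = written s"
    "regs (run pop_item s) 10 = k" "regs (run pop_item s) 11 = e" "regs (run pop_item s) 12 = c" "regs (run pop_item s) 13 = i"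
proof -
  have s: "regs s 5 = Suc (length st)" "arrays s 2 (length st) = k" "arrays s 3 (length st) = e"
    "arrays s 4 (length st) = c" "arrays s 5 (length st) = i"
    "\<And>m. m < length st \<Longrightarrow> (arrays s 2 m, arrays s 3 m, arrays s 4 m, arrays s 5 m) = st ! m"
    using assms(1) by (auto simp: stack_is_def nth_append dest: spec[of _ "length st"] split: if_splits)
  show "fits w pop_item s" "stack_is (run pop_item s) st" "same_frame s (run pop_item s)"
    "written (run pop_item s) = written s"
    "regs (run pop_item s) 10 = k" "regs (run pop_item s) 11 = e" "regs (run pop_item s) 12 = c" "regs (run pop_item s) 13 = i"
    using s assms(2-) by (auto simp: pop_item_def stack_is_def same_frame_def)
qed

lemma expand_item_spec:
  fixes full :: bool
  assumes r: "regs s 10 = k" "regs s 11 = e" "regs s 12 = c" "regs s 13 = i"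
    and p: "regs s 2 = L" "regs s 3 = P" "regs s 4 = \<mu>"
    and w: "(1::nat) < 2 ^ w" "k < 2 ^ w" "e < 2 ^ w" "c < 2 ^ w" "i < 2 ^ w" "L < 2 ^ w" "arrays s arr i < 2 ^ w"
      "2 \<le> e \<Longrightarrow> i * 2 + 1 < 2 ^ w" "\<mu> + (c div 2 + P) < 2 ^ w"
  defines "s' \<equiv> run (expand_item arr full) s"
  shows "fits w (expand_item arr full) s" "written s' = written s" "arrays s' = arrays s"
    "\<forall>r\<in>{0, 1, 2, 3, 4, 5, 7, 8}. regs s' r = regs s r"
    "case expand \<mu> P L full (arrays s arr) (k, e, c, i) of None \<Rightarrow> regs s' 14 = 0
      | Some (l, r) \<Rightarrow> regs s' 14 = 1 \<and> (regs s' 20, regs s' 21, regs s' 22, regs s' 23) = l \<and>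
         (regs s' 30, regs s' 31, regs s' 32, regs s' 33) = r"
proof -
  define s0 where "s0 = run clear_items s"
  have c0: "fits w clear_items s" using w(1) by (simp add: clear_items_def)
  have s0: "regs s0 10 = k" "regs s0 11 = e" "regs s0 12 = c" "regs s0 13 = i"
    "regs s0 2 = L" "regs s0 3 = P" "regs s0 4 = \<mu>" "regs s0 14 = 1"
    "regs s0 20 = 0" "regs s0 21 = 0" "regs s0 22 = 0" "regs s0 23 = 0"
    "regs s0 30 = 0" "regs s0 31 = 0" "regs s0 32 = 0" "regs s0 33 = 0"
    "arrays s0 = arrays s" "written s0 = written s" "regs s0 0 = regs s 0" "regs s0 (Suc 0) = regs s (Suc 0)"
    "regs s0 5 = regs s 5" "regs s0 7 = regs s 7" "regs s0 8 = regs s 8"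
    using r p by (simp_all add: s0_def clear_items_def)
  have bounds: "L div 2 < 2 ^ w" "k div 2 < 2 ^ w" "c div 2 < 2 ^ w" "(k - 1) div 2 < 2 ^ w" "(L - 1) div 2 < 2 ^ w"
    "k - 1 < 2 ^ w" "L - 1 < 2 ^ w" "e - 1 < 2 ^ w" "\<mu> - 1 < 2 ^ w" "c div 2 + P < 2 ^ w" "\<mu> + c div 2 < 2 ^ w"
    "\<mu> + c div 2 - 1 < 2 ^ w" "\<mu> + (c div 2 + P) - 1 < 2 ^ w" "e mod 2 < 2 ^ w" "0 < (2::nat) ^ w"
    using w by (auto intro: le_less_trans[OF div_le_dividend] le_less_trans[OF mod_less_eq_dividend] le_less_trans[OF diff_le_self])
  consider (bal0) "e = 0" "k = 0" | (bal) "e = 0" "0 < k" | (stem) "0 < e" "0 < k"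
    | (leaf0) "e = 1" "k = 0" "arrays s arr i = 0" | (leaf) "e = 1" "k = 0" "arrays s arr i \<noteq> 0"
    | (E) "2 \<le> e" "k = 0" "e mod 2 = 1" | (M) "2 \<le> e" "k = 0" "e mod 2 = 0"
    by (metis One_nat_def Suc_1 Suc_leI bot_nat_0.not_eq_extremum mod2_eq_if le_eq_less_or_eq less_2_cases_iff not_less)
  note cases = this
  note simps = s'_def expand_item_def halve_item_def expand_def s0_def[symmetric] s0
  show "fits w (expand_item arr full) s"
    using cases by cases (use c0 bounds w in \<open>auto simp: simps\<close>)
  show "written s' = written s" "arrays s' = arrays s"
    using cases by (cases; simp add: simps)+
  show "\<forall>r\<in>{0, 1, 2, 3, 4, 5, 7, 8}. regs s' r = regs s r"
    using cases p by cases (auto simp: simps)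
  show "case expand \<mu> P L full (arrays s arr) (k, e, c, i) of None \<Rightarrow> regs s' 14 = 0
      | Some (l, r) \<Rightarrow> regs s' 14 = 1 \<and> (regs s' 20, regs s' 21, regs s' 22, regs s' 23) = l \<and>
         (regs s' 30, regs s' 31, regs s' 32, regs s' 33) = r"
    using cases by cases (simp_all add: simps)
qed


text \<open>Guards against overflow. The last condition says that every completion of the address
  \<open>i\<close> by the remaining \<open>e - 1\<close> bits falls among the \<open>M\<close> input
  cells.\<close>

definition item_ok :: "nat \<Rightarrow> nat \<Rightarrow> nat \<Rightarrow> item \<Rightarrow> bool" where
  "item_ok B M P = (\<lambda>(k, e, c, i). k \<le> B \<and> e \<le> B \<and> c < 2 * P \<and> i < M \<and> (0 < e \<longrightarrow> (i + 1) * 2 ^ (e - 1) \<le> M))"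

lemma item_ok_step:
  assumes "(i + 1) * 2 ^ (e - 1) \<le> (M::nat)" "2 \<le> e" "b \<le> 1"
  shows "(i * 2 + b + 1) * 2 ^ (e - 1 - 1) \<le> M" "i * 2 + b < M"
proof -
  obtain d where e: "e = Suc (Suc d)" using le_Suc_ex[OF assms(2)] by auto
  have "(i * 2 + b + 1) * 2 ^ d \<le> ((i + 1) * 2) * 2 ^ d" using assms(3) by (intro mult_le_mono1) simp
  also have "\<dots> = (i + 1) * 2 ^ (e - 1)" by (simp add: e)
  finally show *: "(i * 2 + b + 1) * 2 ^ (e - 1 - 1) \<le> M" using assms(1) by (simp add: e)
  have "(i * 2 + b + 1) * 1 \<le> (i * 2 + b + 1) * 2 ^ (e - 1 - 1)" by (rule mult_le_mono2) simp
  then have "(i * 2 + b + 1) * 1 \<le> M" using * by (rule le_trans)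
  then show "i * 2 + b < M" by simp
qed

lemma item_ok_expand:
  assumes "item_ok B M P it" "expand \<mu> P L full cells it = Some (l, r)" "L \<le> B" "\<mu> + 2 * P \<le> B"
  shows "item_ok B M P l \<and> item_ok B M P r"
proof -
  obtain k e c i where it: "it = (k, e, c, i)" by (cases it)
  have a: "k \<le> B" "e \<le> B" "c < 2 * P" "i < M" "0 < e \<Longrightarrow> (i + 1) * 2 ^ (e - 1) \<le> M"
    using assms(1) by (auto simp: it item_ok_def)
  have half: "x div 2 \<le> B" if "x \<le> B" for x :: nat using that by (meson div_le_dividend le_trans)
  have c2: "c div 2 < P" using a(3) by (simp add: less_mult_imp_div_less mult.commute)
  have zero: "item_ok B M P (x, 0, 0, 0)" if "x \<le> B" for x using that a c2 by (simp add: item_ok_def)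
  consider (bal) "e = 0" | (stem) "0 < e" "0 < k" | (leaf) "e = 1" "k = 0"
    | (E) "2 \<le> e" "k = 0" "e mod 2 = 1" | (M) "2 \<le> e" "k = 0" "e mod 2 = 0"
    by (metis One_nat_def Suc_1 Suc_leI bot_nat_0.not_eq_extremum mod2_eq_if le_eq_less_or_eq less_2_cases_iff not_less)
  then show ?thesis
  proof cases
    case bal
    then have "l = (k div 2, 0, 0, 0)" "r = ((k - 1) div 2, 0, 0, 0)"
      using assms(2) by (auto simp: it expand_def split: if_splits)
    then show ?thesis using zero half a(1) by simp
  next
    case stem
    then have "l = (0, 0, 0, 0)" "r = (k - 1, e, c, i)" using assms(2) by (auto simp: it expand_def)
    then show ?thesis using zero[of 0] a by (simp add: item_ok_def)
  next
    case leaf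
    then have "l = (L div 2, 0, 0, 0)" "r = ((L - 1) div 2, 0, 0, 0)"
      using assms(2) by (auto simp: it expand_def split: if_splits)
    then show ?thesis using zero half assms(3) by simp
  next
    case E
    note st = item_ok_step[OF a(5) E(1), of 0] item_ok_step[OF a(5) E(1), of 1]
    have "l = (\<mu> + c div 2 - 1, e - 1, c div 2, i * 2)" "r = (\<mu> + (c div 2 + P) - 1, e - 1, c div 2 + P, i * 2 + 1)"
      using assms(2) E by (auto simp: it expand_def)
    moreover have "\<mu> + c div 2 - 1 \<le> B" "\<mu> + (c div 2 + P) - 1 \<le> B" "e - 1 \<le> B" using assms(4) c2 a by simp_all
    ultimately show ?thesis using st E(1) c2 by (simp add: item_ok_def)
  next
    case M
    note st = item_ok_step[OF a(5) M(1), of 0] item_ok_step[OF a(5) M(1), of 1]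
    have lr: "l = (if full then (\<mu> - 1, e - 1, c, i * 2) else (0, 0, 0, 0))" "r = (\<mu> - 1, e - 1, c, i * 2 + 1)"
      using assms(2) M by (auto simp: it expand_def)
    have "\<mu> - 1 \<le> B" "e - 1 \<le> B" using assms(4) a by simp_all
    then have "item_ok B M P (\<mu> - 1, e - 1, c, i * 2)" "item_ok B M P (\<mu> - 1, e - 1, c, i * 2 + 1)"
      using st M(1) a by (simp_all add: item_ok_def)
    then show ?thesis using lr zero[of 0] by simp
  qed
qed

lemma item_ok_bounds: "item_ok B M P it \<Longrightarrow> M \<le> B \<Longrightarrow> 2 * P \<le> B \<Longrightarrow> fst it \<le> B \<and> fst (snd it) \<le> B \<and> fst (snd (snd it)) \<le> B \<and> snd (snd (snd it)) \<le> B"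
  by (cases it) (auto simp: item_ok_def)

lemma same_frame_refl [simp]: "same_frame s s"
  by (simp add: same_frame_def)

lemma same_frame_trans: "same_frame s s' \<Longrightarrow> same_frame s' s'' \<Longrightarrow> same_frame s s''"
  by (simp add: same_frame_def)

lemma stack_step_spec:
  fixes full :: bool
  assumes st: "stack_is s (st @ [it])" and ok: "item_ok B M P it"
    and p: "regs s 2 = L" "regs s 3 = P" "regs s 4 = \<mu>" and arr: "arr \<in> {0, 1}"
    and B: "B < 2 ^ w" "M \<le> B" "L \<le> B" "\<mu> + 2 * P \<le> B" "length st + 2 \<le> B" "\<And>m. arrays s arr m \<le> 1"
  defines "s' \<equiv> run (stack_step arr full) s"
  shows "fits w (stack_step arr full) s \<and> same_frame s s' \<and>
    (case expand \<mu> P L full (arrays s arr) it of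
      None \<Rightarrow> stack_is s' st \<and> written s' = written s @ [0]
    | Some (l, r) \<Rightarrow> stack_is s' (st @ [r, l]) \<and> written s' = written s @ [1])"
proof -
  obtain k e c i where it: "it = (k, e, c, i)" by (cases it)
  have a: "k \<le> B" "e \<le> B" "c < 2 * P" "i < M" "0 < e \<Longrightarrow> (i + 1) * 2 ^ (e - 1) \<le> M"
    using ok by (auto simp: it item_ok_def)
  have kw: "length st < 2 ^ w" "k < 2 ^ w" "e < 2 ^ w" "c < 2 ^ w" "i < 2 ^ w" "(1::nat) < 2 ^ w" "L < 2 ^ w"
    using a B by linarith+
  define s1 where "s1 = run pop_item s"
  note pop = pop_item_spec[OF st[unfolded it] kw(1-5), folded s1_def]
  have fr1: "regs s1 2 = L" "regs s1 3 = P" "regs s1 4 = \<mu>" "arrays s1 arr = arrays s arr"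
    using pop(3) p arr by (auto simp: same_frame_def)
  define s2 where "s2 = run (expand_item arr full) s1"
  have aw: "arrays s1 arr i < 2 ^ w" using B(6)[of i] fr1(4) kw(6) by (metis le_less_trans)
  have c2: "c div 2 < P" using a(3) by (simp add: less_mult_imp_div_less mult.commute)
  have ew: "i * 2 + 1 < 2 ^ w" if "2 \<le> e"
    using item_ok_step(2)[of i e M 1] a(5) that B by linarith
  have mw: "\<mu> + (c div 2 + P) < 2 ^ w" using c2 B by linarith
  note ex = expand_item_spec[OF pop(5-8) fr1(1-3) kw(6) kw(2-5,7) aw ew mw, where full = full, folded s2_def]
  have st2: "stack_is s2 st" using pop(2) ex(3,4) by (simp add: stack_is_def)
  have f2: "same_frame s s2" using pop(3) ex(3,4) by (simp add: same_frame_def)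
  have s': "s' = run emit_item s2" by (simp add: s'_def stack_step_def s1_def s2_def)
  have fit: "fits w (stack_step arr full) s \<longleftrightarrow> fits w emit_item s2"
    using pop(1) ex(1) by (simp add: stack_step_def s1_def s2_def)
  show ?thesis
  proof (cases "expand \<mu> P L full (arrays s arr) it")
    case None
    then have "regs s2 14 = 0" using ex(5) fr1(4) it by simp
    then show ?thesis
      using None st2 f2 pop(4) ex(2) unfolding fit unfolding s'
      by (simp add: emit_item_def stack_is_def same_frame_def)
  next
    case (Some lr)
    obtain l r where lr: "lr = (l, r)" by (cases lr)
    have e2: "regs s2 14 = 1" "(regs s2 20, regs s2 21, regs s2 22, regs s2 23) = l"
      "(regs s2 30, regs s2 31, regs s2 32, regs s2 33) = r"
      using ex(5) fr1(4) it Some lr by auto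
    have "item_ok B M P l \<and> item_ok B M P r" using item_ok_expand[OF ok] Some lr B by blast
    then have rw: "\<forall>q\<in>{20, 21, 22, 23, 30, 31, 32, 33}. regs s2 q < 2 ^ w"
      using item_ok_bounds[of B M P l] item_ok_bounds[of B M P r] e2 B by auto
    define s3 where "s3 = run (Write (Const 1)) s2"
    have s3: "stack_is s3 st" "same_frame s s3" "\<And>q. regs s3 q = regs s2 q" "written s3 = written s @ [1]"
      using st2 f2 pop(4) ex(2) by (simp_all add: s3_def stack_is_def same_frame_def)
    define s4 where "s4 = run (push_item 30 31 32 33) s3"
    have l1: "length st + 1 < 2 ^ w" "length (st @ [r]) + 1 < 2 ^ w" using B by simp_all
    have "\<forall>q\<in>{30, 31, 32, 33}. regs s3 q < 2 ^ w" using rw s3(3) by simp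
    note p1 = push_item_spec[OF s3(1) l1(1) this, folded s4_def, simplified]
    have s4: "stack_is s4 (st @ [r])" using p1(2) e2(3) s3(3) by simp
    have "\<forall>q\<in>{20, 21, 22, 23}. regs s4 q < 2 ^ w" using rw s3(3) p1(5) by simp
    note p2 = push_item_spec[OF s4 l1(2) this, simplified]
    have s5: "s' = run (push_item 20 21 22 23) s4"
      using e2(1) by (simp add: s' emit_item_def s3_def s4_def)
    have "(regs s4 20, regs s4 21, regs s4 22, regs s4 23) = l" using e2(2) s3(3) p1(5) by simp
    then have "stack_is s' (st @ [r, l])" using p2(2) by (simp add: s5)
    moreover have "written s' = written s @ [1]" using p2(4) p1(4) s3(4) by (simp add: s5)
    moreover have "same_frame s s'" using same_frame_trans s3(2) p1(3) p2(3) unfolding s5 by blast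
    moreover have "fits w emit_item s2" using e2(1) kw(6) p1(1) p2(1) by (simp add: emit_item_def s3_def s4_def)
    ultimately show ?thesis using Some lr fit by simp
  qed
qed

lemma cost_stack_step: "cost (stack_step arr full) \<le> 100"
  by (simp add: stack_step_def pop_item_def expand_item_def clear_items_def halve_item_def emit_item_def push_item_def)

text \<open>The number of iterations left: the code of a tree with \<open>m\<close> nodes has
  \<open>2 * m + 1\<close> entries, and each iteration writes one.\<close>

definition stack_size :: "(item \<Rightarrow> unit tree) \<Rightarrow> item list \<Rightarrow> nat" where
  "stack_size tr st = sum_list (map (\<lambda>it. 2 * size (tr it) + 1) st)"

lemma length_le_stack_size: "length st \<le> stack_size tr st"
  by (induction st) (auto simp: stack_size_def)

text \<open>The output so far, followed by the codes of the pending trees from the top of the stack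
  down, never changes, while \<open>stack_size\<close> drops by one per iteration. It also bounds
  the height of the stack.\<close>

lemma stack_loop:
  fixes full :: bool
  assumes st: "stack_is s st" and ok: "\<forall>it\<in>set st. item_ok B M P it"
    and p: "regs s 2 = L" "regs s 3 = P" "regs s 4 = \<mu>" and arr: "arr \<in> {0, 1}" and L: "0 < L"
    and B: "B < 2 ^ w" "M \<le> B" "L \<le> B" "\<mu> + 2 * P \<le> B" "\<And>m. arrays s arr m \<le> 1"
  defines "tr \<equiv> tree_of \<mu> P L full (arrays s arr)"
  assumes size: "stack_size tr st + 2 \<le> B"
  shows "\<exists>k s'. exec w (While (Less (Const 0) (Reg 5)) (stack_step arr full)) s k s' \<and>
    k \<le> 101 * stack_size tr st + 1 \<and> same_frame s s' \<and>
    written s' = written s @ concat (map (\<lambda>it. encode_tree (tr it)) (rev st))"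
proof -
  define target where "target = written s @ concat (map (\<lambda>it. encode_tree (tr it)) (rev st))"
  define I where "I m z \<longleftrightarrow> (\<exists>st. stack_is z st \<and> (\<forall>it\<in>set st. item_ok B M P it) \<and> same_frame s z \<and>
    written z @ concat (map (\<lambda>it. encode_tree (tr it)) (rev st)) = target \<and> stack_size tr st = m \<and> m + 2 \<le> B)" for m z
  have "\<exists>k s'. exec w (While (Less (Const 0) (Reg 5)) (stack_step arr full)) s k s' \<and>
      k \<le> stack_size tr st * (cost (stack_step arr full) + 1) + 1 \<and> I 0 s'"
  proof (rule exec_fits_while)
    fix m z assume "I (Suc m) z"
    then obtain st' where z: "stack_is z st'" "\<forall>it\<in>set st'. item_ok B M P it" "same_frame s z"
      "written z @ concat (map (\<lambda>it. encode_tree (tr it)) (rev st')) = target" "stack_size tr st' = Suc m" "Suc m + 2 \<le> B"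
      by (auto simp: I_def)
    then have "st' \<noteq> []" by (auto simp: stack_size_def)
    then obtain st0 it where st': "st' = st0 @ [it]" by (metis rev_exhaust)
    have fr: "regs z 2 = L" "regs z 3 = P" "regs z 4 = \<mu>" "arrays z arr = arrays s arr"
      using z(3) p arr by (auto simp: same_frame_def)
    have okit: "item_ok B M P it" "\<forall>it\<in>set st0. item_ok B M P it" using z(2) st' by auto
    have len: "length st0 + 2 \<le> B" using length_le_stack_size[of st' tr] z(5,6) st' by simp
    note sp = stack_step_spec[OF z(1)[unfolded st'] okit(1) fr(1-3) arr B(1-4) len, where full = full, unfolded fr(4), OF B(5)]
    have ss: "stack_size tr (a @ b) = stack_size tr a + stack_size tr b" for a b by (simp add: stack_size_def)
    have t: "test_val (Less (Const 0) (Reg 5)) z" using z(1) st' by (simp add: stack_is_def)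
    have "I m (run (stack_step arr full) z)"
    proof (cases "expand \<mu> P L full (arrays s arr) it")
      case None
      then have leaf: "tr it = Leaf" using tree_of_expand[OF L] by (simp add: tr_def)
      have "stack_size tr st0 = m" using z(5) leaf by (simp add: st' ss) (simp add: stack_size_def)
      then show ?thesis
        unfolding I_def using sp None okit z leaf st' same_frame_trans
        by (intro exI[of _ st0]) auto
    next
      case (Some lr)
      obtain l r where lr: "lr = (l, r)" by (cases lr)
      have node: "tr it = Node (tr l) () (tr r)"
        using tree_of_expand[OF L, of \<mu> P full "arrays s arr" it] Some lr by (simp add: tr_def)
      have "item_ok B M P l \<and> item_ok B M P r" using item_ok_expand[OF okit(1)] Some lr B by blast
      moreover have "stack_size tr (st0 @ [r, l]) = m"
        using z(5) node by (simp add: st' ss) (simp add: stack_size_def)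
      ultimately show ?thesis
        unfolding I_def using sp Some lr okit z node st' same_frame_trans
        by (intro exI[of _ "st0 @ [r, l]"]) auto
    qed
    then show "test_val (Less (Const 0) (Reg 5)) z \<and> fits w (stack_step arr full) z \<and> I m (run (stack_step arr full) z)"
      using t sp by blast
  next
    fix z assume "I 0 z"
    then obtain st' where "stack_is z st'" "stack_size tr st' = 0" by (auto simp: I_def)
    then show "\<not> test_val (Less (Const 0) (Reg 5)) z"
      using length_le_stack_size[of st' tr] by (simp add: stack_is_def)
  next
    show "I (stack_size tr st) s" unfolding I_def using st ok size target_def by auto
  qed
  then obtain k s' where k: "exec w (While (Less (Const 0) (Reg 5)) (stack_step arr full)) s k s'"
    "k \<le> stack_size tr st * (cost (stack_step arr full) + 1) + 1" "I 0 s'" by blast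
  obtain st' where st': "stack_size tr st' = 0" "same_frame s s'"
    "written s' @ concat (map (\<lambda>it. encode_tree (tr it)) (rev st')) = target" using k(3) by (auto simp: I_def)
  have "st' = []" using length_le_stack_size[of st' tr] st'(1) by simp
  moreover have "stack_size tr st * (cost (stack_step arr full) + 1) \<le> stack_size tr st * 101"
    using cost_stack_step[of arr full] by (intro mult_le_mono2) simp
  ultimately have "k \<le> 101 * stack_size tr st + 1" using k(2) by linarith
  then show ?thesis using k(1) st' \<open>st' = []\<close> by (intro exI[of _ k] exI[of _ s']) (simp add: target_def)
qed

text \<open>The last tensor is pushed first, so the trees come out in the order of the
  input.\<close>

definition fill_stack :: com where
  "fill_stack = (Assign 5 (Atom (Const 0)) ;; Assign 6 (Atom (Reg 1))) ;;
     While (Less (Const 0) (Reg 6)) (Assign 6 (Arith Minus (Reg 6) (Const 1)) ;; push_item 7 8 3 6)"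

lemma exec_Seq_ex:
  "\<exists>k s'. exec w P s k s' \<and> k \<le> a \<and> Q s' \<Longrightarrow> (\<And>s'. Q s' \<Longrightarrow> \<exists>k s''. exec w P' s' k s'' \<and> k \<le> b \<and> R s'') \<Longrightarrow>
   \<exists>k s''. exec w (P ;; P') s k s'' \<and> k \<le> a + b \<and> R s''"
  by (meson add_mono exec.Seq)

lemma exec_ex_mono:
  "\<exists>k s'. exec w P s k s' \<and> k \<le> a \<and> Q s' \<Longrightarrow> a \<le> b \<Longrightarrow> \<exists>k s'. exec w P s k s' \<and> k \<le> b \<and> Q s'"
  by (meson le_trans)

lemma exec_run_ex: "fits w P s \<Longrightarrow> Q (run P s) \<Longrightarrow> cost P \<le> a \<Longrightarrow> \<exists>k s'. exec w P s k s' \<and> k \<le> a \<and> Q s'"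
  by (meson exec_run le_trans)

lemma fill_stack_spec:
  assumes r: "regs s 1 = N" "regs s 3 = P" "regs s 7 = k0" "regs s 8 = e0"
    and w: "N + 1 < 2 ^ w" "P < 2 ^ w" "k0 < 2 ^ w" "e0 < 2 ^ w"
  shows "\<exists>k s'. exec w fill_stack s k s' \<and> k \<le> 2 + (7 * N + 1) \<and> same_frame s s' \<and> written s' = written s \<and>
    stack_is s' (map (\<lambda>v. (k0, e0, P, v)) (rev [0..<N]))"
proof -
  let ?init = "Assign 5 (Atom (Const 0)) ;; Assign 6 (Atom (Reg 1))"
  let ?body = "Assign 6 (Arith Minus (Reg 6) (Const 1)) ;; push_item 7 8 3 6"
  define I where "I m z \<longleftrightarrow> regs z 6 = m \<and> m \<le> N \<and> same_frame s z \<and> written z = written s \<and>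
     stack_is z (map (\<lambda>v. (k0, e0, P, v)) (rev [m..<N]))" for m z
  have loop: "\<exists>k s'. exec w (While (Less (Const 0) (Reg 6)) ?body) z k s' \<and> k \<le> N * (cost ?body + 1) + 1 \<and> I 0 s'"
    if "I N z" for z
  proof (rule exec_fits_while[where I = I])
    fix m z assume I: "I (Suc m) z"
    define z1 where "z1 = run (Assign 6 (Arith Minus (Reg 6) (Const 1))) z"
    let ?st = "map (\<lambda>v. (k0, e0, P, v)) (rev [Suc m..<N])"
    have z1: "regs z1 6 = m" "same_frame s z1" "written z1 = written s" "stack_is z1 ?st"
      "regs z1 7 = k0" "regs z1 8 = e0" "regs z1 3 = P"
      using I r by (auto simp: I_def z1_def same_frame_def stack_is_def)
    have len: "length ?st + 1 < 2 ^ w" and mw: "m < 2 ^ w" using w(1) I by (auto simp: I_def)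
    have "\<forall>q\<in>{7, 8, 3, 6}. regs z1 q < 2 ^ w" using z1 w mw by simp
    note ps = push_item_spec[OF z1(4) len this, simplified]
    have "rev [m..<N] = rev [Suc m..<N] @ [m]" using I by (simp add: I_def upt_conv_Cons)
    then have "stack_is (run (push_item 7 8 3 6) z1) (map (\<lambda>v. (k0, e0, P, v)) (rev [m..<N]))"
      using ps(2) z1 by simp
    moreover have "same_frame s (run (push_item 7 8 3 6) z1)" using z1(2) ps(3) by (rule same_frame_trans)
    ultimately have "I m (run (push_item 7 8 3 6) z1)" using ps(4,5) z1 I by (simp add: I_def)
    moreover have "fits w ?body z" using ps(1) mw I by (simp add: z1_def I_def)
    ultimately show "test_val (Less (Const 0) (Reg 6)) z \<and> fits w ?body z \<and> I m (run ?body z)"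
      using I by (simp add: z1_def I_def)
  qed (use that in \<open>auto simp: I_def\<close>)
  have "\<exists>k s'. exec w fill_stack s k s' \<and> k \<le> 2 + (7 * N + 1) \<and> I 0 s'"
    unfolding fill_stack_def
  proof (rule exec_Seq_ex[where Q = "I N"])
    show "\<exists>k s'. exec w ?init s k s' \<and> k \<le> 2 \<and> I N s'"
      by (rule exec_run_ex) (use r w in \<open>auto simp: I_def same_frame_def stack_is_def\<close>)
    show "\<exists>k s'. exec w (While (Less (Const 0) (Reg 6)) ?body) z k s' \<and> k \<le> 7 * N + 1 \<and> I 0 s'" if "I N z" for z
      by (rule exec_ex_mono[OF loop[OF that]]) (simp add: push_item_def)
  qed
  then show ?thesis unfolding I_def by auto
qed


section \<open>Addresses of tensor entries\<close>

abbreviation binary :: "nat \<Rightarrow> bool list \<Rightarrow> nat" where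
  "binary \<equiv> foldl (\<lambda>m b. 2 * m + of_bool b)"

lemma binary_eq: "binary u j = u * 2 ^ length j + binary 0 j"
proof (induction j arbitrary: u)
  case (Cons b j)
  show ?case using Cons[of "2 * u + of_bool b"] Cons[of "of_bool b"] by (simp add: algebra_simps)
qed simp

lemma binary_less: "binary 0 j < 2 ^ length j"
proof (induction j)
  case (Cons b j)
  then show ?case using binary_eq[of "of_bool b" j] by (cases b) auto
qed simp

lemma length_indices [simp]: "length (indices t) = 2 ^ t"
  by (induction t) auto

lemma indices_nth: "length j = t \<Longrightarrow> indices t ! binary 0 j = j"
proof (induction j arbitrary: t)
  case (Cons b j)
  then have t: "t = Suc (length j)" by simp
  have "binary 0 j < 2 ^ length j" by (rule binary_less)
  then show ?case
    using Cons.IH[of "length j"] binary_eq[of "of_bool b" j] unfolding t by (cases b) (auto simp: nth_append)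
qed auto

text \<open>Lexicographic order of indices is numerical order of their binary values, so the array
  address of an entry arises by appending the bits of \<open>j\<close> to the tensor number
  \<open>u\<close>.\<close>

lemma tensor_cells_nth:
  assumes "u < length xs" "length j = t"
  shows "binary u j < length (tensor_cells t xs)" "tensor_cells t xs ! binary u j = (xs ! u) j"
proof -
  have len: "length (tensor_cells t xs) = length xs * 2 ^ t" for xs
    by (induction xs) (auto simp: tensor_cells_def)
  have lt: "binary 0 j < 2 ^ t" using binary_less[of j] assms(2) by simp
  have b: "binary u j = u * 2 ^ t + binary 0 j" using binary_eq[of u j] assms(2) by simp
  have "u * 2 ^ t + binary 0 j < Suc u * 2 ^ t" using lt by simp
  also have "\<dots> \<le> length xs * 2 ^ t" using assms(1) by (intro mult_le_mono1) simp
  finally show "binary u j < length (tensor_cells t xs)" using b len by simp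
  have "tensor_cells t xs ! (u * 2 ^ t + binary 0 j) = (xs ! u) j" using assms(1)
  proof (induction xs arbitrary: u)
    case (Cons x xs)
    then show ?case
      using lt indices_nth[OF assms(2)] by (cases u) (auto simp: tensor_cells_def nth_append)
  qed simp
  then show "tensor_cells t xs ! binary u j = (xs ! u) j" using b by simp
qed

text \<open>\<open>P\<close> is found by doubling, \<open>bitlen L\<close> by halving, and
  \<open>gap P L\<close> from both. For \<open>t = 0\<close> the initial items denote
  \<open>balanced 1\<close>, which is the one-node tree; otherwise \<open>e = t + 1\<close> stands
  for a spine over all coordinates.\<close>

definition initialise :: com where
  "initialise =
     ((Assign 6 (Arith Div (Reg 0) (Const 2)) ;; Assign 3 (Atom (Const 1))) ;;
       While (Less (Const 0) (Reg 6)) (Assign 3 (Arith Times (Reg 3) (Const 2)) ;; Assign 6 (Arith Minus (Reg 6) (Const 1)))) ;;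
     ((Assign 6 (Atom (Reg 2)) ;; Assign 9 (Atom (Const 0))) ;;
       While (Less (Const 0) (Reg 6)) (Assign 6 (Arith Div (Reg 6) (Const 2)) ;; Assign 9 (Arith Plus (Reg 9) (Const 1)))) ;;
     (Assign 4 (Arith Times (Reg 3) (Const 4)) ;; Assign 9 (Arith Times (Reg 9) (Const 2)) ;;
      Assign 9 (Arith Div (Reg 9) (Reg 4)) ;; Assign 9 (Arith Plus (Reg 9) (Const 1)) ;;
      Assign 4 (Arith Times (Reg 4) (Reg 9)) ;;
      Cond (Equal (Reg 0) (Const 0))
        (Assign 7 (Atom (Const 1)) ;; Assign 8 (Atom (Const 0)))
        (Assign 7 (Atom (Const 0)) ;; Assign 8 (Arith Plus (Reg 0) (Const 1))))"

definition initialised :: "nat \<Rightarrow> nat \<Rightarrow> nat \<Rightarrow> state \<Rightarrow> bool" where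
  "initialised t N L s \<longleftrightarrow> regs s 0 = t \<and> regs s 1 = N \<and> regs s 2 = L \<and> regs s 3 = 2 ^ (t div 2) \<and>
     regs s 4 = gap (2 ^ (t div 2)) L \<and> regs s 7 = (if t = 0 then 1 else 0) \<and> regs s 8 = (if t = 0 then 0 else t + 1)"

lemma bitlen_half: "0 < m \<Longrightarrow> bitlen m = Suc (bitlen (m div 2))"
  by (cases m) simp_all

lemma initialise_spec:
  assumes r: "regs s 0 = t" "regs s 1 = N" "regs s 2 = L" and tL: "2 ^ t \<le> L" and w: "10 * L < 2 ^ w"
  shows "\<exists>k s'. exec w initialise s k s' \<and> k \<le> (2 + (3 * L + 1)) + ((2 + (3 * L + 1)) + 12) \<and>
    initialised t N L s' \<and> arrays s' = arrays s \<and> written s' = written s"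
proof -
  let ?P = "2 ^ (t div 2) :: nat"
  have tL': "t < L" using less_exp[of t] tL by (rule less_le_trans)
  have PL: "?P \<le> L" using half_power_le[of t] tL by (rule le_trans)
  define keep where "keep z \<longleftrightarrow> regs z 0 = t \<and> regs z (Suc 0) = N \<and> regs z 2 = L \<and> arrays z = arrays s \<and> written z = written s" for z :: state
  let ?b1 = "Assign 3 (Arith Times (Reg 3) (Const 2)) ;; Assign 6 (Arith Minus (Reg 6) (Const 1))"
  define I1 where "I1 m z \<longleftrightarrow> keep z \<and> regs z 6 = m \<and> regs z 3 * 2 ^ m = ?P" for m z
  have l1: "\<exists>k s'. exec w (While (Less (Const 0) (Reg 6)) ?b1) z k s' \<and> k \<le> t div 2 * (cost ?b1 + 1) + 1 \<and> I1 0 s'"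
    if "I1 (t div 2) z" for z
  proof (rule exec_fits_while[where I = I1])
    fix m z assume I: "I1 (Suc m) z"
    then have eq: "(regs z 3 * 2) * 2 ^ m = ?P" by (simp add: I1_def)
    have "regs z 3 * 2 \<le> (regs z 3 * 2) * 2 ^ m" using mult_le_mono2[of 1 "2 ^ m" "regs z 3 * 2"] by simp
    then have "regs z 3 * 2 \<le> L" using eq PL by linarith
    moreover have "m < 2 ^ m" by (rule less_exp)
    moreover have "0 < regs z 3 * 2" using eq by (metis gr0I mult_0 power_eq_0_iff zero_neq_numeral)
    then have "(2::nat) ^ m \<le> ?P" using eq by (metis One_nat_def Suc_leI mult_le_mono1 nat_mult_1)
    ultimately have "regs z 3 * 2 < 2 ^ w" "m < 2 ^ w" using PL w by linarith+
    then show "test_val (Less (Const 0) (Reg 6)) z \<and> fits w ?b1 z \<and> I1 m (run ?b1 z)"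
      using I eq by (simp add: I1_def keep_def)
  qed (use that in \<open>auto simp: I1_def\<close>)
  let ?b2 = "Assign 6 (Arith Div (Reg 6) (Const 2)) ;; Assign 9 (Arith Plus (Reg 9) (Const 1))"
  define I2 where "I2 m z \<longleftrightarrow> keep z \<and> regs z 3 = ?P \<and> bitlen (regs z 6) = m \<and> regs z 6 \<le> L \<and> regs z 9 + m = bitlen L" for m z
  have l2: "\<exists>k s'. exec w (While (Less (Const 0) (Reg 6)) ?b2) z k s' \<and> k \<le> bitlen L * (cost ?b2 + 1) + 1 \<and> I2 0 s'"
    if "I2 (bitlen L) z" for z
  proof (rule exec_fits_while[where I = I2])
    fix m z assume I: "I2 (Suc m) z"
    then have pos: "0 < regs z 6" by (auto simp: I2_def intro: gr0I)
    have "regs z 6 div 2 < 2 ^ w" "regs z 9 + 1 < 2 ^ w" "regs z 6 div 2 \<le> L"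
      using I w bitlen_le[of L] by (auto simp: I2_def)
    then show "test_val (Less (Const 0) (Reg 6)) z \<and> fits w ?b2 z \<and> I2 m (run ?b2 z)"
      using I pos bitlen_half[OF pos] by (simp add: I2_def keep_def)
  next
    fix z assume "I2 0 z"
    then have "regs z 6 = 0" using bitlen_half[of "regs z 6"] by (auto simp: I2_def intro: gr0I)
    then show "\<not> test_val (Less (Const 0) (Reg 6)) z" by simp
  qed (use that in \<open>auto simp: I2_def\<close>)
  show ?thesis unfolding initialise_def
  proof (rule exec_Seq_ex[where Q = "I1 0"], goal_cases)
    case 1
    show ?case
    proof (rule exec_Seq_ex[where Q = "I1 (t div 2)"], goal_cases)
      case 1
      show ?case
        by (rule exec_run_ex) (use r w tL' in \<open>auto simp: I1_def keep_def\<close>)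
    next
      case (2 z)
      show ?case by (rule exec_ex_mono[OF l1[OF 2]]) (use tL' in simp)
    qed
  next
    case (2 z)
    show ?case
    proof (rule exec_Seq_ex[where Q = "I2 0"], goal_cases)
      case 1
      show ?case
      proof (rule exec_Seq_ex[where Q = "I2 (bitlen L)"], goal_cases)
        case 1
        show ?case
          by (rule exec_run_ex) (use 2 w in \<open>auto simp: I2_def I1_def keep_def\<close>)
      next
        case (2 z)
        show ?case by (rule exec_ex_mono[OF l2[OF 2]]) (use bitlen_le[of L] in simp)
      qed
    next
      case (2 z)
      then have z: "regs z 0 = t" "regs z (Suc 0) = N" "regs z 2 = L" "regs z 3 = ?P" "regs z 9 = bitlen L"
        "arrays z = arrays s" "written z = written s"
        by (auto simp: I2_def keep_def)
      have g: "4 * ?P * (2 * bitlen L div (4 * ?P) + 1) \<le> 4 * ?P + 2 * bitlen L"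
        using gap_bounds(3)[of ?P L] by (simp add: gap_def)
      have "2 * bitlen L div (4 * ?P) \<le> 2 * bitlen L" by (rule div_le_dividend)
      then have b: "4 * ?P < 2 ^ w" "2 * bitlen L < 2 ^ w" "2 * bitlen L div (4 * ?P) + 1 < 2 ^ w"
        "4 * ?P * (2 * bitlen L div (4 * ?P) + 1) < 2 ^ w" "2 * bitlen L div (4 * ?P) < 2 ^ w" "t + 1 < 2 ^ w" "(1::nat) < 2 ^ w"
        using g PL bitlen_le[of L] w tL' by linarith+
      show ?case
        by (rule exec_run_ex)
          (use z b in \<open>auto simp: initialised_def gap_def mult.commute mult.left_commute\<close>)
    qed
  qed
qed

section \<open>Correctness and running time of the whole program\<close>

definition emit_trees :: "nat \<Rightarrow> bool \<Rightarrow> com" where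
  "emit_trees arr full = fill_stack ;; While (Less (Const 0) (Reg 5)) (stack_step arr full)"

lemma emit_trees_spec:
  fixes full :: bool
  assumes init: "initialised t N L s" and N: "1 \<le> N" and L: "2 ^ t \<le> L" and xs: "length xs = N"
    and arr: "arr \<in> {0, 1}" and cells: "\<And>m. arrays s arr m \<le> 1"
      "\<And>u j. u < N \<Longrightarrow> length j = t \<Longrightarrow> arrays s arr (binary u j) = (xs ! u) j"
    and w: "40 * (N * 2 ^ t * L) < 2 ^ w"
  shows "\<exists>k s'. exec w (emit_trees arr full) s k s' \<and> k \<le> (2 + (7 * N + 1)) + (3737 * (N * 2 ^ t * L) + 1) \<and>
    same_frame s s' \<and> written s' = written s @ concat (map encode_tree (map (gadget_tree full t L) xs))"
proof -
  let ?P = "2 ^ (t div 2) :: nat" and ?X = "N * 2 ^ t * L"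
  define k0 where "k0 = (if t = 0 then 1 else 0 :: nat)"
  define e0 where "e0 = (if t = 0 then 0 else t + 1)"
  define \<mu> where "\<mu> = gap ?P L"
  \<comment> \<open>A tree has at most \<open>18 * 2 ^ t * L\<close> nodes and hence a code of
    length at most \<open>37 * 2 ^ t * L\<close>; the 2 is the margin that \<open>stack_loop\<close>
    requires.\<close>
  define B where "B = 37 * ?X + 2"
  define st where "st = map (\<lambda>v. (k0, e0, ?P, v)) (rev [0..<N])"
  define tr where "tr = tree_of \<mu> ?P L full (arrays s arr)"
  have L0: "0 < L" using L by (metis gr0I le_zero_eq power_eq_0_iff zero_neq_numeral)
  have tL: "t < L" using less_exp[of t] L by (rule less_le_trans)
  have PL: "?P \<le> L" using half_power_le[of t] L by (rule le_trans)
  have LX: "L \<le> ?X" "N * 2 ^ t \<le> ?X" using N L0 by simp_all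
  have NX: "N \<le> N * 2 ^ t" by simp
  have X0: "1 \<le> ?X" using LX(1) L0 by linarith
  have \<mu>8: "\<mu> + 2 * ?P \<le> 8 * L" using gap_bounds(3)[of ?P L] PL bitlen_le[of L] by (simp add: \<mu>_def)
  have B: "B < 2 ^ w" "N * 2 ^ t \<le> B" "L \<le> B" "\<mu> + 2 * ?P \<le> B"
    using w X0 LX \<mu>8 unfolding B_def by linarith+
  have Pw: "N + 1 < 2 ^ w" "?P < 2 ^ w" "k0 < 2 ^ w" "e0 < 2 ^ w"
  proof -
    have "k0 \<le> 1" "e0 \<le> L" using tL by (simp_all add: k0_def e0_def)
    then show "N + 1 < 2 ^ w" "?P < 2 ^ w" "k0 < 2 ^ w" "e0 < 2 ^ w"
      using w X0 LX NX PL by linarith+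
  qed
  have tr_u: "tr (k0, e0, ?P, u) = gadget_tree full t L (xs ! u)" if "u < N" for u
  proof (cases "t = 0")
    case True
    then show ?thesis by (simp add: tr_def tree_of_def k0_def e0_def gadget_tree_def)
  next
    case False
    have "spine \<mu> ?P L full t ?P (\<lambda>j. arrays s arr (binary u j)) = spine \<mu> ?P L full t ?P (xs ! u)"
      by (rule spine_cong) (simp add: cells(2) that)
    then show ?thesis using False by (simp add: tr_def tree_of_def k0_def e0_def gadget_tree_def \<mu>_def)
  qed
  have "stack_size tr st = (\<Sum>u<N. 2 * size (gadget_tree full t L (xs ! u)) + 1)"
  proof -
    have "stack_size tr st = sum_list (map (\<lambda>u. 2 * size (tr (k0, e0, ?P, u)) + 1) [0..<N])"
      by (simp add: stack_size_def st_def rev_map[symmetric] sum_list_rev o_def flip: rev_map)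
    also have "\<dots> = (\<Sum>u<N. 2 * size (tr (k0, e0, ?P, u)) + 1)"
      by (simp add: interv_sum_list_conv_sum_set_nat atLeast0LessThan)
    finally show ?thesis using tr_u by simp
  qed
  also have "\<dots> \<le> (\<Sum>u<N. 37 * (2 ^ t * L))"
  proof (rule sum_mono)
    fix u
    have "1 \<le> 2 ^ t * L" using L0 by simp
    then show "2 * size (gadget_tree full t L (xs ! u)) + 1 \<le> 37 * (2 ^ t * L)"
      using size_gadget_tree[OF L, of full "xs ! u"] by (simp only: mult.assoc)
  qed
  also have "\<dots> = 37 * ?X" by (simp add: mult.assoc mult.left_commute)
  finally have size: "stack_size tr st \<le> 37 * ?X" .
  have ok: "\<forall>it\<in>set st. item_ok B (N * 2 ^ t) ?P it"
  proof
    fix it assume "it \<in> set st"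
    then obtain u where u: "it = (k0, e0, ?P, u)" "u < N" by (auto simp: st_def)
    have "(u + 1) * 2 ^ t \<le> N * 2 ^ t" using u(2) by (intro mult_le_mono1) simp
    moreover have "k0 \<le> B" "e0 \<le> B" using tL B(3) X0 by (auto simp: k0_def e0_def B_def)
    ultimately show "item_ok B (N * 2 ^ t) ?P it"
      using u less_le_trans[OF u(2) NX] by (auto simp: item_ok_def e0_def)
  qed
  have out: "concat (map (\<lambda>it. encode_tree (tr it)) (rev st)) = concat (map encode_tree (map (gadget_tree full t L) xs))"
  proof -
    have "map (\<lambda>it. encode_tree (tr it)) (rev st) = map (\<lambda>u. encode_tree (gadget_tree full t L (xs ! u))) [0..<N]"
      using tr_u by (simp add: st_def rev_map o_def)
    also have "\<dots> = map encode_tree (map (gadget_tree full t L) xs)"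
      using xs by (auto intro!: nth_equalityI)
    finally show ?thesis by simp
  qed
  show ?thesis unfolding emit_trees_def
  proof (rule exec_Seq_ex[where Q = "\<lambda>s'. same_frame s s' \<and> written s' = written s \<and> stack_is s' st"], goal_cases)
    case 1
    show ?case unfolding st_def
      by (rule fill_stack_spec) (use init Pw in \<open>auto simp: initialised_def k0_def e0_def\<close>)
  next
    case (2 z)
    then have z: "same_frame s z" "written z = written s" "stack_is z st" by auto
    have p: "regs z 2 = L" "regs z 3 = ?P" "regs z 4 = \<mu>" "arrays z arr = arrays s arr"
      using z(1) init arr by (auto simp: same_frame_def initialised_def \<mu>_def)
    have "\<exists>k s'. exec w (While (Less (Const 0) (Reg 5)) (stack_step arr full)) z k s' \<and>
      k \<le> 101 * stack_size tr st + 1 \<and> same_frame z s' \<and>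
      written s' = written z @ concat (map (\<lambda>it. encode_tree (tr it)) (rev st))"
      unfolding tr_def p(4)[symmetric]
      by (rule stack_loop[OF z(3) ok p(1-3) arr L0 B])
        (use cells(1) p(4) size in \<open>auto simp: B_def tr_def\<close>)
    then obtain k s' where k: "exec w (While (Less (Const 0) (Reg 5)) (stack_step arr full)) z k s'"
      "k \<le> 101 * stack_size tr st + 1" "same_frame z s'"
      "written s' = written z @ concat (map (\<lambda>it. encode_tree (tr it)) (rev st))" by blast
    have "101 * stack_size tr st + 1 \<le> 3737 * ?X + 1" using size by linarith
    with k(2) have "k \<le> 3737 * ?X + 1" by (rule le_trans)
    moreover have "written s' = written s @ concat (map encode_tree (map (gadget_tree full t L) xs))"
      using k(4) z(2) out by simp
    ultimately show ?case using k(1) same_frame_trans[OF z(1) k(3)] by blast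
  qed
qed

definition tree_program :: com where
  "tree_program = initialise ;; emit_trees 0 False ;; emit_trees 1 True"

lemma tree_program_spec:
  assumes N: "1 \<le> N" and L: "2 ^ t \<le> L" and xs: "length xs = N" "set xs \<subseteq> tensors t"
    and ys: "length ys = N" "set ys \<subseteq> tensors t" and w: "10000 * (N * 2 ^ t * L) \<le> 2 ^ w"
  shows "\<exists>k s'. exec w tree_program (input_state t N L xs ys) k s' \<and> k \<le> 10000 * (N * 2 ^ t * L) \<and>
    written s' = concat (map encode_tree (map (gadget_tree False t L) xs @ map (gadget_tree True t L) ys))"
proof -
  let ?s = "input_state t N L xs ys" and ?X = "N * 2 ^ t * L"
  have L0: "0 < L" using L by (metis gr0I le_zero_eq power_eq_0_iff zero_neq_numeral)
  have LX: "L \<le> ?X" "N \<le> ?X" using N L0 by simp_all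
  have X0: "1 \<le> ?X" using LX(1) L0 by linarith
  have w': "10 * L < 2 ^ w" "40 * ?X < 2 ^ w" using w LX X0 by linarith+
  have bit: "c \<le> 1" if "c \<in> set (tensor_cells t zs)" "set zs \<subseteq> tensors t" for c zs
  proof -
    from that(1) obtain x i where x: "x \<in> set zs" "i \<in> set (indices t)" "c = x i" by (auto simp: tensor_cells_def)
    have "length i = t" using x(2) by (induction t arbitrary: i) auto
    moreover have "x \<in> tensors t" using x(1) that(2) by blast
    ultimately have "x i \<in> {0, 1}" unfolding tensors_def by (intro PiE_mem[of x]) auto
    then show ?thesis using x(3) by auto
  qed
  have arr: "arrays ?s 0 m \<le> 1" "arrays ?s 1 m \<le> 1" for m
    using bit[OF nth_mem xs(2)] bit[OF nth_mem ys(2)] by (auto simp: input_state_def Let_def)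
  have cell: "arrays ?s 0 (binary u j) = (xs ! u) j" "arrays ?s 1 (binary u j) = (ys ! u) j"
    if "u < N" "length j = t" for u j
    using tensor_cells_nth[of u xs j t] tensor_cells_nth[of u ys j t] that xs(1) ys(1)
    by (auto simp: input_state_def Let_def)
  let ?b = "(2 + (7 * N + 1)) + (3737 * ?X + 1)"
  have "\<exists>k s'. exec w tree_program ?s k s' \<and> k \<le> ((2 + (3 * L + 1)) + ((2 + (3 * L + 1)) + 12)) + (?b + ?b) \<and>
    written s' = concat (map encode_tree (map (gadget_tree False t L) xs)) @
      concat (map encode_tree (map (gadget_tree True t L) ys))"
    unfolding tree_program_def
  proof (rule exec_Seq_ex[where Q = "\<lambda>z. initialised t N L z \<and> arrays z = arrays ?s \<and> written z = []"], goal_cases)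
    case 1
    show ?case
      using initialise_spec[of ?s t N L w] L w' by (simp add: input_state_def)
  next
    case (2 z)
    then have z: "initialised t N L z" "arrays z = arrays ?s" "written z = []" by auto
    show ?case
    proof (rule exec_Seq_ex[where Q = "\<lambda>z'. same_frame z z' \<and> written z' = concat (map encode_tree (map (gadget_tree False t L) xs))"], goal_cases)
      case 1
      have "\<exists>k s'. exec w (emit_trees 0 False) z k s' \<and> k \<le> ?b \<and> same_frame z s' \<and>
          written s' = written z @ concat (map encode_tree (map (gadget_tree False t L) xs))"
        by (rule emit_trees_spec[OF z(1) N L xs(1)]) (simp_all add: z(2) arr(1) cell(1) w'(2) del: One_nat_def)
      then show ?case by (simp only: z(3) append_Nil)
    next
      case (2 z')
      then have z': "initialised t N L z'" "arrays z' 1 = arrays ?s 1"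
        "written z' = concat (map encode_tree (map (gadget_tree False t L) xs))"
        using z by (auto simp: same_frame_def initialised_def)
      have "\<exists>k s'. exec w (emit_trees 1 True) z' k s' \<and> k \<le> ?b \<and> same_frame z' s' \<and>
          written s' = written z' @ concat (map encode_tree (map (gadget_tree True t L) ys))"
        by (rule emit_trees_spec[OF z'(1) N L ys(1)]) (simp_all add: z'(2) arr(2) cell(2) w'(2) del: One_nat_def)
      then show ?case unfolding z'(3) by blast
    qed
  qed
  \<comment> \<open>As \<open>L\<close>, \<open>N\<close> and 1 are at most \<open>?X\<close>, the
    sum is at most \<open>7520 * ?X\<close>.\<close>
  moreover have "((2 + (3 * L + 1)) + ((2 + (3 * L + 1)) + 12)) + (?b + ?b) \<le> 10000 * ?X"
    using LX X0 by linarith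
  ultimately show ?thesis unfolding map_append concat_append by (rule exec_ex_mono)
qed

theorem theorem8p5:
  "\<exists>(P :: com) (c :: nat) (k :: nat).
     \<forall>(t :: nat) (N :: nat) (L :: nat) (A :: tensor set) (B :: tensor set).
       even t \<and> 1 \<le> N \<and> 2 ^ t \<le> L \<and>
       A \<subseteq> tensors t \<and> card A = N \<and> B \<subseteq> tensors t \<and> card B = N \<and>
       (\<forall>a\<in>A. max_invariant t a) \<longrightarrow>
       (\<exists>(fA :: tensor \<Rightarrow> unit tree) (fB :: tensor \<Rightarrow> unit tree).
          (\<forall>xs ys w.
             distinct xs \<and> set xs = A \<and> distinct ys \<and> set ys = B \<and>
             c * (N * 2 ^ t * L) ^ k \<le> 2 ^ w \<longrightarrow>
             (\<exists>n s. exec w P (input_state t N L xs ys) n s \<and>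
                n \<le> c * N * (2 ^ t) ^ k * L \<and>
                written s = concat (map encode_tree (map fA xs @ map fB ys)))) \<and>
          (\<forall>T \<in> fA ` A \<union> fB ` B.
             T \<noteq> Leaf \<and>
             size T \<le> c * (2 ^ t) ^ k * L \<and>
             real (depth T) \<le> real c * ((2 ^ (t div 2) + log 2 (real L)) * real t)) \<and>
          (\<forall>a\<in>A. \<forall>b\<in>B.
             \<bar>real (RLCST (fA a) (fB b)) - 2 ^ (t div 2) * tropical_similarity t a b * real L\<bar>
               \<le> real c * real L \<and>
             \<bar>real (LCST (fA a) (fB b)) - 2 ^ (t div 2) * tropical_similarity t a b * real L\<bar>
               \<le> real c * real L \<and>
             (tropical_similarity t a b = 1 \<longrightarrow>
               RLCST (fA a) (fB b) = size (fA a) \<and> LCST (fA a) (fB b) = size (fA a))))"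
\<comment> \<open>The exponent 1 suffices: the size of a tree is at most linear in
  \<open>2 ^ t * L\<close>, and the time in \<open>N * 2 ^ t * L\<close>.\<close>
proof (rule exI[of _ tree_program], rule exI[of _ 10000], rule exI[of _ 1], intro allI impI, elim conjE, goal_cases)
  case (1 t N L A B)
  then have h: "even t" "1 \<le> N" "2 ^ t \<le> L" "A \<subseteq> tensors t" "card A = N" "B \<subseteq> tensors t" "card B = N"
    "\<And>a. a \<in> A \<Longrightarrow> max_invariant t a" by auto
  show ?case
  proof (rule exI[of _ "gadget_tree False t L"], rule exI[of _ "gadget_tree True t L"], intro conjI allI impI ballI)
    fix xs ys w
    assume a: "distinct xs \<and> set xs = A \<and> distinct ys \<and> set ys = B \<and> 10000 * (N * 2 ^ t * L) ^ 1 \<le> 2 ^ w"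
    then have "length xs = N" "length ys = N" using h distinct_card by metis+
    then show "\<exists>n s. exec w tree_program (input_state t N L xs ys) n s \<and>
        n \<le> 10000 * N * (2 ^ t) ^ 1 * L \<and>
        written s = concat (map encode_tree (map (gadget_tree False t L) xs @ map (gadget_tree True t L) ys))"
      using tree_program_spec[of N t L xs ys w] h a by (simp add: mult.assoc)
  next
    fix T assume "T \<in> gadget_tree False t L ` A \<union> gadget_tree True t L ` B"
    then obtain full x where T: "T = gadget_tree full t L x" by blast
    show "T \<noteq> Leaf" unfolding T by (rule gadget_tree_not_Leaf)
    have "18 * 2 ^ t * L \<le> 10000 * (2 ^ t) ^ 1 * L" by (intro mult_le_mono1) simp
    then show "size T \<le> 10000 * (2 ^ t) ^ 1 * L"
      unfolding T using size_gadget_tree[OF h(3), of full x] by (rule le_trans[rotated])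
    have "1 \<le> L" using h(3) one_le_power[of "2::nat" t] by linarith
    then have "0 \<le> (2 ^ (t div 2) + log 2 (real L)) * real t" by (intro mult_nonneg_nonneg add_nonneg_nonneg) auto
    then show "real (depth T) \<le> real 10000 * ((2 ^ (t div 2) + log 2 (real L)) * real t)"
      using depth_gadget_tree[OF h(3,1), of full x] unfolding T by linarith
  next
    fix a b assume ab: "a \<in> A" "b \<in> B"
    have "a \<in> tensors t" "max_invariant t a" "b \<in> tensors t" using ab h by auto
    note sim = gadget_tree_similarity[OF h(1,3) this]
    have "real (RLCST (gadget_tree False t L a) (gadget_tree True t L b)) \<le> real (LCST (gadget_tree False t L a) (gadget_tree True t L b))"
      using sim(2) by (simp only: of_nat_le_iff)
    then show "\<bar>real (RLCST (gadget_tree False t L a) (gadget_tree True t L b)) - 2 ^ (t div 2) * tropical_similarity t a b * real L\<bar>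
        \<le> real 10000 * real L"
      "\<bar>real (LCST (gadget_tree False t L a) (gadget_tree True t L b)) - 2 ^ (t div 2) * tropical_similarity t a b * real L\<bar>
        \<le> real 10000 * real L"
      using sim(1,3) by linarith+
    assume "tropical_similarity t a b = 1"
    then show "RLCST (gadget_tree False t L a) (gadget_tree True t L b) = size (gadget_tree False t L a)"
      "LCST (gadget_tree False t L a) (gadget_tree True t L b) = size (gadget_tree False t L a)"
      using sim(4) by auto
  qed
qed

end
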